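(* Let $r\in\mathbb{N}$, $1\le p\le\infty$, and $f\in L_p[-1,1]$. Let $\delta,\gamma\ge0$, $\Lambda>0$, and suppose that $w$ is a doubling weight from the class $\mathcal{W}^{\delta,\gamma}_\Lambda$ with $\gamma\le r\lambda_p$. Then, for all $n\in\mathbb{N}$, $$\omega_\varphi^r(f,n^{-1})_{p,w_n}\le\frac{c}{n^{r-\delta/\lambda_p}}\sum_{k=1}^n k^{r-1-\delta/\lambda_p}E_k(f)_{p,w_k},$$ where the constant $c$ depends only on $r$, $p$, $\delta$, $\gamma$, $\Lambda$, and the doubling constant of the weight $w$.
   Context: A doubling weight is a nonnegative $w\in L_1[-1,1]$, extended by $0$ outside $[-1,1]$, for which there is a constant $L$ (the doubling constant of $w$) with $\int_{2I}w\le L\int_I w$ for all intervals $I\subset[-1,1]$, where $2I$ is the interval with the same center as $I$ and twice its length. Let $\varphi(x)=\sqrt{1-x^2}$, $\rho_n(x)=n^{-1}\sqrt{1-x^2}+n^{-2}$, and $w_n(x)=\frac{1}{\rho_n(x)}\int_{x-\rho_n(x)}^{x+\rho_n(x)}w(u)\,du$. Class $\mathcal{W}^{\delta,\gamma}_\Lambda$ ($\delta,\gamma\ge0$, $\Lambda>0$): all doubling weights $w$ such that for all $m,n\in\mathbb{N}$ with $m\le n$ and all $x\in[-1,1]$, $w_n(x)\varphi(x)^\gamma\le\Lambda n^\delta m^{\gamma-\delta}\rho_m(x)^\gamma w_m(x)$ (with $\varphi(x)^0=1$). $\lambda_p=p$ if $p<\infty$, $\lambda_\infty=1$. For a weight $v$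 on $[-1,1]$: $\|g\|_{p,v}=\left(\int_{-1}^1|g|^p v\right)^{1/p}$ if $p<\infty$, $\|g\|_{\infty,v}=\operatorname{ess\,sup}_{[-1,1]}|g|v$. $\Pi_n$ is the set of algebraic polynomials of degree $\le n-1$ and $E_n(f)_{p,v}=\inf_{P\in\Pi_n}\|f-P\|_{p,v}$. Symmetric difference: $\Delta_h^r(f,x)=\sum_{i=0}^r\binom ri(-1)^{r-i}f(x-rh/2+ih)$ if $x\pm rh/2\in[-1,1]$, and $0$ otherwise. Modulus: $\omega_\varphi^r(f,t)_{p,v}=\sup_{0<h\le t}\|\Delta_{h\varphi(\cdot)}^r(f,\cdot)\|_{p,v}$. *)

theory Defs
  imports
    "HOL-Probability.Essential_Supremum"
    "HOL-Computational_Algebra.Polynomial"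
begin

text \<open>The weight is extended by zero outside \<open>[-1,1]\<close>. Closed intervals \<open>I = [a,b]\<close> suffice,
  as the integrals do not see the endpoints; the doubled interval \<open>2I\<close> may leave \<open>[-1,1]\<close>.
  \<open>L\<close> is any admissible constant, not necessarily the least one.\<close>

definition doubling_weight :: "real \<Rightarrow> (real \<Rightarrow> real) \<Rightarrow> bool" where
  "doubling_weight L w \<longleftrightarrow>
     (\<forall>x. 0 \<le> w x) \<and> (\<forall>x. x \<notin> {-1..1} \<longrightarrow> w x = 0) \<and>
     set_integrable lebesgue {-1..1} w \<and>
     (\<forall>a b. -1 \<le> a \<and> a \<le> b \<and> b \<le> 1 \<longrightarrow>
        (LINT u:{(a + b) / 2 - (b - a)..(a + b) / 2 + (b - a)}|lebesgue. w u)
          \<le> L * (LINT u:{a..b}|lebesgue. w u))"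

definition phi :: "real \<Rightarrow> real" where
  "phi x = sqrt (1 - x\<^sup>2)"

definition rho :: "nat \<Rightarrow> real \<Rightarrow> real" where
  "rho n x = sqrt (1 - x\<^sup>2) / real n + 1 / (real n)\<^sup>2"

definition avg_weight :: "(real \<Rightarrow> real) \<Rightarrow> nat \<Rightarrow> real \<Rightarrow> real" where
  "avg_weight w n x = (1 / rho n x) * (LINT u:{x - rho n x..x + rho n x}|lebesgue. w u)"

text \<open>The case distinction implements \<open>\<phi>(x)\<^sup>0 = 1\<close> also at \<open>x = \<plusminus>1\<close>, since \<open>0 powr 0 = 0\<close>.\<close>

definition W_class :: "real \<Rightarrow> real \<Rightarrow> real \<Rightarrow> (real \<Rightarrow> real) set" where
  "W_class \<delta> \<gamma> \<Lambda> = {w. (\<exists>L. doubling_weight L w) \<and>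
     (\<forall>m n x. 1 \<le> m \<and> m \<le> n \<and> x \<in> {-1..1} \<longrightarrow>
        avg_weight w n x * (if \<gamma> = 0 then 1 else phi x powr \<gamma>)
          \<le> \<Lambda> * real n powr \<delta> * real m powr (\<gamma> - \<delta>) * rho m x powr \<gamma> * avg_weight w m x)}"

text \<open>The exponent \<open>p\<close> ranges over \<open>ennreal\<close>, with \<open>p = \<infinity>\<close> admitted.\<close>

definition lam :: "ennreal \<Rightarrow> real" where
  "lam p = (if p = \<infinity> then 1 else enn2real p)"

text \<open>Weighted norms take values in \<open>[0,\<infinity>]\<close>; the innermost case distinction is the
  \<open>p\<close>-th root on \<open>[0,\<infinity>]\<close>.\<close>

definition wnorm :: "ennreal \<Rightarrow> (real \<Rightarrow> real) \<Rightarrow> (real \<Rightarrow> real) \<Rightarrow> ennreal" where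
  "wnorm p v g =
     (if p = \<infinity> then esssup (lebesgue_on {-1..1}) (\<lambda>x. ennreal (\<bar>g x\<bar> * v x))
      else (let I = (\<integral>\<^sup>+ x. ennreal (\<bar>g x\<bar> powr enn2real p * v x) \<partial>lebesgue_on {-1..1})
            in if I = \<infinity> then \<infinity> else ennreal (enn2real I powr (1 / enn2real p))))"

definition Lp_space :: "ennreal \<Rightarrow> (real \<Rightarrow> real) set" where
  "Lp_space p = {f. f \<in> borel_measurable (lebesgue_on {-1..1}) \<and> wnorm p (\<lambda>_. 1) f < \<infinity>}"

text \<open>For \<open>n \<ge> 1\<close>: polynomials of degree at most \<open>n - 1\<close>, including zero.\<close>

definition Pi_polys :: "nat \<Rightarrow> real poly set" where
  "Pi_polys n = {P. degree P < n}"

definition best_approx :: "nat \<Rightarrow> (real \<Rightarrow> real) \<Rightarrow> ennreal \<Rightarrow> (real \<Rightarrow> real) \<Rightarrow> ennreal" where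
  "best_approx n f p v = (INF P\<in>Pi_polys n. wnorm p v (\<lambda>x. f x - poly P x))"

definition symmetric_difference :: "nat \<Rightarrow> real \<Rightarrow> (real \<Rightarrow> real) \<Rightarrow> real \<Rightarrow> real" where
  "symmetric_difference r h f x =
     (if x - real r * h / 2 \<in> {-1..1} \<and> x + real r * h / 2 \<in> {-1..1}
      then \<Sum>i=0..r. real (r choose i) * (-1) ^ (r - i) * f (x - real r * h / 2 + real i * h)
      else 0)"

definition modulus :: "nat \<Rightarrow> (real \<Rightarrow> real) \<Rightarrow> real \<Rightarrow> ennreal \<Rightarrow> (real \<Rightarrow> real) \<Rightarrow> ennreal" where
  "modulus r f t p v = (SUP h\<in>{0<..t}. wnorm p v (\<lambda>x. symmetric_difference r (h * phi x) f x))"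

end

theory Submission
  imports Defs "HOL-Complex_Analysis.Complex_Analysis"
begin

text \<open>Put \<open>E(x,t) = 1 + \<bar>x - t\<bar>/\<rho>\<^sub>m(x)\<close>. Multiply a polynomial \<open>Q\<close> of degree below \<open>m\<close> by a power of a
  Fejer-type polynomial which is \<open>\<ge> 1\<close> at \<open>x\<close> and at most a constant times \<open>E(x,t)\<^sup>-\<^sup>M\<close> elsewhere. The
  antiderivative of the product is bounded on \<open>[-1,1]\<close> by its \<open>L\<^sub>1\<close> norm, hence, by Bernstein--Walsh,
  on the complex disc of radius \<open>\<rho>\<^sub>m(x)\<close> about \<open>x\<close>, and Cauchy's estimates give
  \<open>\<bar>Q\<^sup>(\<^sup>r\<^sup>)(x)\<bar> \<le> C \<rho>\<^sub>m(x)\<^sup>-\<^sup>r\<^sup>-\<^sup>1 \<integral> \<bar>Q(t)\<bar> E(x,t)\<^sup>-\<^sup>M dt\<close>.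
  Doubling makes \<open>w\<^sub>m(x)/w\<^sub>m(t)\<close> at most a power of \<open>E(x,t)\<close>, so the kernel absorbs the weight and Schur's test,
  together with the class condition comparing \<open>w\<^sub>n\<close> with \<open>w\<^sub>m\<close>, bounds the differences of \<open>Q\<close> for
  all \<open>p\<close> at once. The theorem then follows from telescoping near-best approximants of dyadic degrees.\<close>

section \<open>Geometry of \<open>\<rho>\<^sub>n\<close> and growth of the averaged weights\<close>

text \<open>The class condition bounds \<open>w_n\<close> only after multiplication by
  \<open>phi x powr \<gamma>\<close>, so near the endpoints it does not compare \<open>w_n\<close>
  with \<open>w_m\<close> by itself. It becomes usable because a difference of step
  \<open>h * phi x\<close> of a polynomial carries a factor \<open>phi x ^ r\<close>: as \<gamma>
  \<le> r \<lambda>, the part of exponent \<gamma>/\<lambda> feeds the condition and the rest is at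
  most a power of \<open>m * rho m x\<close>. The gain (m/n)^r and the loss
  (n/m)^(\<delta>/\<lambda>) combine to the exponent r - \<delta>/\<lambda> of the theorem. The
  remainder f - P for the last approximant P has no such structure; its differences are bounded by a
  change of variable, at the one degree comparable with n, where doubling alone compares the
  weights. Nothing makes the errors with weights \<open>w_k\<close> decrease in k, since the weight
  changes along with the degree. Going from k to at most 2k costs only a factor 4, which is enough
  to pass from dyadic k to the full sum.\<close>

lemma rho_pos: "1 \<le> n \<Longrightarrow> x \<in> {-1..1} \<Longrightarrow> 0 < rho n x"
  by (auto simp: rho_def abs_square_le_1 intro!: add_nonneg_pos divide_nonneg_nonneg)

lemma phi_nonneg: "x \<in> {-1..1} \<Longrightarrow> 0 \<le> phi x"
  by (auto simp: phi_def abs_square_le_1)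

lemma rho_phi: "rho n x = phi x / real n + 1 / (real n)\<^sup>2"
  by (simp add: rho_def phi_def)

lemma inverse_square_le_rho: "x \<in> {-1..1} \<Longrightarrow> 1 / (real n)\<^sup>2 \<le> rho n x"
  using phi_nonneg[of x] by (simp add: rho_phi)

lemma phi_le_rho: "1 \<le> n \<Longrightarrow> phi x / real n \<le> rho n x"
  by (simp add: rho_phi)

text \<open>\<open>phi\<close> is only Holder continuous of order 1/2 at the endpoints, hence the
  square root: the squares of \<open>phi t\<close> and \<open>phi x\<close> differ by (x - t)(x +
  t), and the second factor is at most 2 in modulus.\<close>

lemma phi_le_add:
  assumes "x \<in> {-1..1}" "t \<in> {-1..1}"
  shows "phi t \<le> phi x + sqrt (2 * \<bar>x - t\<bar>)"
proof -
  have sq: "(phi u)\<^sup>2 = 1 - u\<^sup>2" if "u \<in> {-1..1}" for u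
    using that by (simp add: phi_def abs_square_le_1 abs_le_iff)
  have "(phi t)\<^sup>2 = (phi x)\<^sup>2 + (x - t) * (x + t)"
    unfolding sq[OF assms(1)] sq[OF assms(2)] by (simp add: power2_eq_square algebra_simps)
  also have "(x - t) * (x + t) \<le> \<bar>x - t\<bar> * 2"
    using assms by (intro order_trans[OF abs_ge_self[of "(x - t) * (x + t)"]])
      (auto simp: abs_mult intro!: mult_left_mono)
  also have "(phi x)\<^sup>2 + \<bar>x - t\<bar> * 2 \<le> (phi x + sqrt (2 * \<bar>x - t\<bar>))\<^sup>2"
    using phi_nonneg[OF assms(1)] by (simp add: power2_sum)
  finally show ?thesis
    using phi_nonneg[OF assms(1)] by (intro power2_le_imp_le[of "phi t"]) auto
qed

lemma rho_le_add:
  assumes "x \<in> {-1..1}" "t \<in> {-1..1}" "1 \<le> n"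
  shows "rho n t \<le> rho n x + sqrt (2 * \<bar>x - t\<bar>) / real n"
  using phi_le_add[OF assms(1,2)] assms(3) by (simp add: rho_phi add_divide_distrib[symmetric] divide_right_mono)

text \<open>The scale is taken at the first point, so this is not symmetric; exchanging the points
  costs a square (\<open>dil_le_swap\<close>), which later fixes the exponent in
  \<open>kern\<close>.\<close>

definition dil :: "nat \<Rightarrow> real \<Rightarrow> real \<Rightarrow> real" where
  "dil n x t = 1 + \<bar>x - t\<bar> / rho n x"

lemma dil_ge_1: "1 \<le> n \<Longrightarrow> x \<in> {-1..1} \<Longrightarrow> 1 \<le> dil n x t"
  using rho_pos[of n x] by (simp add: dil_def)

lemma dil_mult_rho:
  assumes "1 \<le> n" "x \<in> {-1..1}"
  shows "dil n x t * rho n x = rho n x + \<bar>x - t\<bar>"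
  using rho_pos[OF assms] by (simp add: dil_def field_simps)

lemma sqrt_div_eq: "1 \<le> n \<Longrightarrow> sqrt (2 * y) / real n = sqrt ((2 * y) * (1 / (real n)\<^sup>2))"
  by (simp add: real_sqrt_divide real_sqrt_mult)

text \<open>The arithmetic-geometric mean inequality splits the square root in
  \<open>rho_le_add\<close> into the distance and half of 1/n^2, which is at most half of
  \<open>rho n x\<close>.\<close>

lemma rho_le_dil_right:
  assumes "1 \<le> n" "x \<in> {-1..1}" "t \<in> {-1..1}"
  shows "rho n t \<le> 2 * dil n x t * rho n x"
proof -
  define q where "q = sqrt (2 * \<bar>x - t\<bar>) / real n"
  have "q \<le> (2 * \<bar>x - t\<bar> + 1 / (real n)\<^sup>2) / 2"
    unfolding q_def sqrt_div_eq[OF assms(1)] by (rule arith_geo_mean_sqrt) auto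
  also have "\<dots> \<le> \<bar>x - t\<bar> + rho n x / 2"
    using inverse_square_le_rho[OF assms(2), of n] by (simp add: field_simps)
  finally have "rho n t \<le> 2 * (rho n x + \<bar>x - t\<bar>)"
    using rho_le_add[OF assms(2,3,1), folded q_def] rho_pos[OF assms(1,2)] abs_ge_zero[of "x - t"] by argo
  then show ?thesis using dil_mult_rho[OF assms(1,2), of t] by (simp add: mult.assoc)
qed

text \<open>Here \<open>rho n x\<close> itself is taken as one factor under the square root, since
  |x - t| = \<open>rho n x\<close> times (dil - 1). After the mean inequality half of it is absorbed
  on the left.\<close>

lemma rho_le_dil_left:
  assumes "1 \<le> n" "x \<in> {-1..1}" "t \<in> {-1..1}"
  shows "rho n x \<le> 2 * dil n x t * rho n t"
proof -
  have E: "1 \<le> dil n x t" using dil_ge_1[OF assms(1,2)] .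
  have eq: "(2 * \<bar>t - x\<bar>) * (1 / (real n)\<^sup>2) = rho n x * (2 * (dil n x t - 1) / (real n)\<^sup>2)"
    using rho_pos[OF assms(1,2)] by (simp add: dil_def field_simps abs_minus_commute)
  define q where "q = sqrt (2 * \<bar>t - x\<bar>) / real n"
  define B where "B = 2 * (dil n x t - 1) * rho n t"
  define A where "A = 2 * (dil n x t - 1) / (real n)\<^sup>2"
  have "q \<le> (rho n x + A) / 2"
    unfolding q_def A_def sqrt_div_eq[OF assms(1)] eq using E rho_pos[OF assms(1,2)]
    by (intro arith_geo_mean_sqrt) auto
  moreover have "A \<le> B"
    unfolding A_def B_def using E mult_left_mono[OF inverse_square_le_rho[OF assms(3), of n], of "2 * (dil n x t - 1)"] by simp
  ultimately have "rho n x \<le> rho n t + (rho n x + B) / 2"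
    using rho_le_add[OF assms(3,2,1), folded q_def] by argo
  then have "rho n x \<le> 2 * rho n t + B" by argo
  then show ?thesis unfolding B_def by (simp add: algebra_simps)
qed

lemma dil_le_swap:
  assumes "1 \<le> n" "x \<in> {-1..1}" "t \<in> {-1..1}"
  shows "dil n t x \<le> 2 * (dil n x t)\<^sup>2"
proof -
  have p: "0 < rho n x" "0 < rho n t" using rho_pos assms by auto
  have E: "1 \<le> dil n x t" using dil_ge_1[OF assms(1,2)] .
  have "1 / rho n t \<le> 2 * dil n x t / rho n x"
    using rho_le_dil_left[OF assms] p by (simp add: field_simps)
  then have "\<bar>x - t\<bar> * (1 / rho n t) \<le> \<bar>x - t\<bar> * (2 * dil n x t / rho n x)"
    by (intro mult_left_mono) auto
  also have "\<dots> = (dil n x t - 1) * (2 * dil n x t)"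
    by (simp add: dil_def)
  finally have "\<bar>x - t\<bar> / rho n t \<le> (dil n x t - 1) * (2 * dil n x t)" by simp
  then have "dil n t x \<le> 1 + (dil n x t - 1) * (2 * dil n x t)"
    by (simp add: dil_def[of n t x] abs_minus_commute)
  also have "\<dots> \<le> 2 * (dil n x t)\<^sup>2" using E by (simp add: power2_eq_square algebra_simps)
  finally show ?thesis .
qed

lemma rho_antimono: "1 \<le> m \<Longrightarrow> m \<le> n \<Longrightarrow> x \<in> {-1..1} \<Longrightarrow> rho n x \<le> rho m x"
  unfolding rho_phi
  by (intro add_mono frac_le power_mono phi_nonneg) auto

lemma rho_double: "1 \<le> m \<Longrightarrow> n \<le> 2 * m \<Longrightarrow> 1 \<le> n \<Longrightarrow> x \<in> {-1..1} \<Longrightarrow> rho m x \<le> 4 * rho n x"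
proof -
  assume a: "1 \<le> m" "n \<le> 2 * m" "1 \<le> n" "x \<in> {-1..1}"
  then have n: "real n \<le> 2 * real m" "0 < real n" "0 < real m" by linarith+
  have "phi x / real m \<le> phi x / (real n / 2)"
    using n phi_nonneg[OF a(4)] by (intro divide_left_mono) auto
  moreover have "1 / (real m)\<^sup>2 \<le> 1 / (real n / 2)\<^sup>2"
    using n by (intro divide_left_mono power_mono) auto
  moreover have "phi x / (real n / 2) \<le> 4 * (phi x / real n)"
    using phi_nonneg[OF a(4)] n by (simp add: field_simps)
  moreover have "1 / (real n / 2)\<^sup>2 = 4 * (1 / (real n)\<^sup>2)"
    by (simp add: power_divide)
  ultimately show ?thesis unfolding rho_phi distrib_left by linarith
qed

section \<open>Integrals of a doubling weight over growing intervals\<close>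

definition wint :: "(real \<Rightarrow> real) \<Rightarrow> real \<Rightarrow> real \<Rightarrow> real" where
  "wint w a b = (LINT u:{a..b}|lebesgue. w u)"

lemma avg_weight_wint: "avg_weight w n x = wint w (x - rho n x) (x + rho n x) / rho n x"
  by (simp add: avg_weight_def wint_def)

lemma doubling_integrable:
  assumes "doubling_weight L w" shows "integrable lebesgue w"
proof -
  have "(\<lambda>x. indicator {-1..1} x *\<^sub>R w x) = w"
    using assms by (auto simp: doubling_weight_def indicator_def fun_eq_iff)
  then show ?thesis using assms by (simp add: doubling_weight_def set_integrable_def)
qed

lemma doubling_nonneg: "doubling_weight L w \<Longrightarrow> 0 \<le> w x"
  by (simp add: doubling_weight_def)

lemma doubling_set_integrable: "doubling_weight L w \<Longrightarrow> set_integrable lebesgue {a..b} w"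
  using doubling_integrable[of L w] unfolding set_integrable_def
  by (intro integrable_mult_indicator) auto

lemma wint_nonneg: "doubling_weight L w \<Longrightarrow> 0 \<le> wint w a b"
  unfolding wint_def set_lebesgue_integral_def
  by (intro Bochner_Integration.integral_nonneg) (auto simp: doubling_nonneg)

lemma wint_mono:
  assumes "doubling_weight L w" "c \<le> a" "b \<le> d"
  shows "wint w a b \<le> wint w c d"
  unfolding wint_def set_lebesgue_integral_def
  using assms doubling_set_integrable[OF assms(1)]
  by (intro integral_mono) (auto simp: indicator_def doubling_nonneg set_integrable_def)

lemma wint_clip:
  assumes "doubling_weight L w"
  shows "wint w a b = wint w (max (-1) a) (min 1 b)"
  unfolding wint_def set_lebesgue_integral_def using assms
  by (intro Bochner_Integration.integral_cong) (auto simp: indicator_def doubling_weight_def)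

lemma wint_double:
  assumes "doubling_weight L w" "-1 \<le> a" "a \<le> b" "b \<le> 1"
  shows "wint w ((3 * a - b) / 2) ((3 * b - a) / 2) \<le> L * wint w a b"
proof -
  have eq: "(3 * a - b) / 2 = (a + b) / 2 - (b - a)" "(3 * b - a) / 2 = (a + b) / 2 + (b - a)"
    by (auto simp: field_simps)
  show ?thesis using assms unfolding wint_def eq doubling_weight_def by blast
qed

text \<open>An interval about \<open>t \<in> [-1,1]\<close> that is clipped to \<open>[-1,1]\<close> has at least half its length,
  so two doublings (with clipping in between) cover the doubled interval.\<close>

lemma wint_double_clipped:
  assumes "doubling_weight L w" "0 \<le> L" "t \<in> {-1..1}" "0 < d"
  shows "wint w (t - 2 * d) (t + 2 * d) \<le> L\<^sup>2 * wint w (t - d) (t + d)"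
proof -
  define a b where "a = max (-1) (t - d)" and "b = min 1 (t + d)"
  define a' b' where "a' = max (-1) ((3 * a - b) / 2)" and "b' = min 1 ((3 * b - a) / 2)"
  have ab: "-1 \<le> a" "a \<le> b" "b \<le> 1" using assms(3,4) by (auto simp: a_def b_def)
  have le: "a' \<le> a" "b \<le> b'" "a \<le> t" "t \<le> b"
    using ab assms(3,4) by (simp_all add: a'_def b'_def) (simp_all add: a_def b_def)
  then have "a' \<le> b'" by linarith
  then have ab': "-1 \<le> a'" "a' \<le> b'" "b' \<le> 1" by (simp_all add: a'_def b'_def)
  \<comment> \<open>If the first doubling has not reached -1, then a = t - d and b - a \<ge> d. The
    two doublings then move the left end by at least d/2 and 3d/4, more than the d that is needed.
    The right end is symmetric.\<close>
  have "a' = -1 \<or> (a = t - d \<and> 2 * a' = 3 * a - b)"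
    using ab by (cases "a = -1") (auto simp: a'_def max_def a_def split: if_splits)
  moreover obtain M where M: "M = max (-1) (t - 2 * d)" "-1 \<le> M" "t - 2 * d \<le> M" by simp
  ultimately have "3 * a' - b' \<le> 2 * M"
    using le ab ab' assms(4) M(2,3) by (elim disjE conjE) linarith+
  then have in1: "(3 * a' - b') / 2 \<le> max (-1) (t - 2 * d)" using M(1) by simp
  have "b' = 1 \<or> (b = t + d \<and> 2 * b' = 3 * b - a)"
    using ab by (cases "b = 1") (auto simp: b'_def min_def b_def split: if_splits)
  moreover obtain N where N: "N = min 1 (t + 2 * d)" "N \<le> 1" "N \<le> t + 2 * d" by simp
  ultimately have "2 * N \<le> 3 * b' - a'"
    using le ab ab' assms(4) N(2,3) by (elim disjE conjE) linarith+
  then have in2: "min 1 (t + 2 * d) \<le> (3 * b' - a') / 2" using N(1) by simp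
  have "wint w (t - 2 * d) (t + 2 * d) = wint w (max (-1) (t - 2 * d)) (min 1 (t + 2 * d))"
    by (rule wint_clip[OF assms(1)])
  also have "\<dots> \<le> wint w ((3 * a' - b') / 2) ((3 * b' - a') / 2)"
    by (rule wint_mono[OF assms(1) in1 in2])
  also have "\<dots> \<le> L * wint w a' b'" by (rule wint_double[OF assms(1) ab'])
  also have "wint w a' b' = wint w ((3 * a - b) / 2) ((3 * b - a) / 2)"
    unfolding a'_def b'_def by (rule wint_clip[OF assms(1), symmetric])
  also have "L * \<dots> \<le> L * (L * wint w a b)"
    by (intro mult_left_mono wint_double[OF assms(1) ab] assms)
  also have "wint w a b = wint w (t - d) (t + d)"
    unfolding a_def b_def by (rule wint_clip[OF assms(1), symmetric])
  finally show ?thesis by (simp add: power2_eq_square mult.assoc)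
qed

lemma wint_double_iter:
  assumes "doubling_weight L w" "0 \<le> L" "t \<in> {-1..1}" "0 < d"
  shows "wint w (t - 2 ^ k * d) (t + 2 ^ k * d) \<le> (L\<^sup>2) ^ k * wint w (t - d) (t + d)"
proof (induction k)
  case (Suc k)
  have "wint w (t - 2 * (2 ^ k * d)) (t + 2 * (2 ^ k * d)) \<le> L\<^sup>2 * wint w (t - 2 ^ k * d) (t + 2 ^ k * d)"
    using assms by (intro wint_double_clipped) auto
  also have "\<dots> \<le> L\<^sup>2 * ((L\<^sup>2) ^ k * wint w (t - d) (t + d))"
    by (intro mult_left_mono Suc) auto
  finally show ?case by (simp add: mult.assoc)
qed simp

lemma ex_power_two_between:
  assumes "1 \<le> (y::real)" shows "\<exists>k. y \<le> 2 ^ k \<and> 2 ^ k \<le> 2 * y"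
proof -
  define k where "k = (LEAST k. y \<le> 2 ^ k)"
  obtain j where "y < 2 ^ j" using real_arch_pow[of 2 y] by auto
  then have k: "y \<le> 2 ^ k" unfolding k_def by (rule LeastI[of "\<lambda>k. y \<le> 2 ^ k" j, OF less_imp_le])
  moreover have "2 ^ k \<le> 2 * y"
  proof (cases k)
    case (Suc i)
    then have "\<not> y \<le> 2 ^ i" using not_less_Least[of i "\<lambda>k. y \<le> 2 ^ k", folded k_def] by simp
    then show ?thesis using Suc by simp
  qed (use assms in simp)
  ultimately show ?thesis by blast
qed

text \<open>With \<open>L\<^sup>2 \<le> 2 ^ s\<close>, k doublings cost at most (2^k)^s, which turns
  the doubling constant into a polynomial degree \<open>s\<close>. Rounding y up to a power of two
  gives the 2 in \<open>2 * y\<close>.\<close>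

lemma wint_growth:
  assumes "doubling_weight L w" "0 \<le> L" "L\<^sup>2 \<le> 2 ^ s" "t \<in> {-1..1}" "0 < d" "1 \<le> y"
  shows "wint w (t - y * d) (t + y * d) \<le> (2 * y) ^ s * wint w (t - d) (t + d)"
proof -
  obtain k where k: "y \<le> 2 ^ k" "2 ^ k \<le> 2 * y" using ex_power_two_between[OF assms(6)] by auto
  have "wint w (t - y * d) (t + y * d) \<le> wint w (t - 2 ^ k * d) (t + 2 ^ k * d)"
    using k assms(5) by (intro wint_mono[OF assms(1)]) auto
  also have "\<dots> \<le> (L\<^sup>2) ^ k * wint w (t - d) (t + d)"
    by (rule wint_double_iter) fact+
  also have "\<dots> \<le> (2 * y) ^ s * wint w (t - d) (t + d)"
  proof (intro mult_right_mono wint_nonneg[OF assms(1)])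
    have "(L\<^sup>2) ^ k \<le> (2 ^ s) ^ k" using assms(3) by (intro power_mono) auto
    also have "\<dots> = (2 ^ k) ^ s" by (simp add: power_mult[symmetric] mult.commute)
    also have "\<dots> \<le> (2 * y) ^ s" using k by (intro power_mono) auto
    finally show "(L\<^sup>2) ^ k \<le> (2 * y) ^ s" .
  qed
  finally show ?thesis .
qed

section \<open>Growth and measurability of the averaged weights\<close>

lemma avg_weight_nonneg:
  assumes "doubling_weight L w" "1 \<le> n" "x \<in> {-1..1}" shows "0 \<le> avg_weight w n x"
  unfolding avg_weight_wint
  by (intro divide_nonneg_pos wint_nonneg[OF assms(1)] rho_pos[OF assms(2,3)])

text \<open>The averaging window at x lies in the interval about t of radius
  \<open>2 * E\<^sup>2 * rho n t\<close>, so \<open>wint_growth\<close> contributes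
  \<open>4 ^ s * E ^ (2 * s)\<close>. The quotient of the two window lengths contributes the
  remaining 2 E.\<close>

lemma avg_weight_growth:
  assumes "doubling_weight L w" "0 \<le> L" "L\<^sup>2 \<le> 2 ^ s" "1 \<le> n" "x \<in> {-1..1}" "t \<in> {-1..1}"
  shows "avg_weight w n x \<le> 2 * 4 ^ s * dil n x t ^ (2 * s + 1) * avg_weight w n t"
proof -
  define E where "E = dil n x t"
  have E: "1 \<le> E" unfolding E_def by (rule dil_ge_1) fact+
  have p: "0 < rho n x" "0 < rho n t" using rho_pos assms by auto
  have r: "rho n x + \<bar>x - t\<bar> \<le> (2 * E\<^sup>2) * rho n t"
  proof -
    have "rho n x + \<bar>x - t\<bar> = E * rho n x" using dil_mult_rho assms by (simp add: E_def)
    also have "\<dots> \<le> E * (2 * E * rho n t)"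
      using E rho_le_dil_left[OF assms(4-6)] by (intro mult_left_mono) (auto simp: E_def)
    finally show ?thesis by (simp add: power2_eq_square algebra_simps)
  qed
  have "wint w (x - rho n x) (x + rho n x) \<le> wint w (t - (2 * E\<^sup>2) * rho n t) (t + (2 * E\<^sup>2) * rho n t)"
    using r by (intro wint_mono[OF assms(1)]) linarith+
  also have "\<dots> \<le> (2 * (2 * E\<^sup>2)) ^ s * wint w (t - rho n t) (t + rho n t)"
    using p one_le_power[OF E, of 2] by (intro wint_growth[OF assms(1-3)] assms) auto
  also have "(2 * (2 * E\<^sup>2)) ^ s = 4 ^ s * E ^ (2 * s)"
    by (simp add: power_mult_distrib power_mult)
  also have "wint w (t - rho n t) (t + rho n t) = avg_weight w n t * rho n t"
    using p by (simp add: avg_weight_wint)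
  finally have *: "wint w (x - rho n x) (x + rho n x) \<le> 4 ^ s * E ^ (2 * s) * (avg_weight w n t * rho n t)" .
  have "avg_weight w n x \<le> 4 ^ s * E ^ (2 * s) * (avg_weight w n t * rho n t) / rho n x"
    unfolding avg_weight_wint[of w n x] using * p by (intro divide_right_mono) auto
  also have "\<dots> = 4 ^ s * E ^ (2 * s) * avg_weight w n t * (rho n t / rho n x)" by simp
  also have "\<dots> \<le> 4 ^ s * E ^ (2 * s) * avg_weight w n t * (2 * E)"
    using rho_le_dil_right[OF assms(4-6)] p E avg_weight_nonneg[OF assms(1,4,6)]
    by (intro mult_left_mono) (auto simp: field_simps E_def)
  finally show ?thesis by (simp add: E_def algebra_simps)
qed

lemma avg_weight_double:
  assumes "doubling_weight L w" "1 \<le> m" "m \<le> n" "n \<le> 2 * m" "x \<in> {-1..1}"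
  shows "avg_weight w n x \<le> 4 * avg_weight w m x"
proof -
  have p: "0 < rho m x" "0 < rho n x" using rho_pos assms by auto
  have "wint w (x - rho n x) (x + rho n x) \<le> wint w (x - rho m x) (x + rho m x)"
    using rho_antimono[OF assms(2,3,5)] by (intro wint_mono[OF assms(1)]) auto
  then have "avg_weight w n x \<le> wint w (x - rho m x) (x + rho m x) / rho n x"
    unfolding avg_weight_wint using p by (intro divide_right_mono) auto
  also have "\<dots> \<le> wint w (x - rho m x) (x + rho m x) / (rho m x / 4)"
    using rho_double[OF assms(2,4) _ assms(5)] assms p wint_nonneg[OF assms(1)]
    by (intro divide_left_mono) auto
  finally show ?thesis by (simp add: avg_weight_wint mult.commute)
qed

lemma rho_measurable [measurable]: "rho n \<in> borel_measurable borel"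
  unfolding rho_def by measurable

lemma phi_measurable [measurable]: "phi \<in> borel_measurable borel"
  unfolding phi_def by measurable

text \<open>The weight is only Lebesgue measurable, but a window integral is a difference of two
  values of the increasing primitive \<open>W\<close>, hence Borel. This is what the later
  composition with \<open>x + c * phi x\<close> requires.\<close>

lemma avg_weight_measurable [measurable]:
  assumes "doubling_weight L w" shows "avg_weight w n \<in> borel_measurable borel"
proof -
  define W where "W = (\<lambda>s. LINT u:{..s}|lebesgue. w u)"
  have si: "set_integrable lebesgue A w" if "A \<in> sets lebesgue" for A
    using doubling_integrable[OF assms] that unfolding set_integrable_def
    by (intro integrable_mult_indicator) auto
  have "mono W"
  proof (rule monoI)
    fix x y :: real assume "x \<le> y"
    then show "W x \<le> W y"
      unfolding W_def set_lebesgue_integral_def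
      using si[of "{..x}"] si[of "{..y}"] assms
      by (intro integral_mono) (auto simp: indicator_def doubling_nonneg set_integrable_def)
  qed
  then have [measurable]: "W \<in> borel_measurable borel" by (rule borel_measurable_mono)
  have eq: "wint w a b = (if a \<le> b then W b - W a else 0)" for a b
  proof (cases "a \<le> b")
    case True
    have "W b = (LINT u:{..a} \<union> {a<..b}|lebesgue. w u)"
      unfolding W_def using True by (simp add: ivl_disj_un)
    also have "\<dots> = W a + (LINT u:{a<..b}|lebesgue. w u)"
      unfolding W_def by (intro set_integral_Un si) auto
    also have "(LINT u:{a<..b}|lebesgue. w u) = wint w a b"
      unfolding wint_def set_lebesgue_integral_def
    proof (rule integral_cong_AE)
      have "AE u in lebesgue. u \<noteq> a"
        by (intro AE_completion AE_lborel_singleton)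
      then show "AE u in lebesgue. indicator {a<..b} u *\<^sub>R w u = indicator {a..b} u *\<^sub>R w u"
        by eventually_elim (auto simp: indicator_def)
    qed (use si[of "{a<..b}"] si[of "{a..b}"] in \<open>auto simp: set_integrable_def\<close>)
    finally show ?thesis using True by simp
  qed (simp add: wint_def set_lebesgue_integral_def)
  show ?thesis unfolding avg_weight_wint[abs_def] eq by measurable
qed

section \<open>Growth of polynomials off the interval\<close>

definition cev :: "real poly \<Rightarrow> complex \<Rightarrow> complex" where
  "cev p z = poly (map_poly of_real p) z"

lemma cev_of_real: "cev p (of_real x) = of_real (poly p x)"
  unfolding cev_def by (induction p) (simp_all add: map_poly_pCons)

lemma cev_add: "cev (p + q) z = cev p z + cev q z"
proof -
  have "map_poly complex_of_real (p + q) = map_poly of_real p + map_poly of_real q"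
    by (rule poly_eqI) (simp add: coeff_map_poly)
  then show ?thesis by (simp add: cev_def)
qed

lemma cev_smult: "cev (smult c p) z = of_real c * cev p z"
proof -
  have "map_poly complex_of_real (smult c p) = smult (of_real c) (map_poly of_real p)"
    by (rule poly_eqI) (simp add: coeff_map_poly)
  then show ?thesis by (simp add: cev_def)
qed

lemma cev_mult: "cev (p * q) z = cev p z * cev q z"
proof (induction p)
  case (pCons a p)
  have "cev (pCons 0 (p * q)) z = z * cev (p * q) z"
    by (simp add: cev_def map_poly_pCons)
  moreover have "cev (pCons a p) z = of_real a + z * cev p z"
    by (simp add: cev_def map_poly_pCons)
  ultimately show ?case using pCons by (simp add: cev_add cev_smult algebra_simps)
qed (simp add: cev_def)

lemma cev_deriv: "(cev p has_field_derivative cev (pderiv p) z) (at z)"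
proof -
  have "pderiv (map_poly complex_of_real p) = map_poly of_real (pderiv p)"
    by (rule poly_eqI) (simp add: coeff_map_poly coeff_pderiv)
  then show ?thesis
    unfolding cev_def using poly_DERIV[of "map_poly complex_of_real p" z] by simp
qed

lemma cev_holomorphic: "cev p holomorphic_on S"
  using cev_deriv by (intro holomorphic_onI) (meson field_differentiable_at_within field_differentiable_def)

lemma cev_continuous: "continuous_on S (cev p)"
  by (rule holomorphic_on_imp_continuous_on[OF cev_holomorphic])

lemma deriv_cev: "deriv (cev p) = cev (pderiv p)"
  using cev_deriv by (auto intro!: ext DERIV_imp_deriv)

lemma higher_deriv_cev: "(deriv ^^ r) (cev p) = cev ((pderiv ^^ r) p)"
  by (induction r) (simp_all add: deriv_cev)

lemma degree_map_poly_of_real: "degree (map_poly complex_of_real p) = degree p"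
  by (rule degree_map_poly) simp

text \<open>\<open>\<zeta>\<^sup>N p((\<zeta> + 1/\<zeta>)/2)\<close> is a polynomial in \<open>\<zeta>\<close>, so the maximum principle on the unit disc,
  whose boundary is mapped into \<open>[-1,1]\<close>, applies.\<close>

lemma bernstein_walsh:
  fixes p :: "complex poly"
  assumes "degree p \<le> N" and bd: "\<And>x. x \<in> {-1..1} \<Longrightarrow> cmod (poly p (of_real x)) \<le> A"
    and z: "\<zeta> \<noteq> 0" "cmod \<zeta> \<le> 1"
  shows "cmod (poly p ((\<zeta> + 1 / \<zeta>) / 2)) * cmod \<zeta> ^ N \<le> A"
proof -
  define F where "F \<zeta> = (\<Sum>i\<le>N. coeff p i * ((\<zeta>\<^sup>2 + 1) / 2) ^ i * \<zeta> ^ (N - i))" for \<zeta>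
  have F: "F \<zeta> = poly p ((\<zeta> + 1 / \<zeta>) / 2) * \<zeta> ^ N" if "\<zeta> \<noteq> 0" for \<zeta>
  proof -
    have "poly p ((\<zeta> + 1 / \<zeta>) / 2) * \<zeta> ^ N = (\<Sum>i\<le>N. coeff p i * ((\<zeta> + 1 / \<zeta>) / 2) ^ i * \<zeta> ^ N)"
      unfolding poly_altdef sum_distrib_right using assms(1)
      by (intro sum.mono_neutral_left) (auto simp: coeff_eq_0)
    also have "\<dots> = F \<zeta>"
      unfolding F_def
    proof (intro sum.cong refl)
      fix i assume "i \<in> {..N}"
      then have "\<zeta> ^ N = \<zeta> ^ i * \<zeta> ^ (N - i)" by (simp add: power_add[symmetric])
      moreover have "(\<zeta> + 1 / \<zeta>) / 2 * \<zeta> = (\<zeta>\<^sup>2 + 1) / 2"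
        using that by (simp add: power2_eq_square field_simps)
      then have "((\<zeta> + 1 / \<zeta>) / 2) ^ i * \<zeta> ^ i = ((\<zeta>\<^sup>2 + 1) / 2) ^ i"
        by (metis power_mult_distrib)
      ultimately show "coeff p i * ((\<zeta> + 1 / \<zeta>) / 2) ^ i * \<zeta> ^ N = coeff p i * ((\<zeta>\<^sup>2 + 1) / 2) ^ i * \<zeta> ^ (N - i)"
        by (simp add: mult.assoc)
    qed
    finally show ?thesis by simp
  qed
  have hol: "F holomorphic_on UNIV" unfolding F_def by (intro holomorphic_intros) auto
  have "cmod (F \<zeta>) \<le> A"
  proof (rule maximum_modulus_frontier[where f = F and S = "cball 0 1" and B = A])
    show "F holomorphic_on interior (cball 0 1)" using hol holomorphic_on_subset by blast
    show "continuous_on (closure (cball 0 1)) F"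
      using hol holomorphic_on_imp_continuous_on holomorphic_on_subset by blast
    fix z assume "z \<in> frontier (cball (0::complex) 1)"
    then have z1: "cmod z = 1" by simp
    then have "z \<noteq> 0" by auto
    have "1 / z = cnj z" using z1 by (simp add: divide_conv_cnj)
    then have "(z + 1 / z) / 2 = of_real (Re z)" by (simp add: complex_add_cnj)
    moreover have "Re z \<in> {-1..1}" using abs_Re_le_cmod[of z] z1 by auto
    ultimately show "cmod (F z) \<le> A" using F[OF \<open>z \<noteq> 0\<close>] bd z1 by (simp add: norm_mult norm_power)
  qed (use z in auto)
  then show ?thesis using F[OF z(1)] by (simp add: norm_mult norm_power)
qed

section \<open>The Joukowski map and confocal ellipses\<close>

text \<open>The two solutions z + sqrt(z^2 - 1) and z - sqrt(z^2 - 1) have product 1, so one of them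
  lies in the closed unit disc.\<close>

lemma joukowski_preimage: "\<exists>\<zeta>. \<zeta> \<noteq> 0 \<and> cmod \<zeta> \<le> 1 \<and> z = (\<zeta> + 1 / \<zeta>) / 2"
proof -
  define u v where "u = z + csqrt (z\<^sup>2 - 1)" and "v = z - csqrt (z\<^sup>2 - 1)"
  have "u * v = z\<^sup>2 - (csqrt (z\<^sup>2 - 1))\<^sup>2"
    by (simp add: u_def v_def power2_eq_square algebra_simps)
  then have uv: "u * v = 1" by simp
  then have nz: "u \<noteq> 0" "v \<noteq> 0" by auto
  have inv: "1 / u = v" "1 / v = u" using uv nz by (auto simp: field_simps)
  have "cmod u * cmod v = 1" using uv by (simp flip: norm_mult)
  then have "cmod u \<le> 1 \<or> cmod v \<le> 1"
    by (metis linorder_not_le less_1_mult less_irrefl)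
  then show ?thesis
  proof
    assume "cmod u \<le> 1" then show ?thesis using nz inv by (intro exI[of _ u]) (simp add: u_def v_def)
  next
    assume "cmod v \<le> 1" then show ?thesis using nz inv by (intro exI[of _ v]) (simp add: u_def v_def)
  qed
qed

text \<open>Circles go to ellipses with foci 1 and -1: the focal distances add up to |\<zeta>| +
  1/|\<zeta>|. This follows from 2\<zeta>(z - 1) = (\<zeta> - 1)^2, its twin for z + 1, and the
  parallelogram law.\<close>

lemma joukowski_modulus:
  assumes "\<zeta> \<noteq> 0" "z = (\<zeta> + 1 / \<zeta>) / 2"
  shows "(1 - cmod \<zeta>)\<^sup>2 = cmod \<zeta> * (cmod (z - 1) + cmod (z + 1) - 2)"
proof -
  have "2 * \<zeta> * (z - 1) = (\<zeta> - 1)\<^sup>2" "2 * \<zeta> * (z + 1) = (\<zeta> + 1)\<^sup>2"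
    using assms by (auto simp: field_simps power2_eq_square)
  then have e: "2 * cmod \<zeta> * cmod (z - 1) = (cmod (\<zeta> - 1))\<^sup>2" "2 * cmod \<zeta> * cmod (z + 1) = (cmod (\<zeta> + 1))\<^sup>2"
    by (metis norm_mult norm_power norm_numeral)+
  have "(cmod (\<zeta> - 1))\<^sup>2 + (cmod (\<zeta> + 1))\<^sup>2 = 2 + 2 * (cmod \<zeta>)\<^sup>2"
    unfolding cmod_power2 by (simp add: power2_eq_square algebra_simps)
  then show ?thesis using e by (simp add: power2_eq_square algebra_simps)
qed

text \<open>The linear term \<open>Re d\<close> is kept because it cancels between the two foci in
  the next lemma, where only the quadratic error may survive.\<close>

lemma norm_le_first_order:
  assumes "0 < a" shows "cmod (of_real a + d) \<le> a + Re d + (cmod d)\<^sup>2 / (2 * a)"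
proof (rule power2_le_imp_le)
  define e where "e = Re d + (cmod d)\<^sup>2 / (2 * a)"
  have "(cmod (of_real a + d))\<^sup>2 = a\<^sup>2 + 2 * a * Re d + (cmod d)\<^sup>2"
    unfolding cmod_power2 by (simp add: power2_eq_square algebra_simps)
  also have "\<dots> = a\<^sup>2 + 2 * a * e" using assms by (simp add: e_def field_simps)
  also have "\<dots> \<le> (a + e)\<^sup>2" by (simp add: power2_sum)
  finally show "(cmod (of_real a + d))\<^sup>2 \<le> (a + Re d + (cmod d)\<^sup>2 / (2 * a))\<^sup>2"
    by (simp add: e_def add.assoc)
  have "0 \<le> a\<^sup>2 + (a + Re d)\<^sup>2 + (Im d)\<^sup>2" by simp
  also have "\<dots> = 2 * a * (a + e)"
    using assms unfolding e_def cmod_power2 by (simp add: power2_eq_square field_simps)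
  finally show "0 \<le> a + Re d + (cmod d)\<^sup>2 / (2 * a)"
    using assms by (simp add: e_def zero_le_mult_iff)
qed

text \<open>Away from the endpoints the linear terms of the two focal distances cancel. Since 1/(1 -
  x) + 1/(1 + x) = 2/phi^2, the quadratic ones add up to (|d|/phi)^2, and |d| \<le> 2 phi/n there.
  When n phi < 1, the radius is at most 2/n^2 and the triangle inequality suffices.\<close>

lemma focal_sum_le:
  assumes "1 \<le> n" "x \<in> {-1..1}" "cmod (z - of_real x) \<le> rho n x"
  shows "cmod (z - 1) + cmod (z + 1) - 2 \<le> 4 / (real n)\<^sup>2"
proof (cases "1 \<le> real n * phi x")
  case True
  define d where "d = z - of_real x"
  have n: "0 < real n" using assms(1) by simp
  have ph: "0 < phi x" using True n by (metis less_numeral_extra(1) order_less_le_trans zero_less_mult_pos)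
  have sq: "(phi x)\<^sup>2 = (1 - x) * (1 + x)"
    using assms(2) by (simp add: phi_def abs_square_le_1 abs_le_iff) (simp add: power2_eq_square algebra_simps)
  then have "1 - x \<noteq> 0" "1 + x \<noteq> 0" using ph by auto
  then have ne: "0 < 1 - x" "0 < 1 + x" using assms(2) by auto
  have split: "c / (2 * p) + c / (2 * q) = c / (p * q)" if "0 < p" "0 < q" "p + q = 2" for c p q :: real
  proof -
    have "c / (2 * p) + c / (2 * q) = c * (p + q) / (2 * (p * q))" using that(1,2) by (simp add: field_simps)
    then show ?thesis using that(3) by simp
  qed
  have "cmod (z - 1) = cmod (of_real (1 - x) + - d)"
    unfolding d_def by (subst norm_minus_cancel[symmetric]) (simp add: algebra_simps)
  also have "\<dots> \<le> (1 - x) + Re (- d) + (cmod (- d))\<^sup>2 / (2 * (1 - x))"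
    by (rule norm_le_first_order[OF ne(1)])
  finally have 1: "cmod (z - 1) \<le> (1 - x) - Re d + (cmod d)\<^sup>2 / (2 * (1 - x))" by simp
  have "cmod (z + 1) = cmod (of_real (1 + x) + d)"
    unfolding d_def by (simp add: algebra_simps)
  also have "\<dots> \<le> (1 + x) + Re d + (cmod d)\<^sup>2 / (2 * (1 + x))"
    by (rule norm_le_first_order[OF ne(2)])
  finally have 2: "cmod (z + 1) \<le> (1 + x) + Re d + (cmod d)\<^sup>2 / (2 * (1 + x))" .
  have "(cmod d)\<^sup>2 / (2 * (1 - x)) + (cmod d)\<^sup>2 / (2 * (1 + x)) = (cmod d)\<^sup>2 / (phi x)\<^sup>2"
    unfolding sq by (rule split[OF ne]) simp
  also have "\<dots> = (cmod d / phi x)\<^sup>2" by (simp add: power_divide)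
  also have "\<dots> \<le> (2 / real n)\<^sup>2"
  proof (rule power_mono)
    have "cmod d \<le> phi x / real n + 1 / (real n)\<^sup>2" using assms(3) by (simp add: d_def rho_phi)
    also have "1 / (real n)\<^sup>2 \<le> phi x / real n"
      using True n by (simp add: power2_eq_square field_simps)
    finally show "cmod d / phi x \<le> 2 / real n" using ph n by (simp add: field_simps)
  qed (use ph in auto)
  also have "\<dots> = 4 / (real n)\<^sup>2" by (simp add: power_divide)
  finally show ?thesis using 1 2 by linarith
next
  case False
  have n: "0 < real n" using assms(1) by simp
  have "phi x / real n \<le> 1 / (real n)\<^sup>2" using False n by (simp add: power2_eq_square field_simps)
  then have d: "cmod (z - of_real x) \<le> 2 / (real n)\<^sup>2" using assms(3) by (simp add: rho_phi)
  have "cmod (z - 1) \<le> cmod (z - of_real x) + cmod (of_real (x - 1))"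
    by (rule order_trans[OF _ norm_triangle_ineq]) simp
  moreover have "cmod (z + 1) \<le> cmod (z - of_real x) + cmod (of_real (x + 1))"
    by (rule order_trans[OF _ norm_triangle_ineq]) simp
  moreover have "cmod (of_real (x - 1)) = 1 - x" "cmod (of_real (x + 1)) = 1 + x"
    using assms(2) unfolding norm_of_real by auto
  ultimately have "cmod (z - 1) + cmod (z + 1) - 2 \<le> 2 * cmod (z - of_real x)" by linarith
  also have "\<dots> \<le> 4 / (real n)\<^sup>2" using d by simp
  finally show ?thesis .
qed

text \<open>The Joukowski preimage of z has modulus b with 1/b \<le> 1 + 6/n, so the factor b^(-Kn)
  from Bernstein-Walsh is bounded independently of n.\<close>

lemma poly_growth_disc:
  assumes "degree p \<le> K * n" and bd: "\<And>t. t \<in> {-1..1} \<Longrightarrow> \<bar>poly p t\<bar> \<le> A"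
    and "1 \<le> n" "x \<in> {-1..1}" "cmod (z - of_real x) \<le> rho n x"
  shows "cmod (cev p z) \<le> A * exp (6 * real K)"
proof -
  obtain \<zeta> where \<zeta>: "\<zeta> \<noteq> 0" "cmod \<zeta> \<le> 1" "z = (\<zeta> + 1 / \<zeta>) / 2"
    using joukowski_preimage by blast
  define b where "b = cmod \<zeta>"
  define y where "y = 1 / b - 1"
  define e where "e = 1 / real n"
  have b: "0 < b" "b \<le> 1" using \<zeta> by (auto simp: b_def)
  have n: "0 < real n" using assms(3) by simp
  have e: "0 < e" "e \<le> 1" using assms(3) by (auto simp: e_def)
  have "(1 - b)\<^sup>2 \<le> b * (4 * e\<^sup>2)"
    unfolding b_def joukowski_modulus[OF \<zeta>(1,3)] using focal_sum_le[OF assms(3-5)]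
    by (intro mult_left_mono) (auto simp: e_def power_divide)
  then have "(1 - b)\<^sup>2 / b\<^sup>2 \<le> b * (4 * e\<^sup>2) / b\<^sup>2" by (rule divide_right_mono) simp
  moreover have "(1 - b)\<^sup>2 / b\<^sup>2 = y\<^sup>2"
    using b by (simp add: y_def power_divide[symmetric] diff_divide_distrib)
  moreover have "b * (4 * e\<^sup>2) / b\<^sup>2 = 4 * e\<^sup>2 * (1 + y)"
    using b by (simp add: y_def power2_eq_square)
  ultimately have y: "y\<^sup>2 \<le> 4 * e\<^sup>2 * (1 + y)" by simp
  have y0: "0 \<le> y" using b by (simp add: y_def)
  \<comment> \<open>For y > 6e the product y(y - 4e) would exceed 12 e^2, whereas the quadratic
    inequality for y, together with e \<le> 1, bounds it by 4 e^2.\<close>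
  have "y \<le> 6 * e"
  proof (rule ccontr)
    assume "\<not> y \<le> 6 * e"
    then have gt: "y > 6 * e" by simp
    have "4 * e\<^sup>2 * y \<le> 4 * e * y"
      using e y0 by (intro mult_right_mono) (auto simp: power2_eq_square)
    then have "y * (y - 4 * e) \<le> 4 * e\<^sup>2" using y by (simp add: power2_eq_square algebra_simps)
    moreover have "(6 * e) * (2 * e) < y * (y - 4 * e)"
      using gt e by (intro mult_strict_mono) auto
    moreover have "4 * e\<^sup>2 \<le> (6 * e) * (2 * e)" by (simp add: power2_eq_square)
    ultimately show False by linarith
  qed
  then have inv: "1 / b \<le> exp (6 * e)"
    using exp_ge_add_one_self[of "6 * e"] unfolding y_def by linarith
  have A0: "0 \<le> A" using bd[of 0] by (auto intro: order_trans[OF abs_ge_zero])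
  have "cmod (poly (map_poly of_real p) ((\<zeta> + 1 / \<zeta>) / 2)) * cmod \<zeta> ^ (K * n) \<le> A"
    using assms(1) bd \<zeta> cev_of_real[of p] by (intro bernstein_walsh) (auto simp: degree_map_poly_of_real cev_def)
  then have "cmod (cev p z) * b ^ (K * n) \<le> A" by (simp add: cev_def \<zeta>(3) b_def)
  then have "cmod (cev p z) \<le> A * (1 / b) ^ (K * n)"
    using b by (simp add: power_divide field_simps)
  also have "\<dots> \<le> A * exp (6 * e) ^ (K * n)"
    using A0 inv b by (intro mult_left_mono power_mono) auto
  also have "exp (6 * e) ^ (K * n) = exp (6 * real K)"
    using n by (simp add: exp_of_nat_mult[symmetric] e_def)
  finally show ?thesis .
qed

section \<open>Fejer-type peaked polynomials\<close>

fun cheb :: "nat \<Rightarrow> real poly" where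
  "cheb 0 = 1"
| "cheb (Suc 0) = [:0, 1:]"
| "cheb (Suc (Suc n)) = smult 2 ([:0, 1:] * cheb (Suc n)) - cheb n"

lemma poly_cheb: "poly (cheb n) (cos \<theta>) = cos (real n * \<theta>)"
proof (induction n rule: cheb.induct)
  case (3 n)
  have "cos (real (Suc (Suc n)) * \<theta>) + cos (real n * \<theta>) = 2 * cos \<theta> * cos (real (Suc n) * \<theta>)"
    using cos_add[of "real (Suc n) * \<theta>" \<theta>] cos_diff[of "real (Suc n) * \<theta>" \<theta>]
    by (simp add: algebra_simps)
  then show ?case using 3 by (simp add: algebra_simps)
qed auto

lemma degree_cheb: "degree (cheb n) \<le> n"
proof (induction n rule: cheb.induct)
  case (3 n)
  have "degree (smult 2 ([:0, 1:] * cheb (Suc n))) \<le> Suc (Suc n)"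
    using 3(1) degree_mult_le[of "[:0, 1:]" "cheb (Suc n)"] degree_smult_le[of 2 "[:0, 1:] * cheb (Suc n)"] by simp
  then show ?case using 3 by (auto intro!: degree_diff_le)
qed auto

text \<open>This is n times the Fejer kernel, (sin(nu/2) / sin(u/2))^2, written as a double sum of
  cosines so that each frequency can be replaced by a Chebyshev polynomial.\<close>

definition fejer :: "nat \<Rightarrow> real \<Rightarrow> real" where
  "fejer n u = (\<Sum>j<n. \<Sum>k<n. cos ((real j - real k) * u))"

lemma fejer_eq_norm: "fejer n u = (cmod (\<Sum>j<n. cis u ^ j))\<^sup>2"
proof -
  have "(\<Sum>j<n. cis u ^ j) = Complex (\<Sum>j<n. cos (real j * u)) (\<Sum>j<n. sin (real j * u))"
    by (simp add: complex_eq_iff Complex.DeMoivre)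
  then have "(cmod (\<Sum>j<n. cis u ^ j))\<^sup>2 = (\<Sum>j<n. cos (real j * u))\<^sup>2 + (\<Sum>j<n. sin (real j * u))\<^sup>2"
    by (simp add: cmod_power2)
  also have "\<dots> = fejer n u"
    unfolding fejer_def power2_eq_square sum_product
    by (simp add: sum.distrib[symmetric] left_diff_distrib cos_diff)
  finally show ?thesis by simp
qed

lemma fejer_nonneg: "0 \<le> fejer n u"
  by (simp add: fejer_eq_norm)

lemma fejer_0: "fejer n 0 = (real n)\<^sup>2"
  by (simp add: fejer_def power2_eq_square)

lemma fejer_le: "fejer n u \<le> (real n)\<^sup>2"
proof -
  have "fejer n u \<le> (\<Sum>j<n. \<Sum>k<n. 1)" unfolding fejer_def by (intro sum_mono cos_le_one)
  then show ?thesis by (simp add: power2_eq_square)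
qed

lemma fejer_sin_le: "fejer n u * (sin (u / 2))\<^sup>2 \<le> 1"
proof -
  have "cmod (1 - cis u) * cmod (\<Sum>j<n. cis u ^ j) = cmod (1 - cis u ^ n)"
    by (simp add: one_diff_power_eq norm_mult)
  also have "\<dots> \<le> 2"
    using norm_triangle_ineq4[of 1 "cis u ^ n"] by (simp add: norm_power)
  finally have "(cmod (1 - cis u) * cmod (\<Sum>j<n. cis u ^ j))\<^sup>2 \<le> 2\<^sup>2" by (intro power_mono) auto
  moreover have "(cmod (1 - cis u))\<^sup>2 = 4 * (sin (u / 2))\<^sup>2"
  proof -
    have "(cmod (1 - cis u))\<^sup>2 = 2 - 2 * cos u"
      unfolding cmod_power2 using sin_cos_squared_add[of u] by (simp add: power2_eq_square algebra_simps)
    also have "cos u = 1 - 2 * (sin (u / 2))\<^sup>2" using cos_double_sin[of "u / 2"] by simp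
    finally show ?thesis by simp
  qed
  ultimately show ?thesis by (simp add: fejer_eq_norm power_mult_distrib mult.commute)
qed

text \<open>The even part in \<tau> of the Fejer kernel at \<theta> - \<tau>, for x = cos \<theta>
  and t = cos \<tau>, rescaled; evenness makes it a polynomial in t. With truncated subtraction
  \<open>(j - k) + (k - j)\<close> is |j - k|.\<close>

definition peak :: "nat \<Rightarrow> real \<Rightarrow> real poly" where
  "peak n x = smult (2 / (real n)\<^sup>2)
     (\<Sum>j<n. \<Sum>k<n. smult (poly (cheb ((j - k) + (k - j))) x) (cheb ((j - k) + (k - j))))"

lemma degree_peak: "degree (peak n x) \<le> n - 1"
  unfolding peak_def
  by (intro order_trans[OF degree_smult_le] degree_sum_le)
     (auto intro!: order_trans[OF degree_smult_le] order_trans[OF degree_cheb])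

lemma poly_peak_cos:
  "poly (peak n (cos \<theta>)) (cos \<tau>) = (fejer n (\<theta> - \<tau>) + fejer n (\<theta> + \<tau>)) / (real n)\<^sup>2"
proof -
  have c: "cos (real ((j - k) + (k - j)) * v) = cos ((real j - real k) * v)" for j k :: nat and v
  proof (cases "k \<le> j")
    case False
    then have "real ((j - k) + (k - j)) * v = - ((real j - real k) * v)" by (simp add: of_nat_diff algebra_simps)
    then show ?thesis by (simp only: cos_minus)
  qed (simp add: of_nat_diff)
  have "2 * (cos ((real j - real k) * \<theta>) * cos ((real j - real k) * \<tau>))
      = cos ((real j - real k) * (\<theta> - \<tau>)) + cos ((real j - real k) * (\<theta> + \<tau>))" for j k :: nat
    by (simp add: right_diff_distrib distrib_left cos_diff cos_add)
  then show ?thesis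
    unfolding peak_def fejer_def
    by (simp add: poly_sum poly_cheb c sum_distrib_left sum.distrib[symmetric] sum_divide_distrib
        add_divide_distrib[symmetric] del: of_nat_add)
qed

text \<open>In the angle variable the local scale is simply 1/n. The difference of the cosines is
  2ab in modulus, and b \<le> sin \<theta> + a because the half sum of the angles is \<theta> minus
  their half difference.\<close>

lemma dil_cos_le:
  assumes "1 \<le> n" "\<theta> \<in> {0..pi}"
  shows "dil n (cos \<theta>) (cos \<tau>) \<le> 3 * (1 + (real n * sin ((\<theta> - \<tau>) / 2))\<^sup>2)"
proof -
  define a where "a = \<bar>sin ((\<theta> - \<tau>) / 2)\<bar>"
  define b where "b = \<bar>sin ((\<theta> + \<tau>) / 2)\<bar>"
  have n: "0 < real n" using assms(1) by simp
  have s0: "0 \<le> sin \<theta>" using assms(2) by (auto intro: sin_ge_zero)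
  have ph: "phi (cos \<theta>) = sin \<theta>"
    using s0 by (simp add: phi_def sin_squared_eq[symmetric])
  have x: "cos \<theta> \<in> {-1..1}" by simp
  have "cos \<theta> - cos \<tau> = 2 * sin ((\<theta> + \<tau>) / 2) * sin ((\<tau> - \<theta>) / 2)"
    by (rule cos_diff_cos)
  moreover have "sin ((\<tau> - \<theta>) / 2) = - sin ((\<theta> - \<tau>) / 2)"
    by (metis minus_diff_eq minus_divide_left sin_minus)
  ultimately have diff: "\<bar>cos \<theta> - cos \<tau>\<bar> = 2 * a * b" by (simp add: a_def b_def abs_mult)
  have "(\<theta> + \<tau>) / 2 = \<theta> - (\<theta> - \<tau>) / 2" by (simp add: field_simps)
  then have "sin ((\<theta> + \<tau>) / 2) = sin \<theta> * cos ((\<theta> - \<tau>) / 2) - cos \<theta> * sin ((\<theta> - \<tau>) / 2)"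
    by (simp only: sin_diff)
  then have "b \<le> \<bar>sin \<theta> * cos ((\<theta> - \<tau>) / 2)\<bar> + \<bar>cos \<theta> * sin ((\<theta> - \<tau>) / 2)\<bar>"
    unfolding b_def by (simp only: abs_triangle_ineq4)
  also have "\<dots> \<le> sin \<theta> * 1 + 1 * a"
    unfolding abs_mult a_def using s0 by (intro add_mono mult_mono) auto
  finally have b: "b \<le> sin \<theta> + a" by simp
  define v where "v = real n * a"
  have a: "a = v / real n" using n by (simp add: v_def)
  have "2 * v \<le> v\<^sup>2 + 1" using sum_squares_bound[of v 1] by simp
  moreover have "0 \<le> v\<^sup>2" by simp
  ultimately have v: "2 * v \<le> 2 + 3 * v\<^sup>2" by linarith
  have "2 * a * b \<le> 2 * a * (sin \<theta> + a)" using b by (intro mult_left_mono) (auto simp: a_def)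
  also have "\<dots> = (2 * v) * (sin \<theta> / real n) + 2 * v\<^sup>2 * (1 / (real n)\<^sup>2)"
    by (simp add: a power2_eq_square algebra_simps add_divide_distrib)
  also have "\<dots> \<le> (2 + 3 * v\<^sup>2) * (sin \<theta> / real n) + (2 + 3 * v\<^sup>2) * (1 / (real n)\<^sup>2)"
    using s0 n v by (intro add_mono mult_right_mono) auto
  also have "\<dots> = (2 + 3 * v\<^sup>2) * rho n (cos \<theta>)" by (simp add: rho_phi ph distrib_left)
  finally have "\<bar>cos \<theta> - cos \<tau>\<bar> / rho n (cos \<theta>) \<le> 2 + 3 * v\<^sup>2"
    using rho_pos[OF assms(1) x] diff by (simp add: field_simps)
  then show ?thesis by (simp add: dil_def v_def a_def power_mult_distrib)
qed

lemma fejer_decay: "fejer n u * (1 + (real n * sin (u / 2))\<^sup>2) \<le> 2 * (real n)\<^sup>2"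
proof -
  have "fejer n u * (real n * sin (u / 2))\<^sup>2 = (real n)\<^sup>2 * (fejer n u * (sin (u / 2))\<^sup>2)"
    by (simp add: power_mult_distrib)
  also have "\<dots> \<le> (real n)\<^sup>2 * 1" by (intro mult_left_mono fejer_sin_le) simp
  finally show ?thesis using fejer_le[of n u] by (simp add: distrib_left)
qed

text \<open>The mirrored term at \<theta> + \<tau> must decay in \<theta> - \<tau> as well. It does,
  because the squared sines of the half sum and the half difference differ by sin \<theta> sin
  \<tau>, which is nonnegative on [0, pi]. The 12 is 3 from \<open>dil_cos_le\<close> times 4 from
  two uses of \<open>fejer_decay\<close>.\<close>

lemma peak_bounds:
  assumes "1 \<le> n" "x \<in> {-1..1}" "t \<in> {-1..1}"
  shows "0 \<le> poly (peak n x) t" "poly (peak n x) t * dil n x t \<le> 12"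
proof -
  define \<theta> \<tau> where "\<theta> = arccos x" and "\<tau> = arccos t"
  have th: "\<theta> \<in> {0..pi}" "\<tau> \<in> {0..pi}" "cos \<theta> = x" "cos \<tau> = t"
    using assms by (auto simp: \<theta>_def \<tau>_def arccos_lbound arccos_ubound)
  have n: "0 < real n" using assms(1) by simp
  have p: "poly (peak n x) t = (fejer n (\<theta> - \<tau>) + fejer n (\<theta> + \<tau>)) / (real n)\<^sup>2"
    using poly_peak_cos[of n \<theta> \<tau>] th by simp
  show "0 \<le> poly (peak n x) t" unfolding p by (simp add: fejer_nonneg)
  define Z where "Z = 1 + (real n * sin ((\<theta> - \<tau>) / 2))\<^sup>2"
  have "(sin ((\<theta> + \<tau>) / 2))\<^sup>2 - (sin ((\<theta> - \<tau>) / 2))\<^sup>2 = sin \<theta> * sin \<tau>"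
  proof -
    have h: "(sin (u / 2))\<^sup>2 = (1 - cos u) / 2" for u :: real
      using cos_double_sin[of "u / 2"] by simp
    show ?thesis unfolding h by (simp add: cos_add cos_diff field_simps)
  qed
  moreover have "0 \<le> sin \<theta> * sin \<tau>" using th by (auto intro!: mult_nonneg_nonneg sin_ge_zero)
  ultimately have sq: "(sin ((\<theta> - \<tau>) / 2))\<^sup>2 \<le> (sin ((\<theta> + \<tau>) / 2))\<^sup>2" by linarith
  have "fejer n (\<theta> + \<tau>) * Z \<le> fejer n (\<theta> + \<tau>) * (1 + (real n * sin ((\<theta> + \<tau>) / 2))\<^sup>2)"
    unfolding Z_def power_mult_distrib using sq
    by (intro mult_left_mono add_left_mono fejer_nonneg) auto
  also have "\<dots> \<le> 2 * (real n)\<^sup>2" by (rule fejer_decay)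
  finally have "(fejer n (\<theta> - \<tau>) + fejer n (\<theta> + \<tau>)) * Z \<le> 4 * (real n)\<^sup>2"
    using fejer_decay[of n "\<theta> - \<tau>"] by (simp add: Z_def distrib_right)
  then have "poly (peak n x) t * Z \<le> 4" unfolding p using n by (simp add: field_simps)
  moreover have "poly (peak n x) t * dil n x t \<le> poly (peak n x) t * (3 * Z)"
    using dil_cos_le[OF assms(1) th(1), of \<tau>] th p
    by (intro mult_left_mono) (auto simp: Z_def fejer_nonneg)
  ultimately show "poly (peak n x) t * dil n x t \<le> 12" by linarith
qed

lemma peak_center:
  assumes "1 \<le> n" "x \<in> {-1..1}" shows "1 \<le> poly (peak n x) x"
proof -
  have "poly (peak n x) x = (fejer n 0 + fejer n (2 * arccos x)) / (real n)\<^sup>2"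
    using poly_peak_cos[of n "arccos x" "arccos x"] assms(2) by simp
  then show ?thesis using fejer_nonneg[of n "2 * arccos x"] assms(1) by (simp add: fejer_0 le_divide_eq)
qed

lemma ex_antiderivative_poly:
  fixes R :: "real poly" shows "\<exists>S. pderiv S = R \<and> degree S \<le> degree R + 1"
proof -
  define S where "S = (\<Sum>i\<le>degree R. monom (coeff R i / real (Suc i)) (Suc i))"
  have "pderiv (\<Sum>i\<in>A. f i) = (\<Sum>i\<in>A. pderiv (f i))" for A and f :: "nat \<Rightarrow> real poly"
    by (induction A rule: infinite_finite_induct) (simp_all add: pderiv_add)
  then have "pderiv S = (\<Sum>i\<le>degree R. monom (coeff R i) i)"
    unfolding S_def by (simp add: pderiv_monom)
  then have "pderiv S = R" by (simp add: poly_as_sum_of_monoms)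
  moreover have "degree S \<le> degree R + 1"
    unfolding S_def by (intro degree_sum_le) (auto intro!: order_trans[OF degree_monom_le])
  ultimately show ?thesis by blast
qed

section \<open>Pointwise bounds for derivatives and differences\<close>

lemma continuous_on_dil [continuous_intros]: "continuous_on S (dil n x)"
  unfolding dil_def divide_inverse by (intro continuous_intros)

lemma antiderivative_bound:
  fixes S :: "real poly"
  assumes "t \<in> {-1..1}"
  shows "\<bar>poly S t - poly S (-1)\<bar> \<le> integral {-1..1} (\<lambda>u. \<bar>poly (pderiv S) u\<bar>)"
proof -
  have "((poly (pderiv S)) has_integral (poly S t - poly S (-1))) {-1..t}"
    using assms
    by (intro fundamental_theorem_of_calculus)
       (auto simp flip: has_real_derivative_iff_has_vector_derivative intro: DERIV_subset[OF poly_DERIV])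
  then have eq: "poly S t - poly S (-1) = integral {-1..t} (poly (pderiv S))"
    by (simp add: integral_unique)
  have int: "(\<lambda>u. \<bar>poly (pderiv S) u\<bar>) integrable_on {a..b}" for a b
    by (intro integrable_continuous_real continuous_intros)
  have "norm (integral {-1..t} (poly (pderiv S))) \<le> integral {-1..t} (\<lambda>u. \<bar>poly (pderiv S) u\<bar>)"
    by (intro integral_norm_bound_integral int integrable_continuous_real continuous_intros) auto
  also have "\<dots> \<le> integral {-1..1} (\<lambda>u. \<bar>poly (pderiv S) u\<bar>)"
    using assms by (intro integral_subset_le int) auto
  finally show ?thesis by (simp add: eq)
qed

lemma cauchy_bound_cev:
  assumes "0 < d" "\<And>y. cmod (y - z) \<le> d \<Longrightarrow> cmod (cev p y) \<le> B"
  shows "cmod (cev ((pderiv ^^ r) p) z) \<le> fact r * B / d ^ r"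
  unfolding higher_deriv_cev[symmetric] using assms
  by (intro Cauchy_inequality cev_holomorphic cev_continuous) (auto simp: norm_minus_commute)

text \<open>The growth estimate controls R = Q J near x, and Q is recovered by dividing by J. Since
  J is large only near x, this works on a smaller disc, still of radius proportional to the local
  scale. One power of the scale is lost in differentiating the antiderivative, r more in the final
  Cauchy estimate.\<close>

lemma pointwise_derivative_bound:
  "\<exists>C>0. \<forall>n Q x. 1 \<le> n \<longrightarrow> degree Q < n \<longrightarrow> x \<in> {-1..1} \<longrightarrow>
     \<bar>poly ((pderiv ^^ r) Q) x\<bar> * rho n x ^ Suc r
       \<le> C * integral {-1..1} (\<lambda>t. \<bar>poly Q t\<bar> / dil n x t ^ M)"
proof -
  define e where "e = exp (6 * real (Suc M))"
  define B where "B = 12 ^ M * exp (6 * real M)"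
  \<comment> \<open>In \<open>4 * 12 ^ M * e\<close> one factor 2 comes from Cauchy's estimate on a
    half disc, the other from dividing by |J| \<ge> 1/2, and \<open>12 ^ M\<close> from the decay of
    J. The power of \<open>4 * B\<close> is due to the radius \<open>d\<close> below.\<close>
  define C where "C = fact r * (4 * 12 ^ M * e) * (4 * B) ^ r"
  have e: "0 < e" by (simp add: e_def)
  have "1 * 1 \<le> (12::real) ^ M * exp (6 * real M)" by (intro mult_mono) auto
  then have B: "1 \<le> B" by (simp add: B_def)
  have "0 < C" using e B by (simp add: C_def)
  moreover have "\<bar>poly ((pderiv ^^ r) Q) x\<bar> * rho n x ^ Suc r
      \<le> C * integral {-1..1} (\<lambda>t. \<bar>poly Q t\<bar> / dil n x t ^ M)"
    if n: "1 \<le> n" and deg: "degree Q < n" and x: "x \<in> {-1..1}" for n Q x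
  proof -
    define \<rho> where "\<rho> = rho n x"
    have \<rho>: "0 < \<rho>" using rho_pos[OF n x] by (simp add: \<rho>_def)
    define J where "J = peak n x ^ M"
    define R where "R = Q * J"
    define A where "A = integral {-1..1} (\<lambda>t. \<bar>poly R t\<bar>)"
    define I where "I = integral {-1..1} (\<lambda>t. \<bar>poly Q t\<bar> / dil n x t ^ M)"
    have degJ: "degree J \<le> M * (n - 1)"
      unfolding J_def using degree_power_le[of "peak n x" M] degree_peak[of n x]
      by (metis le_trans mult.commute mult_le_mono1)
    obtain S0 where S0: "pderiv S0 = R" "degree S0 \<le> degree R + 1" using ex_antiderivative_poly by blast
    \<comment> \<open>Normalised to vanish at -1, so that the integral of |R| bounds it on the whole
      interval.\<close>
    define S where "S = S0 - [:poly S0 (-1):]"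
    have dS: "pderiv S = R" by (simp add: S_def pderiv_diff S0 pderiv_pCons)
    have "degree R \<le> (n - 1) + M * (n - 1)"
      unfolding R_def using degree_mult_le[of Q J] deg degJ by linarith
    moreover have "(n - 1) + M * (n - 1) + 1 \<le> Suc M * n"
      using n by (cases n) (auto simp: algebra_simps)
    ultimately have "degree S0 \<le> Suc M * n" using S0(2) by linarith
    then have degS: "degree S \<le> Suc M * n" unfolding S_def by (intro degree_diff_le) auto
    have Sb: "\<bar>poly S t\<bar> \<le> A" if "t \<in> {-1..1}" for t
      using antiderivative_bound[OF that, of S0] by (simp add: S_def A_def S0)
    have A0: "0 \<le> A" using Sb[of 0] by (auto intro: order_trans[OF abs_ge_zero])
    have cS: "cmod (cev S z) \<le> A * e" if "cmod (z - of_real x) \<le> \<rho>" for z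
      using poly_growth_disc[OF degS Sb n x, of z] that by (simp add: e_def \<rho>_def)
    have half: "cmod (y - of_real x) \<le> \<rho>" if "cmod (y - z) \<le> \<rho> / 2" "cmod (z - of_real x) \<le> \<rho> / 2" for y z
      using norm_triangle_ineq[of "y - z" "z - of_real x"] that by simp
    have cR: "cmod (cev R z) \<le> 2 * A * e / \<rho>" if "cmod (z - of_real x) \<le> \<rho> / 2" for z
      using cauchy_bound_cev[of "\<rho> / 2" z S "A * e" 1] cS half[OF _ that] \<rho> by (simp add: dS mult_ac)
    have Jb: "\<bar>poly J t\<bar> \<le> 12 ^ M" if "t \<in> {-1..1}" for t
    proof -
      have "poly (peak n x) t * 1 \<le> poly (peak n x) t * dil n x t"
        by (intro mult_left_mono dil_ge_1[OF n x] peak_bounds[OF n x that])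
      then have "poly (peak n x) t \<le> 12" using peak_bounds(2)[OF n x that] by simp
      then show ?thesis using peak_bounds(1)[OF n x that] by (simp add: J_def poly_power power_mono)
    qed
    have "degree J \<le> M * n" using degJ by (meson diff_le_self le_trans mult_le_mono2)
    then have cJ: "cmod (cev J z) \<le> B" if "cmod (z - of_real x) \<le> \<rho>" for z
      using poly_growth_disc[OF _ Jb n x, of M z] that by (simp add: B_def \<rho>_def)
    have cJ': "cmod (cev (pderiv J) z) \<le> 2 * B / \<rho>" if "cmod (z - of_real x) \<le> \<rho> / 2" for z
      using cauchy_bound_cev[of "\<rho> / 2" z J B 1] cJ half[OF _ that] \<rho> by (simp add: mult_ac)
    have J1: "1 \<le> poly J x" using peak_center[OF n x] by (simp add: J_def poly_power one_le_power)
    \<comment> \<open>On this disc J changes by at most 1/2, its derivative being at most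
      \<open>2 * B / \<rho>\<close>; as J is at least 1 at x, it stays at least 1/2 in
      modulus.\<close>
    define d where "d = \<rho> / (4 * B)"
    have d: "0 < d" "d \<le> \<rho> / 2" using \<rho> B by (auto simp: d_def field_simps)
    have cJl: "1 / 2 \<le> cmod (cev J z)" if z: "cmod (z - of_real x) \<le> d" for z
    proof -
      have "cmod (cev J z - cev J (of_real x)) \<le> (2 * B / \<rho>) * cmod (z - of_real x)"
      proof (rule field_differentiable_bound[where S = "cball (complex_of_real x) d"])
        fix y assume "y \<in> cball (complex_of_real x) d"
        then have "cmod (y - complex_of_real x) \<le> \<rho> / 2" using d by (simp add: dist_norm norm_minus_commute)
        then show "cmod (cev (pderiv J) y) \<le> 2 * B / \<rho>" by (rule cJ')
        show "(cev J has_field_derivative cev (pderiv J) y) (at y within cball (complex_of_real x) d)"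
          by (rule has_field_derivative_at_within[OF cev_deriv])
      qed (use z d in \<open>auto simp: dist_norm norm_minus_commute\<close>)
      also have "\<dots> \<le> (2 * B / \<rho>) * d" using z \<rho> B by (intro mult_left_mono) auto
      also have "\<dots> = 1 / 2" using \<rho> B by (simp add: d_def)
      finally have "cmod (cev J z - cev J (of_real x)) \<le> 1 / 2" .
      moreover have "1 \<le> cmod (cev J (of_real x))" using J1 by (simp add: cev_of_real)
      ultimately show ?thesis
        using norm_triangle_ineq2[of "cev J (of_real x)" "cev J z"] by (simp add: norm_minus_commute)
    qed
    have cQ: "cmod (cev Q z) \<le> 4 * A * e / \<rho>" if z: "cmod (z - of_real x) \<le> d" for z
    proof -
      have "cmod (cev Q z) * (1 / 2) \<le> cmod (cev Q z) * cmod (cev J z)"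
        by (intro mult_left_mono cJl[OF z]) auto
      also have "\<dots> = cmod (cev R z)" by (simp add: R_def cev_mult norm_mult)
      also have "\<dots> \<le> 2 * A * e / \<rho>" using z d by (intro cR) auto
      finally show ?thesis by simp
    qed
    have "\<bar>poly ((pderiv ^^ r) Q) x\<bar> = cmod (cev ((pderiv ^^ r) Q) (of_real x))"
      by (simp add: cev_of_real)
    also have "\<dots> \<le> fact r * (4 * A * e / \<rho>) / d ^ r"
      by (rule cauchy_bound_cev[OF d(1) cQ])
    also have "\<dots> = fact r * (4 * A * e) * (4 * B) ^ r / \<rho> ^ Suc r"
      using \<rho> B by (simp add: d_def power_divide)
    finally have "\<bar>poly ((pderiv ^^ r) Q) x\<bar> * \<rho> ^ Suc r \<le> fact r * (4 * A * e) * (4 * B) ^ r"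
      using \<rho> by (simp add: pos_le_divide_eq del: power_Suc)
    also have "A \<le> 12 ^ M * I"
    proof -
      have pw: "\<bar>poly R t\<bar> \<le> 12 ^ M * (\<bar>poly Q t\<bar> / dil n x t ^ M)" if "t \<in> {-1..1}" for t
      proof -
        have E: "0 < dil n x t" using dil_ge_1[OF n x, of t] by linarith
        have "(poly (peak n x) t * dil n x t) ^ M \<le> 12 ^ M"
          using peak_bounds[OF n x that] E by (intro power_mono) auto
        then have "poly J t \<le> 12 ^ M / dil n x t ^ M"
          using E by (simp add: J_def poly_power power_mult_distrib pos_le_divide_eq)
        moreover have "0 \<le> poly J t" using peak_bounds(1)[OF n x that] by (simp add: J_def poly_power)
        ultimately have "\<bar>poly Q t\<bar> * \<bar>poly J t\<bar> \<le> \<bar>poly Q t\<bar> * (12 ^ M / dil n x t ^ M)"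
          by (intro mult_left_mono) auto
        then show ?thesis by (simp add: R_def abs_mult mult_ac)
      qed
      have ne: "dil n x t ^ M \<noteq> 0" for t using dil_ge_1[OF n x, of t] by auto
      have "A \<le> integral {-1..1} (\<lambda>t. 12 ^ M * (\<bar>poly Q t\<bar> / dil n x t ^ M))"
        unfolding A_def
        by (intro integral_le integrable_continuous_real continuous_intros pw) (use ne in auto)
      then show ?thesis by (simp only: I_def integral_mult_right)
    qed
    finally show ?thesis
      using e B by (simp add: C_def I_def \<rho>_def mult_ac mult_left_mono mult_right_mono del: power_Suc)
  qed
  ultimately show ?thesis by blast
qed

section \<open>From derivatives to finite differences\<close>

text \<open>Pascal's rule, in the form needed for the induction below: a difference of order r + 1
  is one of order r applied to first differences.\<close>

lemma binomial_difference_Suc: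
  fixes f :: "nat \<Rightarrow> real"
  shows "(\<Sum>i=0..Suc r. real (Suc r choose i) * (-1) ^ (Suc r - i) * f i)
       = (\<Sum>i=0..r. real (r choose i) * (-1) ^ (r - i) * (f (Suc i) - f i))"
proof -
  define g where "g = (\<lambda>i. real (r choose i) * (-1) ^ (r - i))"
  have "(\<Sum>i=0..Suc r. real (Suc r choose i) * (-1) ^ (Suc r - i) * f i)
      = (-1) ^ Suc r * f 0 + (\<Sum>i=0..r. real (Suc r choose Suc i) * (-1) ^ (r - i) * f (Suc i))"
    unfolding sum.atLeast0_atMost_Suc_shift by simp
  also have "(\<Sum>i=0..r. real (Suc r choose Suc i) * (-1) ^ (r - i) * f (Suc i))
      = (\<Sum>i=0..r. g i * f (Suc i)) + (\<Sum>i=0..r. real (r choose Suc i) * (-1) ^ (r - i) * f (Suc i))"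
    by (simp add: g_def sum.distrib[symmetric] algebra_simps)
  also have "(\<Sum>i=0..r. real (r choose Suc i) * (-1) ^ (r - i) * f (Suc i))
      = (\<Sum>i=0..r. - (if i = r then 0 else g (Suc i) * f (Suc i)))"
  proof (intro sum.cong refl)
    fix i assume "i \<in> {0..r}"
    then have "i = r \<or> r - i = Suc (r - Suc i)" by auto
    then show "real (r choose Suc i) * (-1) ^ (r - i) * f (Suc i) = - (if i = r then 0 else g (Suc i) * f (Suc i))"
      by (auto simp: g_def)
  qed
  also have "\<dots> = - (\<Sum>i\<in>{0..<r}. g (Suc i) * f (Suc i))"
    unfolding sum_negf by (intro arg_cong[where f = uminus] sum.mono_neutral_cong_right) auto
  also have "(\<Sum>i\<in>{0..<r}. g (Suc i) * f (Suc i)) = (\<Sum>i=0..r. g i * f i) - g 0 * f 0"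
    by (induction r) simp_all
  finally show ?thesis
    by (simp add: g_def right_diff_distrib sum_subtractf del: sum.atLeast0_atMost_Suc)
qed

text \<open>Induction through the first difference q of p: by the mean value theorem the r-th
  derivative of q at z is h times the (r+1)-st derivative of p at a point between z and z + h, which
  stays within the range of the nodes.\<close>

lemma poly_difference_bound:
  assumes "0 \<le> h" "\<And>z. z \<in> {y..y + real r * h} \<Longrightarrow> \<bar>poly ((pderiv ^^ r) p) z\<bar> \<le> B"
  shows "\<bar>\<Sum>i=0..r. real (r choose i) * (-1) ^ (r - i) * poly p (y + real i * h)\<bar> \<le> h ^ r * B"
  using assms(2)
proof (induction r arbitrary: p B)
  case 0 then show ?case by simp
next
  case (Suc r)
  define q where "q = pcompose p [:h, 1:] - p"
  have shift: "(pderiv ^^ k) (pcompose s [:h, 1:]) = pcompose ((pderiv ^^ k) s) [:h, 1:]" for k and s :: "real poly"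
    by (induction k) (simp_all add: pderiv_pcompose pderiv_pCons)
  have diff: "(pderiv ^^ k) (s - t) = (pderiv ^^ k) s - (pderiv ^^ k) t" for k and s t :: "real poly"
    by (induction k) (simp_all add: pderiv_diff)
  have "\<bar>poly ((pderiv ^^ r) q) z\<bar> \<le> h * B" if z: "z \<in> {y..y + real r * h}" for z
  proof (cases "h = 0")
    case False
    then have h: "0 < h" using assms(1) by simp
    obtain u where u: "u > z" "u < z + h"
      "poly ((pderiv ^^ r) p) (z + h) - poly ((pderiv ^^ r) p) z = h * poly (pderiv ((pderiv ^^ r) p)) u"
      using poly_MVT[of z "z + h" "(pderiv ^^ r) p"] h by auto
    have "poly ((pderiv ^^ r) q) z = poly ((pderiv ^^ r) p) (z + h) - poly ((pderiv ^^ r) p) z"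
      by (simp add: q_def diff shift poly_pcompose algebra_simps)
    then have "\<bar>poly ((pderiv ^^ r) q) z\<bar> = h * \<bar>poly (pderiv ((pderiv ^^ r) p)) u\<bar>"
      using h by (simp only: u abs_mult)
    also have "\<dots> \<le> h * B"
      using Suc.prems[of u] u z h by (intro mult_left_mono) (auto simp: algebra_simps)
    finally show ?thesis .
  qed (simp add: q_def pcompose_idR diff)
  then have "\<bar>\<Sum>i=0..r. real (r choose i) * (-1) ^ (r - i) * poly q (y + real i * h)\<bar> \<le> h ^ r * (h * B)"
    by (rule Suc.IH)
  moreover have "poly q (y + real i * h) = poly p (y + real (Suc i) * h) - poly p (y + real i * h)" for i
    by (simp add: q_def poly_pcompose algebra_simps)
  ultimately show ?case
    unfolding binomial_difference_Suc by (simp add: mult_ac)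
qed

lemma symmetric_difference_poly_bound:
  "\<exists>C>0. \<forall>m Q x h. 1 \<le> m \<longrightarrow> degree Q < m \<longrightarrow> x \<in> {-1..1} \<longrightarrow> 0 \<le> h \<longrightarrow> h \<le> 1 / real m \<longrightarrow>
     \<bar>symmetric_difference r (h * phi x) (poly Q) x\<bar> * rho m x ^ Suc r
       \<le> C * (h * phi x) ^ r * integral {-1..1} (\<lambda>t. \<bar>poly Q t\<bar> / dil m x t ^ M)"
proof -
  obtain C0 where C0: "0 < C0" and bd: "\<And>n Q x. 1 \<le> n \<Longrightarrow> degree Q < n \<Longrightarrow> x \<in> {-1..1} \<Longrightarrow>
     \<bar>poly ((pderiv ^^ r) Q) x\<bar> * rho n x ^ Suc r
       \<le> C0 * integral {-1..1} (\<lambda>t. \<bar>poly Q t\<bar> / dil n x t ^ M)"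
    using pointwise_derivative_bound[of r M] by blast
  \<comment> \<open>All nodes lie within r/2 local scales of x, so \<open>dil m x y\<close> is at
    most 1 + r/2 there, and comparing \<open>rho\<close> at x and y costs twice that. The same K
    compares \<open>dil\<close> as seen from x and from y.\<close>
  define K where "K = 2 + real r"
  have K: "0 < K" "1 \<le> K" by (auto simp: K_def)
  define C where "C = K ^ Suc r * (C0 * K ^ M)"
  have "0 < C" using C0 K by (simp add: C_def)
  moreover have "\<bar>symmetric_difference r (h * phi x) (poly Q) x\<bar> * rho m x ^ Suc r
       \<le> C * (h * phi x) ^ r * integral {-1..1} (\<lambda>t. \<bar>poly Q t\<bar> / dil m x t ^ M)"
    if m: "1 \<le> m" and deg: "degree Q < m" and x: "x \<in> {-1..1}" and h: "0 \<le> h" "h \<le> 1 / real m" for m Q x h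
  proof -
    define s where "s = h * phi x"
    define I where "I = integral {-1..1} (\<lambda>t. \<bar>poly Q t\<bar> / dil m x t ^ M)"
    have \<rho>: "0 < rho m x" by (rule rho_pos[OF m x])
    have ne: "dil m u t ^ M \<noteq> 0" if "u \<in> {-1..1}" for u t using dil_ge_1[OF m that, of t] by auto
    have int: "(\<lambda>t. \<bar>poly Q t\<bar> / dil m u t ^ M) integrable_on {-1..1}" if "u \<in> {-1..1}" for u
      by (intro integrable_continuous_real continuous_intros) (use ne[OF that] in auto)
    have I0: "0 \<le> I" unfolding I_def
      by (intro integral_nonneg int x divide_nonneg_nonneg abs_ge_zero zero_le_power
          order_trans[OF zero_le_one dil_ge_1[OF m x]])
    have s0: "0 \<le> s" using h phi_nonneg[OF x] by (simp add: s_def)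
    have "s \<le> (1 / real m) * phi x" unfolding s_def using h phi_nonneg[OF x] by (intro mult_right_mono)
    also have "\<dots> \<le> rho m x" using phi_le_rho[OF m, of x] by simp
    finally have s: "s \<le> rho m x" .
    show ?thesis
    proof (cases "x - real r * s / 2 \<in> {-1..1} \<and> x + real r * s / 2 \<in> {-1..1}")
      case True
      define D where "D = K ^ Suc r * (C0 * (K ^ M * I)) / rho m x ^ Suc r"
      have "\<bar>poly ((pderiv ^^ r) Q) y\<bar> \<le> D" if "y \<in> {x - real r * s / 2..(x - real r * s / 2) + real r * s}" for y
      proof -
        have "x - real r * s / 2 + real r * s = x + real r * s / 2" by simp
        then have that: "x - real r * s / 2 \<le> y" "y \<le> x + real r * s / 2"
          using that by (simp_all only: atLeastAtMost_iff)
        then have y: "y \<in> {-1..1}" using True unfolding atLeastAtMost_iff by linarith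
        have dist: "\<bar>x - y\<bar> \<le> real r * s / 2" using that unfolding abs_le_iff by linarith
        also have "\<dots> \<le> real r * rho m x / 2" using s by (intro divide_right_mono mult_left_mono) auto
        finally have dist: "\<bar>x - y\<bar> \<le> real r * rho m x / 2" .
        then have "\<bar>x - y\<bar> / rho m x \<le> real r / 2" using \<rho> by (simp add: field_simps)
        then have "dil m x y \<le> 1 + real r / 2" by (simp only: dil_def add_left_mono)
        then have Exy: "2 * dil m x y \<le> K" unfolding K_def by linarith
        have \<rho>y: "0 < rho m y" by (rule rho_pos[OF m y])
        have r1: "rho m x \<le> K * rho m y"
          using rho_le_dil_left[OF m x y] mult_right_mono[OF Exy, of "rho m y"] \<rho>y by linarith
        have r2: "rho m y \<le> K * rho m x"
          using rho_le_dil_right[OF m x y] mult_right_mono[OF Exy, of "rho m x"] \<rho> by linarith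
        have dl: "dil m x t \<le> K * dil m y t" for t
        proof -
          have "\<bar>x - t\<bar> \<le> \<bar>x - y\<bar> + \<bar>y - t\<bar>" by linarith
          then have "\<bar>x - t\<bar> / rho m x \<le> (real r * rho m x / 2 + \<bar>y - t\<bar>) / rho m x"
            using dist \<rho> by (intro divide_right_mono) auto
          also have "\<dots> = real r / 2 + \<bar>y - t\<bar> / rho m x" using \<rho> by (simp add: add_divide_distrib)
          also have "\<bar>y - t\<bar> / rho m x \<le> K * (\<bar>y - t\<bar> / rho m y)"
          proof -
            have "1 / rho m x \<le> K / rho m y" using r2 \<rho> \<rho>y by (simp add: field_simps)
            then have "\<bar>y - t\<bar> * (1 / rho m x) \<le> \<bar>y - t\<bar> * (K / rho m y)" by (intro mult_left_mono) auto
            then show ?thesis by (simp add: mult.commute)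
          qed
          finally show ?thesis by (simp add: dil_def[of m x] dil_def[of m y] distrib_left K_def)
        qed
        have "\<bar>poly ((pderiv ^^ r) Q) y\<bar> * rho m x ^ Suc r \<le> \<bar>poly ((pderiv ^^ r) Q) y\<bar> * (K * rho m y) ^ Suc r"
          using r1 \<rho> by (intro mult_left_mono power_mono) auto
        also have "\<dots> = K ^ Suc r * (\<bar>poly ((pderiv ^^ r) Q) y\<bar> * rho m y ^ Suc r)"
          by (simp only: power_mult_distrib mult_ac)
        also have "\<dots> \<le> K ^ Suc r * (C0 * integral {-1..1} (\<lambda>t. \<bar>poly Q t\<bar> / dil m y t ^ M))"
          using K by (intro mult_left_mono bd m deg y) auto
        also have "integral {-1..1} (\<lambda>t. \<bar>poly Q t\<bar> / dil m y t ^ M)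
            \<le> integral {-1..1} (\<lambda>t. K ^ M * (\<bar>poly Q t\<bar> / dil m x t ^ M))"
        proof (intro integral_le int y integrable_on_mult_right x)
          fix t :: real
          have E: "1 \<le> dil m x t" "1 \<le> dil m y t" using dil_ge_1[OF m] x y by auto
          have "dil m x t ^ M \<le> (K * dil m y t) ^ M" using dl E by (intro power_mono) auto
          then have "1 / dil m y t ^ M \<le> K ^ M / dil m x t ^ M"
            using E zero_less_power[of "dil m x t" M] zero_less_power[of "dil m y t" M]
            by (simp add: power_mult_distrib field_simps)
          then have "\<bar>poly Q t\<bar> * (1 / dil m y t ^ M) \<le> \<bar>poly Q t\<bar> * (K ^ M / dil m x t ^ M)"
            by (intro mult_left_mono) auto
          then show "\<bar>poly Q t\<bar> / dil m y t ^ M \<le> K ^ M * (\<bar>poly Q t\<bar> / dil m x t ^ M)"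
            by (simp add: mult.commute)
        qed
        also have "\<dots> = K ^ M * I" by (simp only: I_def integral_mult_right)
        finally show ?thesis
          unfolding D_def using \<rho> K C0 by (simp add: pos_le_divide_eq del: power_Suc)
      qed
      then have "\<bar>symmetric_difference r s (poly Q) x\<bar> \<le> s ^ r * D"
        using True poly_difference_bound[OF s0, of "x - real r * s / 2" r Q D]
        by (simp add: symmetric_difference_def)
      then have "\<bar>symmetric_difference r s (poly Q) x\<bar> * rho m x ^ Suc r \<le> s ^ r * D * rho m x ^ Suc r"
        using \<rho> by (intro mult_right_mono) auto
      also have "\<dots> = C * s ^ r * I" using \<rho> by (simp add: D_def C_def del: power_Suc)
      finally show ?thesis by (simp add: s_def I_def)
    next
      case False
      then have "symmetric_difference r (h * phi x) (poly Q) x = 0"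
        by (auto simp: symmetric_difference_def s_def)
      then show ?thesis using \<open>0 < C\<close> I0 s0 by (simp add: I_def s_def)
    qed
  qed
  ultimately show ?thesis by blast
qed

section \<open>Weighted norms on \<open>[-1,1]\<close>\<close>

text \<open>The weight is absorbed into the function, \<open>\<parallel>g\<parallel>\<^bsub>p,v\<^esub> = \<parallel>g v\<^bsup>1/\<lambda>\<^esup>\<parallel>\<^sub>p\<close> with \<open>\<lambda> = \<lambda>\<^sub>p\<close>, which treats finite and
  infinite \<open>p\<close> alike.\<close>

definition norm_le :: "ennreal \<Rightarrow> (real \<Rightarrow> real) \<Rightarrow> real \<Rightarrow> bool" where
  "norm_le p g A \<longleftrightarrow>
     (if p = \<infinity> then AE x in lborel. x \<in> {-1..1} \<longrightarrow> \<bar>g x\<bar> \<le> A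
      else (\<integral>\<^sup>+x. ennreal (\<bar>g x\<bar> powr enn2real p) * indicator {-1..1} x \<partial>lborel) \<le> ennreal (A powr enn2real p))"

lemma enn2real_ge_1: "1 \<le> p \<Longrightarrow> p \<noteq> \<infinity> \<Longrightarrow> 1 \<le> enn2real p"
  by (cases p rule: ennreal_cases) (auto simp flip: ennreal_1 simp: ennreal_le_iff2)

lemma lam_ge_1: "1 \<le> p \<Longrightarrow> 1 \<le> lam p"
  by (simp add: lam_def enn2real_ge_1)

lemma AE_lebesgue_on_iff:
  "(AE x in lebesgue_on {-1..1::real}. Q x) \<longleftrightarrow> (AE x in lborel. x \<in> {-1..1} \<longrightarrow> Q x)"
  by (simp add: AE_restrict_space_iff AE_completion_iff)

lemma nn_integral_lebesgue_on:
  "(\<integral>\<^sup>+x. F x \<partial>lebesgue_on {-1..1::real}) = (\<integral>\<^sup>+x. F x * indicator {-1..1} x \<partial>lborel)"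
  by (simp add: nn_integral_restrict_space nn_integral_completion)

lemma measurable_lebesgue_on_AE:
  fixes g g' :: "real \<Rightarrow> real"
  assumes "g' \<in> borel_measurable borel" "AE x in lborel. x \<in> {-1..1} \<longrightarrow> g x = g' x"
  shows "g \<in> borel_measurable (lebesgue_on {-1..1})"
proof -
  define g0 where "g0 = (\<lambda>x. if x \<in> {-1..1} then g x else g' x)"
  have "g0 \<in> borel_measurable lebesgue"
  proof (rule borel_measurable_AE)
    show "g' \<in> borel_measurable lebesgue" using assms(1) by (simp add: measurable_completion)
    show "AE x in lebesgue. g' x = g0 x"
      unfolding AE_completion_iff using assms(2) by eventually_elim (auto simp: g0_def)
  qed
  then have "g0 \<in> borel_measurable (lebesgue_on {-1..1})" by (rule measurable_restrict_space1)
  then show ?thesis by (rule measurable_cong[THEN iffD1, rotated]) (simp add: g0_def)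
qed

text \<open>The bridge from the norm of the statement to \<open>norm_le\<close>. It replaces a
  Lebesgue measurable g by a Borel representative, since the substitution and Fubini arguments below
  compose and multiply functions.\<close>

lemma wnorm_le_iff:
  assumes p: "1 \<le> p" and A: "0 \<le> A" and [measurable]: "g' \<in> borel_measurable borel" "v \<in> borel_measurable borel"
    and eq: "AE x in lborel. x \<in> {-1..1} \<longrightarrow> g x = g' x" and v: "\<And>x. x \<in> {-1..1} \<Longrightarrow> 0 \<le> v x"
  shows "wnorm p v g \<le> ennreal A \<longleftrightarrow> norm_le p (\<lambda>x. g' x * v x powr (1 / lam p)) A"
proof (cases "p = \<infinity>")
  case True
  have [measurable]: "g \<in> borel_measurable (lebesgue_on {-1..1})"
    by (rule measurable_lebesgue_on_AE[OF _ eq]) simp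
  have [measurable]: "v \<in> borel_measurable (lebesgue_on {-1..1})"
    by (intro measurable_restrict_space1 measurable_completion) simp
  have "wnorm p v g \<le> ennreal A \<longleftrightarrow> (AE x in lebesgue_on {-1..1}. ennreal (\<bar>g x\<bar> * v x) \<le> ennreal A)"
  proof
    assume "wnorm p v g \<le> ennreal A"
    then show "AE x in lebesgue_on {-1..1}. ennreal (\<bar>g x\<bar> * v x) \<le> ennreal A"
      using esssup_AE[where f = "\<lambda>x. ennreal (\<bar>g x\<bar> * v x)" and M = "lebesgue_on {-1..1}"] True
      unfolding wnorm_def by (auto elim: eventually_mono)
  next
    assume "AE x in lebesgue_on {-1..1}. ennreal (\<bar>g x\<bar> * v x) \<le> ennreal A"
    then show "wnorm p v g \<le> ennreal A"
      using True unfolding wnorm_def by (simp add: esssup_eq_AE Inf_lower)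
  qed
  also have "\<dots> \<longleftrightarrow> (AE x in lborel. x \<in> {-1..1} \<longrightarrow> \<bar>g' x * v x powr (1 / lam p)\<bar> \<le> A)"
    unfolding AE_lebesgue_on_iff
  proof (rule eventually_subst)
    show "AE x in lborel. (x \<in> {-1..1} \<longrightarrow> ennreal (\<bar>g x\<bar> * v x) \<le> ennreal A)
        = (x \<in> {-1..1} \<longrightarrow> \<bar>g' x * v x powr (1 / lam p)\<bar> \<le> A)"
      using eq by eventually_elim (use v A True in \<open>auto simp: lam_def abs_mult ennreal_le_iff powr_one\<close>)
  qed
  finally show ?thesis using True by (simp add: norm_le_def)
next
  case False
  define P where "P = enn2real p"
  have P: "1 \<le> P" using enn2real_ge_1[OF p False] by (simp add: P_def)
  define I where "I = (\<integral>\<^sup>+x. ennreal (\<bar>g x\<bar> powr P * v x) \<partial>lebesgue_on {-1..1})"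
  have I: "I = (\<integral>\<^sup>+x. ennreal (\<bar>g' x * v x powr (1 / lam p)\<bar> powr P) * indicator {-1..1} x \<partial>lborel)"
    unfolding I_def nn_integral_lebesgue_on
  proof (rule nn_integral_cong_AE)
    have "(v x powr (1 / P)) powr P = v x" if "x \<in> {-1..1}" for x
      using v[OF that] P by (simp add: powr_powr powr_one)
    then have "\<bar>a * v x powr (1 / lam p)\<bar> powr P = \<bar>a\<bar> powr P * v x" if "x \<in> {-1..1}" for a x
      using that False by (simp add: abs_mult powr_mult lam_def P_def)
    then show "AE x in lborel. ennreal (\<bar>g x\<bar> powr P * v x) * indicator {-1..1} x
        = ennreal (\<bar>g' x * v x powr (1 / lam p)\<bar> powr P) * indicator {-1..1} x"
      using eq by (auto elim!: eventually_mono simp: indicator_def)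
  qed
  have "wnorm p v g \<le> ennreal A \<longleftrightarrow> I \<le> ennreal (A powr P)"
  proof (cases I rule: ennreal_cases)
    case (real i)
    have "i powr (1 / P) \<le> A \<longleftrightarrow> i \<le> A powr P"
    proof
      assume "i powr (1 / P) \<le> A"
      then have "(i powr (1 / P)) powr P \<le> A powr P" using P by (intro powr_mono2) auto
      then show "i \<le> A powr P" using P real by (simp add: powr_powr)
    next
      assume "i \<le> A powr P"
      then have "i powr (1 / P) \<le> (A powr P) powr (1 / P)" using P real by (intro powr_mono2) auto
      then show "i powr (1 / P) \<le> A" using P A by (simp add: powr_powr)
    qed
    then show ?thesis
      using False A real unfolding wnorm_def I_def[symmetric, unfolded P_def] P_def[symmetric]
      by (simp add: Let_def ennreal_le_iff I_def[symmetric, unfolded P_def] P_def)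
  next
    case top
    then show ?thesis
      using False unfolding wnorm_def by (simp add: Let_def I_def P_def top_unique)
  qed
  then show ?thesis using False I by (simp add: norm_le_def P_def)
qed

lemma norm_le_mono:
  assumes p: "1 \<le> p" and "norm_le p g A" and "AE x in lborel. x \<in> {-1..1} \<longrightarrow> \<bar>g' x\<bar> \<le> \<bar>g x\<bar>"
  shows "norm_le p g' A"
proof (cases "p = \<infinity>")
  case True
  then show ?thesis
    using assms(2,3) unfolding norm_le_def by simp (elim AE_mp, auto)
next
  case False
  have "(\<integral>\<^sup>+x. ennreal (\<bar>g' x\<bar> powr enn2real p) * indicator {-1..1} x \<partial>lborel)
      \<le> (\<integral>\<^sup>+x. ennreal (\<bar>g x\<bar> powr enn2real p) * indicator {-1..1} x \<partial>lborel)"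
  proof (rule nn_integral_mono_AE)
    show "AE x in lborel. ennreal (\<bar>g' x\<bar> powr enn2real p) * indicator {-1..1} x
        \<le> ennreal (\<bar>g x\<bar> powr enn2real p) * indicator {-1..1} x"
      using assms(3) by eventually_elim (auto simp: indicator_def intro!: ennreal_leI powr_mono2)
  qed
  then show ?thesis using assms(2) False by (auto simp: norm_le_def)
qed

lemma norm_le_bound_mono:
  assumes "1 \<le> p" "norm_le p g A" "0 \<le> A" "A \<le> B" shows "norm_le p g B"
proof (cases "p = \<infinity>")
  case True
  then show ?thesis using assms(2,4) unfolding norm_le_def by (auto elim!: eventually_mono)
next
  case False
  have "A powr enn2real p \<le> B powr enn2real p" using assms by (intro powr_mono2) auto
  then show ?thesis using assms(2) False by (auto simp: norm_le_def intro: order_trans ennreal_leI)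
qed

lemma norm_le_scale:
  assumes p: "1 \<le> p" and [measurable]: "g \<in> borel_measurable borel" and "norm_le p g A" "0 \<le> c" "0 \<le> A"
  shows "norm_le p (\<lambda>x. c * g x) (c * A)"
proof (cases "p = \<infinity>")
  case True
  then show ?thesis
    using assms(3-5) unfolding norm_le_def by (auto elim!: eventually_mono simp: abs_mult intro!: mult_left_mono)
next
  case False
  define P where "P = enn2real p"
  have "(\<integral>\<^sup>+x. ennreal (\<bar>c * g x\<bar> powr P) * indicator {-1..1} x \<partial>lborel)
      = (\<integral>\<^sup>+x. ennreal (c powr P) * (ennreal (\<bar>g x\<bar> powr P) * indicator {-1..1} x) \<partial>lborel)"
    using assms(4) by (intro nn_integral_cong) (simp add: abs_mult powr_mult ennreal_mult mult.assoc)
  also have "\<dots> = ennreal (c powr P) * (\<integral>\<^sup>+x. ennreal (\<bar>g x\<bar> powr P) * indicator {-1..1} x \<partial>lborel)"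
    by (rule nn_integral_cmult) simp
  also have "\<dots> \<le> ennreal (c powr P) * ennreal (A powr P)"
    using assms(3) False by (intro mult_left_mono) (auto simp: norm_le_def P_def)
  also have "\<dots> = ennreal ((c * A) powr P)"
    using assms(4,5) by (simp add: powr_mult ennreal_mult)
  finally show ?thesis using False by (simp add: norm_le_def P_def)
qed

lemma powr_convex_combination:
  assumes "1 \<le> (P::real)" "0 \<le> s" "0 \<le> t" "0 \<le> a" "0 \<le> b" "a + b = 1"
  shows "(a * s + b * t) powr P \<le> a * s powr P + b * t powr P"
proof -
  have sub: "c powr P \<le> c" if "0 \<le> c" "c \<le> 1" for c :: real
    using powr_mono'[of 1 P c] that assms(1) by simp
  consider "s = 0" | "t = 0" | "0 < s" "0 < t" using assms by linarith
  then show ?thesis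
  proof cases
    case 1 then show ?thesis using sub[of b] assms by (auto simp: powr_mult intro!: mult_right_mono)
  next
    case 2 then show ?thesis using sub[of a] assms by (auto simp: powr_mult intro!: mult_right_mono)
  next
    case 3
    have a: "a = 1 - b" and "b \<le> 1" using assms by simp_all
    then show ?thesis
      unfolding a using convex_onD[OF powr_convex[OF assms(1)], of b s t] 3 assms(5) by simp
  qed
qed

text \<open>Minkowski's inequality by convexity: g1/A and g2/B are combined with weights A/S and
  B/S. The divisions are why the bounds are strictly positive, and why all bounds in the telescoping
  are kept so.\<close>

lemma norm_le_add:
  assumes p: "1 \<le> p" and [measurable]: "g1 \<in> borel_measurable borel" "g2 \<in> borel_measurable borel"
    and "norm_le p g1 A" "norm_le p g2 B" "0 < A" "0 < B"
  shows "norm_le p (\<lambda>x. g1 x + g2 x) (A + B)"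
proof (cases "p = \<infinity>")
  case True
  have "AE x in lborel. x \<in> {-1..1} \<longrightarrow> \<bar>g1 x\<bar> \<le> A" "AE x in lborel. x \<in> {-1..1} \<longrightarrow> \<bar>g2 x\<bar> \<le> B"
    using assms(4,5) True by (auto simp: norm_le_def)
  then have "AE x in lborel. x \<in> {-1..1} \<longrightarrow> \<bar>g1 x + g2 x\<bar> \<le> A + B"
    by eventually_elim auto
  then show ?thesis using True by (simp add: norm_le_def)
next
  case False
  define P where "P = enn2real p"
  have P: "1 \<le> P" using enn2real_ge_1[OF p False] by (simp add: P_def)
  define S where "S = A + B"
  have S: "0 < S" using assms by (simp add: S_def)
  define F where "F = (\<lambda>(g :: real \<Rightarrow> real) x. ennreal (\<bar>g x\<bar> powr P) * indicator {-1..1} x :: ennreal)"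
  define ca where "ca = S powr P * (A / S) / A powr P"
  define cb where "cb = S powr P * (B / S) / B powr P"
  have c0: "0 \<le> ca" "0 \<le> cb" using assms S by (auto simp: ca_def cb_def)
  have [measurable]: "F g1 \<in> borel_measurable borel" "F g2 \<in> borel_measurable borel"
    unfolding F_def by measurable
  have pw: "\<bar>g1 x + g2 x\<bar> powr P \<le> ca * \<bar>g1 x\<bar> powr P + cb * \<bar>g2 x\<bar> powr P" for x
  proof -
    have e: "S * ((A / S) * (\<bar>g1 x\<bar> / A) + (B / S) * (\<bar>g2 x\<bar> / B)) = \<bar>g1 x\<bar> + \<bar>g2 x\<bar>"
      using assms S by (simp add: distrib_left)
    have "\<bar>g1 x + g2 x\<bar> powr P \<le> (\<bar>g1 x\<bar> + \<bar>g2 x\<bar>) powr P"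
      using P by (intro powr_mono2) auto
    also have "\<dots> = S powr P * ((A / S) * (\<bar>g1 x\<bar> / A) + (B / S) * (\<bar>g2 x\<bar> / B)) powr P"
      unfolding e[symmetric] by (rule powr_mult)
    also have "\<dots> \<le> S powr P * ((A / S) * (\<bar>g1 x\<bar> / A) powr P + (B / S) * (\<bar>g2 x\<bar> / B) powr P)"
      using assms S P by (intro mult_left_mono powr_convex_combination)
        (auto simp: add_divide_distrib[symmetric] S_def)
    also have "\<dots> = ca * \<bar>g1 x\<bar> powr P + cb * \<bar>g2 x\<bar> powr P"
      using assms by (simp add: ca_def cb_def powr_divide distrib_left)
    finally show ?thesis .
  qed
  have "(\<integral>\<^sup>+x. F (\<lambda>x. g1 x + g2 x) x \<partial>lborel) \<le> (\<integral>\<^sup>+x. ennreal ca * F g1 x + ennreal cb * F g2 x \<partial>lborel)"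
  proof (rule nn_integral_mono)
    fix x
    have "ennreal (\<bar>g1 x + g2 x\<bar> powr P) \<le> ennreal (ca * \<bar>g1 x\<bar> powr P + cb * \<bar>g2 x\<bar> powr P)"
      by (rule ennreal_leI[OF pw])
    also have "\<dots> = ennreal ca * ennreal (\<bar>g1 x\<bar> powr P) + ennreal cb * ennreal (\<bar>g2 x\<bar> powr P)"
      using c0 by (simp add: ennreal_mult ennreal_plus)
    finally show "F (\<lambda>x. g1 x + g2 x) x \<le> ennreal ca * F g1 x + ennreal cb * F g2 x"
      by (auto simp: F_def indicator_def)
  qed
  also have "\<dots> = ennreal ca * (\<integral>\<^sup>+x. F g1 x \<partial>lborel) + ennreal cb * (\<integral>\<^sup>+x. F g2 x \<partial>lborel)"
    by (simp add: nn_integral_add nn_integral_cmult)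
  also have "\<dots> \<le> ennreal ca * ennreal (A powr P) + ennreal cb * ennreal (B powr P)"
    using assms(4,5) False by (intro add_mono mult_left_mono) (auto simp: norm_le_def F_def P_def)
  also have "\<dots> = ennreal (ca * A powr P + cb * B powr P)"
    using c0 by (simp add: ennreal_mult ennreal_plus)
  also have "ca * A powr P + cb * B powr P = S powr P"
  proof -
    have "ca * A powr P + cb * B powr P = S powr P * (A / S) + S powr P * (B / S)"
      using assms by (simp add: ca_def cb_def)
    also have "\<dots> = S powr P * ((A + B) / S)" by (simp only: distrib_left add_divide_distrib)
    finally show ?thesis using S by (simp add: S_def)
  qed
  finally show ?thesis using False by (simp add: norm_le_def F_def P_def S_def)
qed

lemma norm_le_sum:
  assumes p: "1 \<le> p" and "\<And>i. g i \<in> borel_measurable borel"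
    and "\<And>i. i \<le> n \<Longrightarrow> norm_le p (g i) (A i)" "\<And>i. i \<le> n \<Longrightarrow> 0 < A i"
  shows "norm_le p (\<lambda>x. \<Sum>i\<le>(n::nat). g i x) (\<Sum>i\<le>n. A i)"
  using assms(3,4)
proof (induction n)
  case (Suc n)
  have "0 < (\<Sum>i\<le>n. A i)" using Suc.prems by (intro sum_pos) auto
  then show ?case
    unfolding sum.atMost_Suc using Suc assms(2) p by (intro norm_le_add borel_measurable_sum) auto
qed simp

section \<open>Schur's test\<close>

text \<open>A bound for u that is linear in u^P, with equality at u = a. Being linear it can be
  integrated against a kernel, and a is optimised afterwards.\<close>

lemma Young_powr:
  assumes "1 \<le> (P::real)" "0 \<le> u" "0 < a"
  shows "u \<le> a powr (1 - P) * u powr P / P + (1 - 1 / P) * a"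
proof (cases "u = 0")
  case False
  then have u: "0 < u" using assms by simp
  have "((u / a) powr P) powr (1 / P) * 1 powr (1 - 1 / P) \<le> (1 / P) * (u / a) powr P + (1 - 1 / P) * 1"
    using assms u by (intro Youngs_inequality_0) auto
  then have "u / a \<le> (1 / P) * (u / a) powr P + (1 - 1 / P)"
    using assms u by (simp add: powr_powr)
  then have "a * (u / a) \<le> a * ((1 / P) * (u / a) powr P + (1 - 1 / P))"
    using assms by (intro mult_left_mono) auto
  moreover have "a * (u / a) powr P = a powr (1 - P) * u powr P"
    using assms u by (simp add: powr_divide powr_diff)
  ultimately show ?thesis using assms by (simp add: distrib_left mult_ac)
qed (use assms in auto)

text \<open>Jensen's inequality for a kernel of mass at most C instead of exactly 1. It is stated
  for a real X below the integral of k u, so that this integral need not be known to be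
  finite.\<close>

lemma nn_integral_Jensen_powr:
  fixes k :: "'a \<Rightarrow> ennreal" and u :: "'a \<Rightarrow> real"
  assumes [measurable]: "k \<in> borel_measurable M" "u \<in> borel_measurable M"
    and P: "1 \<le> (P::real)" and u: "\<And>t. 0 \<le> u t" and C: "0 < C" "(\<integral>\<^sup>+t. k t \<partial>M) \<le> ennreal C"
    and X: "0 \<le> X" "ennreal X \<le> (\<integral>\<^sup>+t. k t * ennreal (u t) \<partial>M)"
  shows "ennreal (X powr P) \<le> ennreal (C powr (P - 1)) * (\<integral>\<^sup>+t. k t * ennreal (u t powr P) \<partial>M)"
proof (cases "(\<integral>\<^sup>+t. k t * ennreal (u t powr P) \<partial>M)" rule: ennreal_cases)
  case (real y)
  have tangent: "X \<le> a powr (1 - P) / P * y + (1 - 1 / P) * a * C" if a: "0 < a" for a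
  proof -
    define c d where "c = a powr (1 - P) / P" and "d = (1 - 1 / P) * a"
    have cd: "0 \<le> c" "0 \<le> d" using P a by (auto simp: c_def d_def)
    have "ennreal X \<le> (\<integral>\<^sup>+t. k t * ennreal (u t) \<partial>M)" by (rule X)
    also have "\<dots> \<le> (\<integral>\<^sup>+t. ennreal c * (k t * ennreal (u t powr P)) + ennreal d * k t \<partial>M)"
    proof (rule nn_integral_mono)
      fix t
      have "ennreal (u t) \<le> ennreal (c * u t powr P + d)"
        using Young_powr[OF P u a, of t] by (intro ennreal_leI) (simp add: c_def d_def)
      also have "\<dots> = ennreal c * ennreal (u t powr P) + ennreal d"
        using cd by (simp add: ennreal_mult ennreal_plus)
      finally have "k t * ennreal (u t) \<le> k t * (ennreal c * ennreal (u t powr P) + ennreal d)"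
        by (intro mult_left_mono) auto
      then show "k t * ennreal (u t) \<le> ennreal c * (k t * ennreal (u t powr P)) + ennreal d * k t"
        by (simp add: distrib_left mult_ac)
    qed
    also have "\<dots> = ennreal c * ennreal y + ennreal d * (\<integral>\<^sup>+t. k t \<partial>M)"
      by (simp add: nn_integral_add nn_integral_cmult real)
    also have "\<dots> \<le> ennreal c * ennreal y + ennreal d * ennreal C"
      by (intro add_left_mono mult_left_mono C) auto
    also have "\<dots> = ennreal (c * y + d * C)"
      using cd C real by (simp add: ennreal_mult ennreal_plus)
    finally have "ennreal X \<le> ennreal (c * y + d * C)" .
    moreover have "0 \<le> c * y + d * C" using cd C real by simp
    ultimately have "X \<le> c * y + d * C" by (simp only: ennreal_le_iff)
    then show ?thesis by (simp only: c_def d_def)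
  qed
  have "X powr P \<le> C powr (P - 1) * y"
  proof (cases "y = 0")
    case True
    have "X = 0"
    proof (rule ccontr)
      assume "X \<noteq> 0"
      then have "0 < X" using X by simp
      \<comment> \<open>With y = 0 only the term in a is left, and a = X/(2C) makes it at most
        X/2.\<close>
      have "X \<le> (1 - 1 / P) * (X / (2 * C)) * C"
        using tangent[of "X / (2 * C)"] True \<open>0 < X\<close> C by simp
      also have "\<dots> = (1 - 1 / P) * (X / 2)" using C by simp
      also have "\<dots> \<le> 1 * (X / 2)" using P \<open>0 < X\<close> by (intro mult_right_mono) auto
      finally show False using \<open>0 < X\<close> by simp
    qed
    then show ?thesis using P True by simp
  next
    case False
    then have y: "0 < y" using real by simp
    \<comment> \<open>The minimiser of the tangent bound; at it both terms are multiples of a C and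
      add up to a C.\<close>
    define a where "a = (y / C) powr (1 / P)"
    have a: "0 < a" "a powr P = y / C" using y C P by (auto simp: a_def powr_powr)
    have "a powr (1 - P) = a * C / y" using a y C by (simp add: powr_diff)
    then have "X \<le> a * C / y / P * y + (1 - 1 / P) * a * C" using tangent[OF a(1)] by simp
    also have "\<dots> = a * C" using y P by (simp add: field_simps)
    finally have "X powr P \<le> (a * C) powr P" using X P by (intro powr_mono2) auto
    also have "\<dots> = y / C * C powr P" by (simp add: powr_mult a)
    also have "\<dots> = C powr (P - 1) * y" using C by (simp add: powr_diff)
    finally show ?thesis .
  qed
  then have "ennreal (X powr P) \<le> ennreal (C powr (P - 1) * y)" by (rule ennreal_leI)
  then show ?thesis using real by (simp add: ennreal_mult)
next
  case top
  then show ?thesis using C by (simp add: ennreal_mult_top)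
qed

text \<open>For finite p, Jensen with the row bound yields C^(P - 1), and after Fubini the column
  bound yields the missing factor C. For p = \<infinity> the row bound alone does it.\<close>

lemma norm_le_Schur:
  fixes k :: "real \<Rightarrow> real \<Rightarrow> ennreal"
  assumes p: "1 \<le> p" and km: "(\<lambda>(x, t). k x t) \<in> borel_measurable (borel \<Otimes>\<^sub>M borel)"
    and um[measurable]: "u \<in> borel_measurable borel" and u: "\<And>t. 0 \<le> u t"
    and C: "0 < C"
    and row: "\<And>x. x \<in> {-1..1} \<Longrightarrow> (\<integral>\<^sup>+t. k x t * indicator {-1..1} t \<partial>lborel) \<le> ennreal C"
    and col: "\<And>t. t \<in> {-1..1} \<Longrightarrow> (\<integral>\<^sup>+x. k x t * indicator {-1..1} x \<partial>lborel) \<le> ennreal C"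
    and g: "\<And>x. x \<in> {-1..1} \<Longrightarrow> ennreal \<bar>g x\<bar> \<le> (\<integral>\<^sup>+t. k x t * ennreal (u t) * indicator {-1..1} t \<partial>lborel)"
    and nu: "norm_le p u A" and A: "0 \<le> A"
  shows "norm_le p g (C * A)"
proof -
  have [measurable]: "k x \<in> borel_measurable borel" for x
    using measurable_compose[OF measurable_Pair1'[of x borel borel] km] by simp
  have [measurable]: "(\<lambda>x. k x t) \<in> borel_measurable borel" for t
    using measurable_compose[OF measurable_Pair2'[of t borel borel] km] by simp
  show ?thesis
  proof (cases "p = \<infinity>")
    case True
    have ae: "AE t in lborel. t \<in> {-1..1} \<longrightarrow> u t \<le> A"
      using nu True u by (simp add: norm_le_def)
    have "\<bar>g x\<bar> \<le> C * A" if x: "x \<in> {-1..1}" for x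
    proof -
      have "ennreal \<bar>g x\<bar> \<le> (\<integral>\<^sup>+t. k x t * ennreal (u t) * indicator {-1..1} t \<partial>lborel)" by (rule g[OF x])
      also have "\<dots> \<le> (\<integral>\<^sup>+t. ennreal A * (k x t * indicator {-1..1} t) \<partial>lborel)"
      proof (rule nn_integral_mono_AE)
        show "AE t in lborel. k x t * ennreal (u t) * indicator {-1..1} t \<le> ennreal A * (k x t * indicator {-1..1} t)"
          using ae
        proof eventually_elim
          case (elim t)
          then show ?case
            by (auto simp: indicator_def mult.commute[of "ennreal A"] intro!: mult_left_mono ennreal_leI)
        qed
      qed
      also have "\<dots> = ennreal A * (\<integral>\<^sup>+t. k x t * indicator {-1..1} t \<partial>lborel)"
        by (rule nn_integral_cmult) measurable
      also have "\<dots> \<le> ennreal A * ennreal C" by (intro mult_left_mono row x) auto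
      also have "\<dots> = ennreal (C * A)" using A C by (simp add: ennreal_mult mult.commute)
      finally show ?thesis using A C by (simp add: ennreal_le_iff)
    qed
    then show ?thesis using True by (simp add: norm_le_def)
  next
    case False
    define P where "P = enn2real p"
    have P: "1 \<le> P" using enn2real_ge_1[OF p False] by (simp add: P_def)
    define I where "I = (indicator {-1..1} :: real \<Rightarrow> ennreal)"
    have [measurable]: "I \<in> borel_measurable borel" by (simp add: I_def)
    define D where "D = ennreal (C powr (P - 1))"
    have km': "(\<lambda>(x, t). k x t * ennreal (u t powr P) * I t * I x) \<in> borel_measurable (lborel \<Otimes>\<^sub>M lborel)"
      using km by measurable
    have "(\<integral>\<^sup>+x. ennreal (\<bar>g x\<bar> powr P) * I x \<partial>lborel)
        \<le> (\<integral>\<^sup>+x. D * (\<integral>\<^sup>+t. k x t * ennreal (u t powr P) * I t * I x \<partial>lborel) \<partial>lborel)"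
    proof (rule nn_integral_mono)
      fix x
      show "ennreal (\<bar>g x\<bar> powr P) * I x \<le> D * (\<integral>\<^sup>+t. k x t * ennreal (u t powr P) * I t * I x \<partial>lborel)"
      proof (cases "x \<in> {-1..1}")
        case True
        have "ennreal (\<bar>g x\<bar> powr P) \<le> D * (\<integral>\<^sup>+t. k x t * I t * ennreal (u t powr P) \<partial>lborel)"
          unfolding D_def using g[OF True] row[OF True] P u C
          by (intro nn_integral_Jensen_powr) (auto simp: I_def mult_ac)
        then show ?thesis using True by (simp add: I_def mult_ac)
      qed (simp add: I_def)
    qed
    also have "\<dots> = D * (\<integral>\<^sup>+x. \<integral>\<^sup>+t. k x t * ennreal (u t powr P) * I t * I x \<partial>lborel \<partial>lborel)"
      using km' by (intro nn_integral_cmult lborel.borel_measurable_nn_integral) (simp add: case_prod_unfold)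
    also have "(\<integral>\<^sup>+x. \<integral>\<^sup>+t. k x t * ennreal (u t powr P) * I t * I x \<partial>lborel \<partial>lborel)
        = (\<integral>\<^sup>+t. \<integral>\<^sup>+x. k x t * ennreal (u t powr P) * I t * I x \<partial>lborel \<partial>lborel)"
      using lborel_pair.Fubini'[OF km'] by simp
    also have "\<dots> \<le> (\<integral>\<^sup>+t. ennreal C * (ennreal (u t powr P) * I t) \<partial>lborel)"
    proof (rule nn_integral_mono)
      fix t :: real
      have "(\<integral>\<^sup>+x. k x t * ennreal (u t powr P) * I t * I x \<partial>lborel)
          = (\<integral>\<^sup>+x. (ennreal (u t powr P) * I t) * (k x t * I x) \<partial>lborel)"
        by (simp add: mult_ac)
      also have "\<dots> = (ennreal (u t powr P) * I t) * (\<integral>\<^sup>+x. k x t * I x \<partial>lborel)"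
        by (rule nn_integral_cmult) measurable
      also have "\<dots> \<le> (ennreal (u t powr P) * I t) * ennreal C"
        using col[of t] by (cases "t \<in> {-1..1}") (auto simp: I_def intro!: mult_left_mono)
      finally show "(\<integral>\<^sup>+x. k x t * ennreal (u t powr P) * I t * I x \<partial>lborel) \<le> ennreal C * (ennreal (u t powr P) * I t)"
        by (simp add: mult.commute)
    qed
    also have "\<dots> = ennreal C * (\<integral>\<^sup>+t. ennreal (u t powr P) * I t \<partial>lborel)"
      by (rule nn_integral_cmult) measurable
    also have "\<dots> \<le> ennreal C * ennreal (A powr P)"
      using nu False u by (intro mult_left_mono) (auto simp: norm_le_def I_def P_def)
    also have "D * (ennreal C * ennreal (A powr P)) = ennreal ((C * A) powr P)"
    proof -
      have "(C * A) powr P = C powr (P - 1) * (C * A powr P)"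
        using C by (simp add: powr_mult powr_diff)
      then show ?thesis using C by (simp add: D_def ennreal_mult)
    qed
    finally show ?thesis using False by (simp add: norm_le_def I_def P_def mult_left_mono)
  qed
qed

text \<open>Since \<open>(1 + y)\<^sup>2 \<ge> 1 + y\<^sup>2\<close>, the Cauchy density, of total mass \<open>\<pi>\<close>, is a majorant.\<close>

lemma Cauchy_kernel_integral:
  assumes a: "0 < (a::real)"
  shows "(\<integral>\<^sup>+s. ennreal (1 / (a * (1 + \<bar>s - c\<bar> / a)\<^sup>2)) * indicator {-1..1} s \<partial>lborel) \<le> ennreal pi"
proof -
  define f where "f = (\<lambda>s. inverse (1 + ((s - c) / a)\<^sup>2) * (1 / a))"
  have f0: "0 \<le> f s" for s using a by (auto simp: f_def intro!: mult_nonneg_nonneg add_nonneg_nonneg)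
  have "(\<integral>\<^sup>+s. ennreal (1 / (a * (1 + \<bar>s - c\<bar> / a)\<^sup>2)) * indicator {-1..1} s \<partial>lborel)
      \<le> (\<integral>\<^sup>+s. ennreal (f s) * indicator {-1..1} s \<partial>lborel)"
  proof (intro nn_integral_mono mult_right_mono ennreal_leI)
    fix s
    have "1 + ((s - c) / a)\<^sup>2 \<le> (1 + \<bar>s - c\<bar> / a)\<^sup>2"
      using a by (simp add: power2_sum power_divide)
    moreover have "0 < 1 + ((s - c) / a)\<^sup>2" by (intro add_pos_nonneg) auto
    ultimately have "1 / (1 + \<bar>s - c\<bar> / a)\<^sup>2 \<le> 1 / (1 + ((s - c) / a)\<^sup>2)"
      by (intro divide_left_mono mult_pos_pos) auto
    then have "1 / (1 + \<bar>s - c\<bar> / a)\<^sup>2 * (1 / a) \<le> 1 / (1 + ((s - c) / a)\<^sup>2) * (1 / a)"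
      using a by (intro mult_right_mono) auto
    then show "1 / (a * (1 + \<bar>s - c\<bar> / a)\<^sup>2) \<le> f s"
      by (simp add: f_def inverse_eq_divide mult.commute)
  qed auto
  also have "\<dots> = ennreal (arctan ((1 - c) / a) - arctan ((- 1 - c) / a))"
  proof (rule nn_integral_FTC_Icc[where f = f and F = "\<lambda>s. arctan ((s - c) / a)"])
    show "f \<in> borel_measurable borel" unfolding f_def by measurable
    fix x :: real
    have "((\<lambda>s. (s - c) / a) has_real_derivative 1 / a) (at x)"
      using a by (auto intro!: derivative_eq_intros)
    then have "((\<lambda>s. arctan ((s - c) / a)) has_real_derivative f x) (at x)"
      unfolding f_def by (rule DERIV_chain2[OF DERIV_arctan])
    then show "((\<lambda>s. arctan ((s - c) / a)) has_real_derivative f x) (at x)" .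
  qed (use f0 in auto)
  also have "\<dots> \<le> ennreal pi"
    using arctan_bounded[of "(1 - c) / a"] arctan_bounded[of "(- 1 - c) / a"] by (intro ennreal_leI) linarith
  finally show ?thesis .
qed

section \<open>A kernel with bounded rows and columns\<close>

text \<open>Rows would be integrable with exponent 2 already. For columns the scale must be moved to
  t: \<open>rho n t\<close> costs one factor \<open>dil\<close>, and the square of
  \<open>dil_le_swap\<close> costs four more, hence 5.\<close>

definition kern :: "nat \<Rightarrow> real \<Rightarrow> real \<Rightarrow> real" where
  "kern n x t = 1 / (rho n x * dil n x t ^ 5)"

lemma kern_measurable: "(\<lambda>(x, t). ennreal (kern n x t)) \<in> borel_measurable (borel \<Otimes>\<^sub>M borel)"
  unfolding kern_def dil_def by measurable

lemma kern_row_le: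
  assumes n: "1 \<le> n" and x: "x \<in> {-1..1}"
  shows "(\<integral>\<^sup>+t. ennreal (kern n x t) * indicator {-1..1} t \<partial>lborel) \<le> ennreal (8 * pi)"
proof -
  have \<rho>: "0 < rho n x" by (rule rho_pos[OF n x])
  have "(\<integral>\<^sup>+t. ennreal (kern n x t) * indicator {-1..1} t \<partial>lborel)
      \<le> (\<integral>\<^sup>+t. ennreal (1 / (rho n x * (1 + \<bar>t - x\<bar> / rho n x)\<^sup>2)) * indicator {-1..1} t \<partial>lborel)"
  proof (intro nn_integral_mono mult_right_mono ennreal_leI)
    fix t
    have E: "1 \<le> dil n x t" by (rule dil_ge_1[OF n x])
    have "dil n x t ^ 2 \<le> dil n x t ^ 5" using E by (intro power_increasing) auto
    then show "kern n x t \<le> 1 / (rho n x * (1 + \<bar>t - x\<bar> / rho n x)\<^sup>2)"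
      unfolding kern_def using \<rho> E
      by (intro divide_left_mono mult_left_mono mult_pos_pos zero_less_power)
         (auto simp: dil_def abs_minus_commute intro!: add_pos_nonneg)
  qed auto
  also have "\<dots> \<le> ennreal pi" by (rule Cauchy_kernel_integral[OF \<rho>])
  also have "\<dots> \<le> ennreal (8 * pi)" by (intro ennreal_leI) simp
  finally show ?thesis .
qed

lemma kern_col_le:
  assumes n: "1 \<le> n" and t: "t \<in> {-1..1}"
  shows "(\<integral>\<^sup>+x. ennreal (kern n x t) * indicator {-1..1} x \<partial>lborel) \<le> ennreal (8 * pi)"
proof -
  define G where "G = (\<lambda>x. ennreal (1 / (rho n t * (1 + \<bar>x - t\<bar> / rho n t)\<^sup>2)) * indicator {-1..1} x)"
  have [measurable]: "G \<in> borel_measurable borel" unfolding G_def by measurable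
  have \<rho>t: "0 < rho n t" by (rule rho_pos[OF n t])
  have "(\<integral>\<^sup>+x. ennreal (kern n x t) * indicator {-1..1} x \<partial>lborel) \<le> (\<integral>\<^sup>+x. ennreal 8 * G x \<partial>lborel)"
  proof (rule nn_integral_mono)
    fix x :: real
    show "ennreal (kern n x t) * indicator {-1..1} x \<le> ennreal 8 * G x"
    proof (cases "x \<in> {-1..1}")
      case True
      define E where "E = dil n x t"
      define F where "F = dil n t x"
      have EF: "1 \<le> E" "1 \<le> F" using dil_ge_1[OF n] True t by (auto simp: E_def F_def)
      have \<rho>x: "0 < rho n x" by (rule rho_pos[OF n True])
      have "rho n t * F\<^sup>2 \<le> (2 * E * rho n x) * (2 * E\<^sup>2)\<^sup>2"
        using rho_le_dil_right[OF n True t] dil_le_swap[OF n True t] EF \<rho>t \<rho>x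
        by (intro mult_mono power_mono) (auto simp: E_def F_def)
      also have "\<dots> = 8 * (rho n x * E ^ 5)" by (simp add: power2_eq_square eval_nat_numeral)
      finally have "1 / (rho n x * E ^ 5) \<le> 8 / (rho n t * F\<^sup>2)"
        using \<rho>x \<rho>t EF zero_less_power[of E 5] by (simp add: field_simps)
      then have "ennreal (kern n x t) \<le> ennreal (8 * (1 / (rho n t * F\<^sup>2)))"
        by (intro ennreal_leI) (simp add: kern_def E_def)
      also have "\<dots> = ennreal 8 * ennreal (1 / (rho n t * F\<^sup>2))"
        using \<rho>t by (intro ennreal_mult) auto
      finally show ?thesis using True by (simp add: G_def F_def dil_def[of n t x] abs_minus_commute)
    qed simp
  qed
  also have "\<dots> = ennreal 8 * (\<integral>\<^sup>+x. G x \<partial>lborel)" by (rule nn_integral_cmult) measurable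
  also have "\<dots> \<le> ennreal 8 * ennreal pi"
    unfolding G_def by (intro mult_left_mono Cauchy_kernel_integral[OF \<rho>t]) auto
  also have "\<dots> = ennreal (8 * pi)" by (simp add: ennreal_mult)
  finally show ?thesis .
qed

section \<open>The substitution \<open>x + c\<phi>(x)\<close>\<close>

lemma phi_sq: "x \<in> {-1..1} \<Longrightarrow> (phi x)\<^sup>2 = (1 - \<bar>x\<bar>) * (1 + \<bar>x\<bar>)"
  by (simp add: phi_def abs_square_le_1 abs_le_iff) (simp add: power2_eq_square algebra_simps)

lemma phi_derivative:
  assumes "\<bar>x\<bar> < 1" shows "(phi has_real_derivative - x / phi x) (at x)"
proof -
  have "0 < 1 - x\<^sup>2" using assms by (simp add: abs_square_less_1)
  then have "((\<lambda>x. sqrt (1 - x\<^sup>2)) has_real_derivative - x / sqrt (1 - x\<^sup>2)) (at x)"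
    by (auto intro!: derivative_eq_intros simp: field_simps)
  then show ?thesis unfolding phi_def[abs_def] .
qed

text \<open>The points \<open>x\<close> with \<open>x \<plusminus> b\<phi>(x) \<in> [-1,1]\<close> form, up to \<open>\<plusminus>1\<close>, the interval
  \<open>\<bar>x\<bar> \<le> (1 - b\<^sup>2)/(1 + b\<^sup>2)\<close>, where the slope of \<open>x + c\<phi>(x)\<close>, \<open>\<bar>c\<bar> \<le> b\<close>, is at least \<open>1/2\<close>.\<close>

definition step_limit :: "real \<Rightarrow> real" where
  "step_limit b = (1 - b\<^sup>2) / (1 + b\<^sup>2)"

lemma le_step_limit_iff: "y \<le> step_limit b \<longleftrightarrow> b\<^sup>2 * (1 + y) \<le> 1 - y"
proof -
  have "0 < 1 + b\<^sup>2" by (simp add: add_pos_nonneg)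
  then show ?thesis by (simp add: step_limit_def pos_le_divide_eq algebra_simps)
qed

lemma step_limit_less_1: "0 < b \<Longrightarrow> step_limit b < 1"
  by (simp add: step_limit_def divide_less_eq add_pos_nonneg)

text \<open>The two node conditions say \<open>b * phi x \<le> 1 - \<bar>x\<bar>\<close>. Squaring
  leaves a common factor 1 - |x|, which can be cancelled only inside the open interval.\<close>

lemma abs_le_step_limit:
  assumes "0 < b" "\<bar>x\<bar> < 1" "x + b * phi x \<le> 1" "-1 \<le> x - b * phi x"
  shows "\<bar>x\<bar> \<le> step_limit b"
proof -
  have x: "x \<in> {-1..1}" using assms(2) by auto
  have "b * phi x \<le> 1 - \<bar>x\<bar>" using assms(3,4) by linarith
  then have "(b * phi x)\<^sup>2 \<le> (1 - \<bar>x\<bar>)\<^sup>2"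
    using assms(1) phi_nonneg[OF x] by (intro power_mono) auto
  then have "(1 - \<bar>x\<bar>) * (b\<^sup>2 * (1 + \<bar>x\<bar>)) \<le> (1 - \<bar>x\<bar>) * (1 - \<bar>x\<bar>)"
    unfolding power_mult_distrib phi_sq[OF x] power2_eq_square[of "1 - \<bar>x\<bar>"] by (simp only: mult_ac)
  then show ?thesis using assms(2) unfolding le_step_limit_iff by simp
qed

text \<open>The inequality \<open>b\<^sup>2 * (1 + \<bar>x\<bar>) \<le> 1 - \<bar>x\<bar>\<close> is
  used twice. Multiplied by 1 - |x| it keeps the image in [-1,1]; multiplied by 1 + |x| it gives b
  (1 + |x|) \<le> \<open>phi x\<close>, which bounds the slope because 2|x| \<le> 1 + |x|.\<close>

lemma step_map_facts:
  assumes b: "0 < b" and c: "\<bar>c\<bar> \<le> b" and x: "\<bar>x\<bar> \<le> step_limit b"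
  shows "x + c * phi x \<in> {-1..1}" "1 / 2 \<le> 1 + c * (- x / phi x)" "0 < phi x"
proof -
  have x1: "\<bar>x\<bar> < 1" using x step_limit_less_1[OF b] by linarith
  then have xm: "x \<in> {-1..1}" by auto
  have le: "b\<^sup>2 * (1 + \<bar>x\<bar>) \<le> 1 - \<bar>x\<bar>" using x by (simp add: le_step_limit_iff)
  have "0 < (phi x)\<^sup>2" using x1 by (simp add: phi_sq[OF xm])
  then show p: "0 < phi x" using phi_nonneg[OF xm] by (simp add: less_le)
  have "(b * (1 + \<bar>x\<bar>))\<^sup>2 = (b\<^sup>2 * (1 + \<bar>x\<bar>)) * (1 + \<bar>x\<bar>)"
    by (simp add: power2_eq_square)
  also have "\<dots> \<le> (1 - \<bar>x\<bar>) * (1 + \<bar>x\<bar>)" by (rule mult_right_mono[OF le]) simp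
  also have "\<dots> = (phi x)\<^sup>2" by (rule phi_sq[OF xm, symmetric])
  finally have l: "b * (1 + \<bar>x\<bar>) \<le> phi x" by (rule power2_le_imp_le) (use p in simp)
  have "(b * phi x)\<^sup>2 = (b\<^sup>2 * (1 + \<bar>x\<bar>)) * (1 - \<bar>x\<bar>)"
    unfolding power_mult_distrib phi_sq[OF xm] by (simp only: mult_ac)
  also have "\<dots> \<le> (1 - \<bar>x\<bar>) * (1 - \<bar>x\<bar>)" using x1 by (intro mult_right_mono[OF le]) simp
  finally have "(b * phi x)\<^sup>2 \<le> (1 - \<bar>x\<bar>)\<^sup>2" by (simp only: power2_eq_square)
  then have u: "b * phi x \<le> 1 - \<bar>x\<bar>" by (rule power2_le_imp_le) (use x1 in simp)
  have "\<bar>c * phi x\<bar> \<le> b * phi x" using c p by (simp add: abs_mult)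
  then show "x + c * phi x \<in> {-1..1}" using u unfolding atLeastAtMost_iff by linarith
  have "b * (2 * \<bar>x\<bar>) \<le> b * (1 + \<bar>x\<bar>)" using b x1 by (intro mult_left_mono) auto
  then have "2 * (b * \<bar>x\<bar>) \<le> phi x" using l by simp
  moreover have "\<bar>c\<bar> * \<bar>x\<bar> \<le> b * \<bar>x\<bar>" using c by (intro mult_right_mono) auto
  ultimately have "\<bar>c * x\<bar> \<le> phi x / 2" by (simp add: abs_mult)
  then have "c * x / phi x \<le> 1 / 2" using p by (simp add: field_simps)
  then show "1 / 2 \<le> 1 + c * (- x / phi x)" by simp
qed

text \<open>The 2 is the reciprocal of the least slope. Applied to indicators, this also shows that
  null sets pull back to null sets. If \<open>step_limit b\<close> is not positive, the domain has
  at most the point 0.\<close>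

lemma nn_integral_step_map:
  fixes F :: "real \<Rightarrow> ennreal"
  assumes [measurable]: "F \<in> borel_measurable borel" and b: "0 < b" and c: "\<bar>c\<bar> \<le> b"
  shows "(\<integral>\<^sup>+x. F (x + c * phi x) * indicator {- step_limit b..step_limit b} x \<partial>lborel)
       \<le> 2 * (\<integral>\<^sup>+y. F y * indicator {-1..1} y \<partial>lborel)"
proof (cases "0 < step_limit b")
  case True
  define l where "l = step_limit b"
  define T where "T = (\<lambda>x. x + c * phi x)"
  define T' where "T' = (\<lambda>x. 1 + c * (- x / phi x))"
  have facts: "T x \<in> {-1..1}" "1 / 2 \<le> T' x" "0 < phi x" if "x \<in> {-l..l}" for x
    using step_map_facts[OF b c, of x] that by (auto simp: l_def T_def T'_def abs_le_iff)
  have l1: "l < 1" using step_limit_less_1[OF b] by (simp add: l_def)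
  have dT: "(T has_real_derivative T' x) (at x)" if "x \<in> {-l..l}" for x
    unfolding T_def T'_def using that l1
    by (intro derivative_intros DERIV_cmult phi_derivative) (auto simp: abs_less_iff)
  have cT: "continuous_on {-l..l} T'"
    unfolding T'_def phi_def[abs_def] using facts(3)
    by (intro continuous_intros) (auto simp: phi_def less_le)
  have "(\<integral>\<^sup>+x. F (x + c * phi x) * indicator {- step_limit b..step_limit b} x \<partial>lborel)
      \<le> (\<integral>\<^sup>+x. 2 * (F (T x) * ennreal (T' x) * indicator {-l..l} x) \<partial>lborel)"
  proof (rule nn_integral_mono)
    fix x
    show "F (x + c * phi x) * indicator {- step_limit b..step_limit b} x
        \<le> 2 * (F (T x) * ennreal (T' x) * indicator {-l..l} x)"
    proof (cases "x \<in> {-l..l}")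
      case True
      have "1 \<le> 2 * T' x" using facts(2)[OF True] by simp
      then have "1 \<le> 2 * ennreal (T' x)"
        by (metis ennreal_1 ennreal_leI ennreal_mult' ennreal_numeral zero_le_numeral)
      then have "F (T x) * 1 \<le> F (T x) * (2 * ennreal (T' x))" by (rule mult_left_mono) simp
      then show ?thesis using True by (simp add: T_def l_def mult_ac)
    qed (simp add: l_def)
  qed
  also have "\<dots> = 2 * (\<integral>\<^sup>+x. F (T x) * ennreal (T' x) * indicator {-l..l} x \<partial>lborel)"
    unfolding T_def T'_def by (intro nn_integral_cmult) measurable
  also have "(\<integral>\<^sup>+x. F (T x) * ennreal (T' x) * indicator {-l..l} x \<partial>lborel)
      = (\<integral>\<^sup>+y. F y * indicator {T (-l)..T l} y \<partial>lborel)"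
    by (rule nn_integral_substitution_aux[symmetric])
      (use True dT cT facts(2) in \<open>auto simp: l_def intro: order_trans[of _ "1 / 2"]\<close>)
  also have "\<dots> \<le> (\<integral>\<^sup>+y. F y * indicator {-1..1} y \<partial>lborel)"
    using facts(1)[of "-l"] facts(1)[of l] True
    by (intro nn_integral_mono mult_left_mono) (auto simp: indicator_def l_def)
  finally show ?thesis by (simp add: mult_left_mono)
next
  case False
  have "AE x in lborel. x \<noteq> (0::real)" by (rule AE_lborel_singleton)
  then have "AE x in lborel. F (x + c * phi x) * indicator {- step_limit b..step_limit b} x = 0"
    using False by (auto elim!: eventually_mono simp: indicator_def)
  then have "(\<integral>\<^sup>+x. F (x + c * phi x) * indicator {- step_limit b..step_limit b} x \<partial>lborel) = 0"
    by (subst nn_integral_0_iff_AE) auto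
  then show ?thesis by simp
qed

lemma norm_le_step_map:
  assumes p: "1 \<le> p" and [measurable]: "u \<in> borel_measurable borel" and b: "0 < b" and c: "\<bar>c\<bar> \<le> b"
    and nu: "norm_le p u A" and A: "0 \<le> A"
  shows "norm_le p (\<lambda>x. indicator {- step_limit b..step_limit b} x * u (x + c * phi x)) (2 * A)"
proof (cases "p = \<infinity>")
  case True
  \<comment> \<open>For p = \<infinity> the integral estimate is applied to the indicator of the set
    where the bound fails, so that the pulled back exceptional set is null.\<close>
  define F where "F = (\<lambda>y. indicator {y. A < \<bar>u y\<bar>} y :: ennreal)"
  have [measurable]: "F \<in> borel_measurable borel" unfolding F_def by measurable
  have "AE y in lborel. F y * indicator {-1..1} y = 0"
    using nu True unfolding norm_le_def by (auto elim!: eventually_mono simp: F_def indicator_def)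
  then have "(\<integral>\<^sup>+y. F y * indicator {-1..1} y \<partial>lborel) = 0"
    by (subst nn_integral_0_iff_AE) auto
  then have "(\<integral>\<^sup>+x. F (x + c * phi x) * indicator {- step_limit b..step_limit b} x \<partial>lborel) = 0"
    using nn_integral_step_map[of F b c] b c by simp
  then have "AE x in lborel. F (x + c * phi x) * indicator {- step_limit b..step_limit b} x = 0"
    by (subst (asm) nn_integral_0_iff_AE) auto
  then show ?thesis
    using True A unfolding norm_le_def
    by (auto elim!: eventually_mono simp: F_def indicator_def split: if_splits)
next
  case False
  define P where "P = enn2real p"
  have P: "1 \<le> P" using enn2real_ge_1[OF p False] by (simp add: P_def)
  have "(\<integral>\<^sup>+x. ennreal (\<bar>indicator {- step_limit b..step_limit b} x * u (x + c * phi x)\<bar> powr P) * indicator {-1..1} x \<partial>lborel)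
      \<le> (\<integral>\<^sup>+x. ennreal (\<bar>u (x + c * phi x)\<bar> powr P) * indicator {- step_limit b..step_limit b} x \<partial>lborel)"
    by (intro nn_integral_mono) (auto simp: indicator_def)
  also have "\<dots> \<le> 2 * (\<integral>\<^sup>+y. ennreal (\<bar>u y\<bar> powr P) * indicator {-1..1} y \<partial>lborel)"
    by (rule nn_integral_step_map[OF _ b c]) measurable
  also have "\<dots> \<le> 2 * ennreal (A powr P)"
    using nu False by (intro mult_left_mono) (auto simp: norm_le_def P_def)
  also have "\<dots> = ennreal (2 * A powr P)" by (simp add: ennreal_mult)
  also have "\<dots> \<le> ennreal ((2 * A) powr P)"
  proof (rule ennreal_leI)
    have "2 powr 1 \<le> (2::real) powr P" using P by (intro powr_mono) auto
    then show "2 * A powr P \<le> (2 * A) powr P" using A by (simp add: powr_mult mult_right_mono)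
  qed
  finally show ?thesis using False by (simp add: norm_le_def P_def)
qed

section \<open>Differences in weighted norms\<close>

lemma powr_le_scaled:
  assumes "0 \<le> a" "a \<le> K * b" "1 \<le> K" "0 \<le> b" "1 \<le> (l::real)"
  shows "a powr (1 / l) \<le> K * b powr (1 / l)"
proof -
  have "a powr (1 / l) \<le> (K * b) powr (1 / l)" using assms by (intro powr_mono2) auto
  also have "\<dots> = K powr (1 / l) * b powr (1 / l)" by (rule powr_mult)
  also have "\<dots> \<le> K powr 1 * b powr (1 / l)"
    using assms by (intro mult_right_mono powr_mono) auto
  finally show ?thesis using assms by simp
qed

lemma difference_node_le:
  assumes "i \<le> r" "0 \<le> h"
  shows "\<bar>real i * h - real r * h / 2\<bar> \<le> real r * h / 2"
proof -
  have "real i * h \<le> real r * h" "0 \<le> real i * h" using assms by (auto intro!: mult_right_mono)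
  then show ?thesis unfolding abs_le_iff by linarith
qed

lemma symmetric_difference_measurable [measurable]:
  assumes [measurable]: "g \<in> borel_measurable borel"
  shows "(\<lambda>x. symmetric_difference r (h * phi x) g x) \<in> borel_measurable borel"
  unfolding symmetric_difference_def by measurable

text \<open>A crude bound for functions without structure, meant for the remainder of the last
  approximant. Every node lies within r local scales of x, so the weight moves to the node at cost
  K; the substitution costs 2 per node, and the binomial coefficients sum to
  \<open>2 ^ r\<close>.\<close>

lemma norm_le_symmetric_difference:
  assumes r: "1 \<le> r" and p: "1 \<le> p" and L: "0 \<le> L" "L\<^sup>2 \<le> 2 ^ s"
    and w: "doubling_weight L w" and n: "1 \<le> n" and h: "0 < h" "h \<le> 1 / real n"
    and [measurable]: "g \<in> borel_measurable borel"
    and A: "0 < A" and ng: "norm_le p (\<lambda>x. g x * avg_weight w n x powr (1 / lam p)) A"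
  shows "norm_le p (\<lambda>x. symmetric_difference r (h * phi x) g x * avg_weight w n x powr (1 / lam p))
     (2 ^ r * (2 * 4 ^ s * (1 + real r) ^ (2 * s + 1)) * (2 * A))"
proof -
  define K where "K = 2 * 4 ^ s * (1 + real r) ^ (2 * s + 1)"
  have "1 * 1 \<le> (4::real) ^ s * (1 + real r) ^ (2 * s + 1)" by (intro mult_mono one_le_power) auto
  then have K: "1 \<le> K" by (simp add: K_def)
  define b where "b = real r * h / 2"
  have b: "0 < b" using r h by (simp add: b_def)
  define c where "c i = real i * h - b" for i :: nat
  have c: "\<bar>c i\<bar> \<le> b" if "i \<le> r" for i
    unfolding c_def b_def by (rule difference_node_le[OF that]) (use h in simp)
  define v where "v x = avg_weight w n x powr (1 / lam p)" for x
  have [measurable]: "avg_weight w n \<in> borel_measurable borel" by (rule avg_weight_measurable[OF w])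
  have [measurable]: "v \<in> borel_measurable borel" unfolding v_def by measurable
  define u where "u x = g x * v x" for x
  have [measurable]: "u \<in> borel_measurable borel" unfolding u_def by measurable
  have "u = (\<lambda>x. g x * avg_weight w n x powr (1 / lam p))" by (simp add: fun_eq_iff u_def v_def)
  then have nu: "norm_le p u A" using ng by simp
  define S where "S = {- step_limit b..step_limit b}"
  have vle: "v x \<le> K * v (x + c i * phi x)" if x: "x \<in> S" and i: "i \<le> r" for x i
  proof -
    have y: "x + c i * phi x \<in> {-1..1}"
      using step_map_facts(1)[OF b c[OF i], of x] x by (auto simp: S_def abs_le_iff)
    have x1: "x \<in> {-1..1}" using x step_limit_less_1[OF b] by (auto simp: S_def)
    have \<rho>: "0 < rho n x" by (rule rho_pos[OF n x1])
    have E: "dil n x (x + c i * phi x) \<le> 1 + real r"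
    proof -
      have "\<bar>c i * phi x\<bar> \<le> b * phi x"
        using c[OF i] phi_nonneg[OF x1] by (simp add: abs_mult mult_right_mono)
      also have "\<dots> \<le> real r * (h * phi x)" using phi_nonneg[OF x1] h by (simp add: b_def)
      also have "\<dots> \<le> real r * ((1 / real n) * phi x)"
        using h phi_nonneg[OF x1] by (intro mult_left_mono mult_right_mono) auto
      also have "\<dots> \<le> real r * rho n x" using phi_le_rho[OF n, of x] by (intro mult_left_mono) auto
      finally show ?thesis using \<rho> by (simp add: dil_def pos_divide_le_eq)
    qed
    have "avg_weight w n x \<le> 2 * 4 ^ s * dil n x (x + c i * phi x) ^ (2 * s + 1) * avg_weight w n (x + c i * phi x)"
      by (rule avg_weight_growth[OF w L n x1 y])
    also have "\<dots> \<le> K * avg_weight w n (x + c i * phi x)"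
      unfolding K_def using E dil_ge_1[OF n x1, of "x + c i * phi x"]
      by (intro mult_right_mono mult_left_mono power_mono avg_weight_nonneg[OF w n y]) auto
    finally show ?thesis
      unfolding v_def using K by (intro powr_le_scaled avg_weight_nonneg[OF w n] x1 y lam_ge_1[OF p])
  qed
  define G where "G i x = (real (r choose i) * K) * (indicator S x * u (x + c i * phi x))" for i x
  have [measurable]: "G i \<in> borel_measurable borel" for i
    unfolding G_def[abs_def] S_def by measurable
  have "norm_le p (\<lambda>x. \<Sum>i\<le>r. \<bar>if i \<le> r then G i x else 0\<bar>) (\<Sum>i\<le>r. real (r choose i) * K * (2 * A))"
  proof (rule norm_le_sum[OF p])
    fix i assume i: "i \<le> r"
    have "norm_le p (G i) (real (r choose i) * K * (2 * A))"
      unfolding G_def[abs_def]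
    proof (rule norm_le_scale[OF p])
      show "norm_le p (\<lambda>x. indicator S x * u (x + c i * phi x)) (2 * A)"
        unfolding S_def using A by (intro norm_le_step_map[OF p _ b c[OF i] nu]) auto
    qed (use K A in \<open>auto simp: S_def\<close>)
    then show "norm_le p (\<lambda>x. \<bar>if i \<le> r then G i x else 0\<bar>) (real (r choose i) * K * (2 * A))"
      by (rule norm_le_mono[OF p]) (use i in auto)
    show "0 < real (r choose i) * K * (2 * A)" using K A i by simp
  qed measurable
  also have "(\<Sum>i\<le>r. real (r choose i) * K * (2 * A)) = 2 ^ r * K * (2 * A)"
    using choose_row_sum[of r] by (simp add: sum_distrib_right[symmetric] flip: of_nat_sum)
  finally have "norm_le p (\<lambda>x. \<Sum>i\<le>r. \<bar>if i \<le> r then G i x else 0\<bar>) (2 ^ r * K * (2 * A))" .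
  then have "norm_le p (\<lambda>x. symmetric_difference r (h * phi x) g x * v x) (2 ^ r * K * (2 * A))"
  proof (rule norm_le_mono[OF p])
    \<comment> \<open>At the endpoints \<open>phi\<close> vanishes, so the node condition holds
      although x lies outside S; these two points are discarded.\<close>
    have "AE x in lborel. x \<noteq> (1::real)" "AE x in lborel. x \<noteq> (-1::real)"
      by (rule AE_lborel_singleton)+
    then show "AE x in lborel. x \<in> {-1..1} \<longrightarrow> \<bar>symmetric_difference r (h * phi x) g x * v x\<bar>
        \<le> \<bar>\<Sum>i\<le>r. \<bar>if i \<le> r then G i x else 0\<bar>\<bar>"
    proof eventually_elim
      case (elim x)
      show ?case
      proof
        assume x: "x \<in> {-1..1}"
        have v0: "0 \<le> v x" by (simp add: v_def)
        have step: "real r * (h * phi x) / 2 = b * phi x" by (simp add: b_def)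
        show "\<bar>symmetric_difference r (h * phi x) g x * v x\<bar> \<le> \<bar>\<Sum>i\<le>r. \<bar>if i \<le> r then G i x else 0\<bar>\<bar>"
        proof (cases "x - b * phi x \<in> {-1..1} \<and> x + b * phi x \<in> {-1..1}")
          case True
          then have xS: "x \<in> S"
            using abs_le_step_limit[OF b, of x] x elim by (auto simp: S_def abs_le_iff abs_less_iff)
          have "\<bar>symmetric_difference r (h * phi x) g x * v x\<bar>
              = \<bar>\<Sum>i=0..r. real (r choose i) * (-1) ^ (r - i) * g (x - b * phi x + real i * (h * phi x)) * v x\<bar>"
            using True by (simp add: symmetric_difference_def step sum_distrib_right)
          also have "\<dots> \<le> (\<Sum>i=0..r. \<bar>real (r choose i) * (-1) ^ (r - i) * g (x - b * phi x + real i * (h * phi x)) * v x\<bar>)"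
            by (rule sum_abs)
          also have "\<dots> \<le> (\<Sum>i=0..r. \<bar>if i \<le> r then G i x else 0\<bar>)"
          proof (rule sum_mono)
            fix i assume "i \<in> {0..r}"
            then have i: "i \<le> r" by simp
            have y: "x - b * phi x + real i * (h * phi x) = x + c i * phi x"
              by (simp add: c_def algebra_simps)
            have "\<bar>g (x + c i * phi x)\<bar> * v x \<le> \<bar>g (x + c i * phi x)\<bar> * (K * v (x + c i * phi x))"
              by (intro mult_left_mono vle xS i) auto
            then have "real (r choose i) * (\<bar>g (x + c i * phi x)\<bar> * v x)
                \<le> real (r choose i) * (\<bar>g (x + c i * phi x)\<bar> * (K * v (x + c i * phi x)))"
              by (rule mult_left_mono) simp
            moreover have "\<bar>real (r choose i) * (-1) ^ (r - i) * g (x + c i * phi x) * v x\<bar>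
                = real (r choose i) * (\<bar>g (x + c i * phi x)\<bar> * v x)"
              using v0 by (simp add: abs_mult power_abs)
            moreover have "0 \<le> v (x + c i * phi x)" by (simp add: v_def)
            then have "\<bar>if i \<le> r then G i x else 0\<bar>
                = real (r choose i) * (\<bar>g (x + c i * phi x)\<bar> * (K * v (x + c i * phi x)))"
              using i xS K by (simp add: abs_mult G_def u_def)
            ultimately show "\<bar>real (r choose i) * (-1) ^ (r - i) * g (x - b * phi x + real i * (h * phi x)) * v x\<bar>
                \<le> \<bar>if i \<le> r then G i x else 0\<bar>"
              unfolding y by simp
          qed
          finally show ?thesis by (simp add: atLeast0AtMost)
        next
          case False
          then have "symmetric_difference r (h * phi x) g x = 0"
            by (auto simp: symmetric_difference_def step)
          then show ?thesis by (simp add: sum_nonneg)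
        qed
      qed
    qed
  qed
  then show ?thesis by (simp only: v_def K_def)
qed

text \<open>The 1/l-th power of the class condition, multiplied by
  \<open>phi x \<le> real m * rho m x\<close> raised to r - \<gamma>/l, an exponent that is
  nonnegative by \<gamma> \<le> r l. This completes both sides to r-th powers.\<close>

lemma W_class_powr:
  assumes wW: "w \<in> W_class \<delta> \<gamma> \<Lambda>" and w: "doubling_weight L w" and l: "1 \<le> l" and mn: "1 \<le> m" "m \<le> n"
    and par: "0 \<le> \<gamma>" "0 < \<Lambda>" "\<gamma> \<le> real r * l" and x: "x \<in> {-1..1}" and ph: "0 < phi x"
  shows "avg_weight w n x powr (1 / l) * phi x ^ r
     \<le> \<Lambda> powr (1 / l) * (real n / real m) powr (\<delta> / l) * (real m * rho m x) ^ r * avg_weight w m x powr (1 / l)"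
proof -
  define a where "a = 1 / l"
  have a: "0 < a" using l by (simp add: a_def)
  define y where "y = real m * rho m x"
  have m: "0 < real m" "0 < real n" using mn by auto
  have \<rho>: "0 < rho m x" by (rule rho_pos[OF mn(1) x])
  then have y: "0 < y" using m by (simp add: y_def)
  have py: "phi x \<le> y" using phi_le_rho[OF mn(1), of x] m by (simp add: y_def field_simps)
  have n: "1 \<le> n" using mn by simp
  have w0: "0 \<le> avg_weight w n x" "0 \<le> avg_weight w m x" using avg_weight_nonneg[OF w] n mn x by auto
  have "avg_weight w n x * (if \<gamma> = 0 then 1 else phi x powr \<gamma>)
      \<le> \<Lambda> * real n powr \<delta> * real m powr (\<gamma> - \<delta>) * rho m x powr \<gamma> * avg_weight w m x"
    using wW mn x unfolding W_class_def by blast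
  moreover have "(if \<gamma> = 0 then 1 else phi x powr \<gamma>) = phi x powr \<gamma>" using ph by simp
  ultimately have "avg_weight w n x * phi x powr \<gamma>
      \<le> \<Lambda> * real n powr \<delta> * real m powr (\<gamma> - \<delta>) * rho m x powr \<gamma> * avg_weight w m x" by simp
  also have "\<Lambda> * real n powr \<delta> * real m powr (\<gamma> - \<delta>) * rho m x powr \<gamma> = \<Lambda> * (real n / real m) powr \<delta> * y powr \<gamma>"
    using m \<rho> by (simp add: y_def powr_mult powr_divide powr_diff)
  finally have "(avg_weight w n x * phi x powr \<gamma>) powr a
      \<le> (\<Lambda> * (real n / real m) powr \<delta> * y powr \<gamma> * avg_weight w m x) powr a"
    using w0 a by (intro powr_mono2) auto
  then have "avg_weight w n x powr a * phi x powr (\<gamma> * a)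
      \<le> \<Lambda> powr a * (real n / real m) powr (\<delta> * a) * y powr (\<gamma> * a) * avg_weight w m x powr a"
    by (simp add: powr_mult powr_powr)
  moreover have "phi x powr (real r - \<gamma> * a) \<le> y powr (real r - \<gamma> * a)"
    using ph py par(3) l by (intro powr_mono2) (auto simp: a_def pos_divide_le_eq)
  ultimately have "(avg_weight w n x powr a * phi x powr (\<gamma> * a)) * phi x powr (real r - \<gamma> * a)
      \<le> (\<Lambda> powr a * (real n / real m) powr (\<delta> * a) * y powr (\<gamma> * a) * avg_weight w m x powr a) * y powr (real r - \<gamma> * a)"
    by (rule mult_mono) auto
  also have "\<dots> = \<Lambda> powr a * (real n / real m) powr (\<delta> * a)
      * (y powr (\<gamma> * a) * y powr (real r - \<gamma> * a)) * avg_weight w m x powr a"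
    by (simp only: mult_ac)
  also have "y powr (\<gamma> * a) * y powr (real r - \<gamma> * a) = y ^ r"
    using y by (simp add: powr_add[symmetric] powr_realpow)
  also have "(avg_weight w n x powr a * phi x powr (\<gamma> * a)) * phi x powr (real r - \<gamma> * a)
      = avg_weight w n x powr a * phi x ^ r"
    using ph by (simp add: mult.assoc powr_add[symmetric] powr_realpow)
  finally show ?thesis by (simp add: a_def y_def)
qed

text \<open>Of the r + 1 negative powers of \<open>rho m x\<close> in the pointwise bound, r cancel
  against (m \<open>rho m x\<close>)^r from the class condition and the last normalises the kernel.
  What is left is m^r h^r \<le> (m/n)^r, reduced by (n/m)^(\<delta>/\<lambda>).\<close>

lemma norm_le_symmetric_difference_poly:
  assumes r: "1 \<le> r" and p: "1 \<le> p" and par: "0 \<le> \<gamma>" "0 < \<Lambda>" "\<gamma> \<le> real r * lam p"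
    and L: "0 \<le> L" "L\<^sup>2 \<le> 2 ^ s"
  shows "\<exists>C>0. \<forall>w m n Q h A. doubling_weight L w \<longrightarrow> w \<in> W_class \<delta> \<gamma> \<Lambda> \<longrightarrow> 1 \<le> m \<longrightarrow> m \<le> n \<longrightarrow>
     degree Q < m \<longrightarrow> 0 < h \<longrightarrow> h \<le> 1 / real n \<longrightarrow> 0 \<le> A \<longrightarrow>
     norm_le p (\<lambda>x. poly Q x * avg_weight w m x powr (1 / lam p)) A \<longrightarrow>
     norm_le p (\<lambda>x. symmetric_difference r (h * phi x) (poly Q) x * avg_weight w n x powr (1 / lam p))
       (C * (real m / real n) powr (real r - \<delta> / lam p) * A)"
proof -
  define a where "a = 1 / lam p"
  \<comment> \<open>2s + 1 powers pay for moving the weight from x to t, and 5 are left for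
    \<open>kern\<close>.\<close>
  define M where "M = 2 * s + 6"
  obtain C1 where C1: "0 < C1" and bd: "\<And>m Q x h. 1 \<le> m \<Longrightarrow> degree Q < m \<Longrightarrow> x \<in> {-1..1} \<Longrightarrow> 0 \<le> h \<Longrightarrow> h \<le> 1 / real m \<Longrightarrow>
     \<bar>symmetric_difference r (h * phi x) (poly Q) x\<bar> * rho m x ^ Suc r
       \<le> C1 * (h * phi x) ^ r * integral {-1..1} (\<lambda>t. \<bar>poly Q t\<bar> / dil m x t ^ M)"
    using symmetric_difference_poly_bound[of r M] by blast
  define K where "K = (2 * 4 ^ s :: real)"
  have "1 \<le> (4::real) ^ s" by simp
  then have K: "1 \<le> K" unfolding K_def by linarith
  define C2 where "C2 = C1 * \<Lambda> powr a"
  have C2: "0 < C2" using C1 par by (simp add: C2_def)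
  define C where "C = 8 * pi * (C2 * K)"
  have C: "0 < C" using C2 K by (simp add: C_def)
  show ?thesis
  proof (rule exI[of _ C], intro conjI allI impI, rule C)
    fix w m n Q h A
    assume w: "doubling_weight L w" and wW: "w \<in> W_class \<delta> \<gamma> \<Lambda>" and mn: "1 \<le> m" "m \<le> n"
      and deg: "degree Q < m" and h: "0 < h" "h \<le> 1 / real n" and A: "0 \<le> A"
      and nQ: "norm_le p (\<lambda>x. poly Q x * avg_weight w m x powr (1 / lam p)) A"
    have m: "0 < real m" "0 < real n" using mn by auto
    define F where "F = C2 * K * (real m / real n) powr (real r - \<delta> / lam p)"
    have F: "0 \<le> F" using C2 K by (simp add: F_def)
    define v where "v x = avg_weight w m x powr a" for x
    have [measurable]: "avg_weight w m \<in> borel_measurable borel" by (rule avg_weight_measurable[OF w])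
    have [measurable]: "v \<in> borel_measurable borel" unfolding v_def by measurable
    have [measurable]: "poly Q \<in> borel_measurable borel"
      by (intro borel_measurable_continuous_onI continuous_intros)
    define u where "u x = \<bar>poly Q x\<bar> * v x" for x
    have [measurable]: "u \<in> borel_measurable borel" unfolding u_def by measurable
    have nu: "norm_le p u A"
      by (rule norm_le_mono[OF p nQ]) (simp add: u_def v_def a_def abs_mult)
    have "norm_le p (\<lambda>x. symmetric_difference r (h * phi x) (poly Q) x * avg_weight w n x powr a) (8 * pi * (F * A))"
    \<comment> \<open>The factor F, which depends on m/n, is moved into the function, so that the
      row and column bound 8 pi stays absolute.\<close>
    proof (rule norm_le_Schur[OF p kern_measurable[of m] _ _ _ kern_row_le[OF mn(1)] kern_col_le[OF mn(1)]])
      show "norm_le p (\<lambda>x. F * u x) (F * A)" by (rule norm_le_scale[OF p _ nu F A]) measurable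
      fix x :: real assume x: "x \<in> {-1..1}"
      define D where "D = symmetric_difference r (h * phi x) (poly Q) x"
      define I where "I = integral {-1..1} (\<lambda>t. \<bar>poly Q t\<bar> / dil m x t ^ M)"
      have \<rho>: "0 < rho m x" by (rule rho_pos[OF mn(1) x])
      have E: "1 \<le> dil m x t" for t by (rule dil_ge_1[OF mn(1) x])
      have E0: "0 \<le> \<bar>poly Q t\<bar> / dil m x t ^ M" "dil m x t ^ M \<noteq> 0" for t
        using E[of t] by (auto intro!: divide_nonneg_nonneg zero_le_power)
      have int: "(\<lambda>t. \<bar>poly Q t\<bar> / dil m x t ^ M) integrable_on {-1..1}"
        by (intro integrable_continuous_real continuous_intros) (use E0(2) in auto)
      have I0: "0 \<le> I" unfolding I_def using E0 by (intro integral_nonneg int) auto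
      have "h \<le> 1 / real m" using h mn m by (intro order_trans[OF h(2)] divide_left_mono) auto
      then have D: "\<bar>D\<bar> * rho m x ^ Suc r \<le> C1 * (h * phi x) ^ r * I"
        unfolding D_def I_def using h by (intro bd[OF mn(1) deg x]) auto
      have main: "\<bar>D * avg_weight w n x powr a\<bar>
          \<le> C2 * (real m / real n) powr (real r - \<delta> / lam p) / rho m x * v x * I"
      proof (cases "phi x = 0")
        \<comment> \<open>The class condition says nothing useful where \<open>phi\<close> vanishes,
          but there the step is zero and, as r \<ge> 1, so is the difference.\<close>
        case True
        then have "\<bar>D\<bar> * rho m x ^ Suc r \<le> 0" using D r by (simp add: zero_power)
        then have "D = 0" using \<rho> zero_less_power[OF \<rho>, of "Suc r"] by (simp add: mult_le_0_iff del: power_Suc)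
        then show ?thesis using C2 \<rho> I0 by (simp add: v_def)
      next
        case False
        then have ph: "0 < phi x" using phi_nonneg[OF x] by simp
        have "\<bar>D * avg_weight w n x powr a\<bar> * rho m x ^ Suc r = \<bar>D\<bar> * rho m x ^ Suc r * avg_weight w n x powr a"
          by (simp add: abs_mult)
        also have "\<dots> \<le> C1 * (h * phi x) ^ r * I * avg_weight w n x powr a"
          by (rule mult_right_mono[OF D]) simp
        also have "\<dots> = C1 * h ^ r * I * (avg_weight w n x powr a * phi x ^ r)"
          by (simp add: power_mult_distrib)
        also have "\<dots> \<le> C1 * h ^ r * I * (\<Lambda> powr a * (real n / real m) powr (\<delta> / lam p) * (real m * rho m x) ^ r * v x)"
          unfolding a_def v_def using C1 h I0
          by (intro mult_left_mono W_class_powr[OF wW w lam_ge_1[OF p] mn par x ph]) auto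
        also have "\<dots> \<le> C1 * (1 / real n) ^ r * I * (\<Lambda> powr a * (real n / real m) powr (\<delta> / lam p) * (real m * rho m x) ^ r * v x)"
          using C1 h I0 m \<rho> by (intro mult_right_mono mult_left_mono power_mono) (auto simp: v_def)
        also have "\<dots> = C2 * ((real m / real n) ^ r * (real n / real m) powr (\<delta> / lam p)) * v x * I * rho m x ^ r"
          by (simp add: C2_def power_mult_distrib power_divide)
        also have "(real m / real n) ^ r * (real n / real m) powr (\<delta> / lam p) = (real m / real n) powr (real r - \<delta> / lam p)"
        proof -
          have "(real n / real m) powr (\<delta> / lam p) = (real m / real n) powr (- (\<delta> / lam p))"
            using m by (simp add: powr_minus powr_divide)
          moreover have "(real m / real n) ^ r = (real m / real n) powr real r"
            using m by (simp add: powr_realpow)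
          ultimately show ?thesis by (simp add: powr_add[symmetric])
        qed
        finally show ?thesis using \<rho> by (simp add: field_simps)
      qed
      have "ennreal \<bar>D * avg_weight w n x powr a\<bar>
          \<le> ennreal (C2 * (real m / real n) powr (real r - \<delta> / lam p) / rho m x * v x * I)"
        by (rule ennreal_leI[OF main])
      also have "\<dots> = (\<integral>\<^sup>+t. ennreal (C2 * (real m / real n) powr (real r - \<delta> / lam p) / rho m x * v x
          * (\<bar>poly Q t\<bar> / dil m x t ^ M)) * indicator {-1..1} t \<partial>lborel)"
      proof (rule nn_integral_has_integral_lebesgue'[symmetric])
        show "((\<lambda>t. C2 * (real m / real n) powr (real r - \<delta> / lam p) / rho m x * v x
          * (\<bar>poly Q t\<bar> / dil m x t ^ M)) has_integral
            C2 * (real m / real n) powr (real r - \<delta> / lam p) / rho m x * v x * I) {-1..1}"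
          unfolding I_def by (rule has_integral_mult_right[OF integrable_integral[OF int]])
        fix t :: real
        show "0 \<le> C2 * (real m / real n) powr (real r - \<delta> / lam p) / rho m x * v x
          * (\<bar>poly Q t\<bar> / dil m x t ^ M)"
          using C2 \<rho> E0(1)[of t] by (intro E0(1) mult_nonneg_nonneg divide_nonneg_pos) (auto simp: v_def)
      qed
      also have "\<dots> \<le> (\<integral>\<^sup>+t. ennreal (kern m x t) * ennreal (F * u t) * indicator {-1..1} t \<partial>lborel)"
      proof (rule nn_integral_mono)
        fix t :: real
        show "ennreal (C2 * (real m / real n) powr (real r - \<delta> / lam p) / rho m x * v x
            * (\<bar>poly Q t\<bar> / dil m x t ^ M)) * indicator {-1..1} t
          \<le> ennreal (kern m x t) * ennreal (F * u t) * indicator {-1..1} t"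
        proof (cases "t \<in> {-1..1}")
          case True
          define e where "e = dil m x t"
          have e: "1 \<le> e" unfolding e_def by (rule E)
          have "v x \<le> (K * e ^ (2 * s + 1)) * v t"
            unfolding v_def a_def
          proof (rule powr_le_scaled)
            show "avg_weight w m x \<le> K * e ^ (2 * s + 1) * avg_weight w m t"
              unfolding K_def e_def by (rule avg_weight_growth[OF w L mn(1) x True])
            show "1 \<le> K * e ^ (2 * s + 1)"
              using mult_mono[OF K one_le_power[OF e, of "2 * s + 1"]] K by simp
          qed (use avg_weight_nonneg[OF w mn(1)] x True lam_ge_1[OF p] in auto)
          then have "v x / e ^ M \<le> (K * e ^ (2 * s + 1)) * v t / e ^ M"
            using e by (intro divide_right_mono) auto
          also have "\<dots> = K * v t / e ^ 5"
          proof -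
            have "M = (2 * s + 1) + 5" by (simp add: M_def)
            then have "e ^ M = e ^ (2 * s + 1) * e ^ 5" by (simp only: power_add)
            then show ?thesis using e by simp
          qed
          finally have ve: "v x / e ^ M \<le> K * v t / e ^ 5" .
          define q where "q = C2 * (real m / real n) powr (real r - \<delta> / lam p) / rho m x * \<bar>poly Q t\<bar>"
          have "0 \<le> q" using C2 \<rho> by (simp add: q_def)
          then have "q * (v x / e ^ M) \<le> q * (K * v t / e ^ 5)" by (intro mult_left_mono ve)
          then have "C2 * (real m / real n) powr (real r - \<delta> / lam p) / rho m x * v x
              * (\<bar>poly Q t\<bar> / dil m x t ^ M) \<le> kern m x t * (F * u t)"
            by (simp add: q_def e_def kern_def F_def u_def mult_ac)
          then have "ennreal (C2 * (real m / real n) powr (real r - \<delta> / lam p) / rho m x * v x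
              * (\<bar>poly Q t\<bar> / dil m x t ^ M)) \<le> ennreal (kern m x t * (F * u t))"
            by (rule ennreal_leI)
          also have "\<dots> = ennreal (kern m x t) * ennreal (F * u t)"
            using \<rho> E[of t] F by (intro ennreal_mult) (auto simp: kern_def u_def v_def)
          finally show ?thesis using True by simp
        qed simp
      qed
      finally show "ennreal \<bar>symmetric_difference r (h * phi x) (poly Q) x * avg_weight w n x powr a\<bar>
          \<le> (\<integral>\<^sup>+t. ennreal (kern m x t) * ennreal (F * u t) * indicator {-1..1} t \<partial>lborel)"
        by (simp only: D_def)
    qed (use F A in \<open>auto simp: u_def v_def\<close>)
    then show "norm_le p (\<lambda>x. symmetric_difference r (h * phi x) (poly Q) x * avg_weight w n x powr (1 / lam p))
       (C * (real m / real n) powr (real r - \<delta> / lam p) * A)"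
      by (simp add: a_def C_def F_def mult_ac)
  qed
qed

section \<open>Dyadic telescoping\<close>

lemma AE_borel_representative:
  fixes f :: "real \<Rightarrow> real"
  assumes "f \<in> borel_measurable (lebesgue_on {-1..1})"
  shows "\<exists>g\<in>borel_measurable borel. AE x in lborel. x \<in> {-1..1} \<longrightarrow> f x = g x"
proof -
  have "(\<lambda>x. if x \<in> {-1..1} then f x else 0) \<in> borel_measurable lebesgue"
    using assms by (subst borel_measurable_if) auto
  then obtain g where "g \<in> borel_measurable lborel" "AE x in lborel. (if x \<in> {-1..1} then f x else 0) = g x"
    using completion_ex_borel_measurable_real by blast
  then show ?thesis by (intro bexI[of _ g]) (auto elim!: eventually_mono split: if_splits)
qed

text \<open>A difference samples f at moved points, so changing f on a null set N matters only where
  some node falls into N. By \<open>nn_integral_step_map\<close> each node does so only for x in a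
  null set.\<close>

lemma AE_symmetric_difference_eq:
  assumes "AE x in lborel. x \<in> {-1..1} \<longrightarrow> f x = g x" and r: "1 \<le> r" and h: "0 < h"
  shows "AE x in lborel. x \<in> {-1..1} \<longrightarrow>
    symmetric_difference r (h * phi x) f x = symmetric_difference r (h * phi x) g x"
proof -
  define b where "b = real r * h / 2"
  have b: "0 < b" using r h by (simp add: b_def)
  define c where "c i = real i * h - b" for i :: nat
  have c: "\<bar>c i\<bar> \<le> b" if "i \<le> r" for i
    unfolding c_def b_def by (rule difference_node_le[OF that]) (use h in simp)
  obtain N where N: "N \<in> null_sets lborel" "{x. \<not> (x \<in> {-1..1} \<longrightarrow> f x = g x)} \<subseteq> N"
    using assms(1) unfolding eventually_ae_filter by auto
  define F where "F = (indicator N :: real \<Rightarrow> ennreal)"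
  have [measurable]: "N \<in> sets borel" using N(1) by auto
  have [measurable]: "F \<in> borel_measurable borel" unfolding F_def by measurable
  have "(\<integral>\<^sup>+y. F y * indicator {-1..1} y \<partial>lborel) \<le> (\<integral>\<^sup>+y. indicator N y \<partial>lborel)"
    by (intro nn_integral_mono) (auto simp: F_def indicator_def)
  also have "\<dots> = 0" using N(1) by auto
  finally have F0: "(\<integral>\<^sup>+y. F y * indicator {-1..1} y \<partial>lborel) = 0" by simp
  have "AE x in lborel. \<forall>i\<in>{0..r}. F (x + c i * phi x) * indicator {- step_limit b..step_limit b} x = 0"
  proof (rule AE_finite_allI)
    fix i assume "i \<in> {0..r}"
    then have "(\<integral>\<^sup>+x. F (x + c i * phi x) * indicator {- step_limit b..step_limit b} x \<partial>lborel) = 0"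
      using nn_integral_step_map[of F b "c i"] b c[of i] F0 by simp
    then show "AE x in lborel. F (x + c i * phi x) * indicator {- step_limit b..step_limit b} x = 0"
      by (subst (asm) nn_integral_0_iff_AE) auto
  qed simp
  moreover have "AE x in lborel. x \<noteq> (1::real)" "AE x in lborel. x \<noteq> (-1::real)"
    by (rule AE_lborel_singleton)+
  ultimately show ?thesis
  proof eventually_elim
    case (elim x)
    show ?case
    proof
      assume x: "x \<in> {-1..1}"
      have step: "real r * (h * phi x) / 2 = b * phi x" by (simp add: b_def)
      show "symmetric_difference r (h * phi x) f x = symmetric_difference r (h * phi x) g x"
      proof (cases "x - b * phi x \<in> {-1..1} \<and> x + b * phi x \<in> {-1..1}")
        case True
        then have xS: "\<bar>x\<bar> \<le> step_limit b"
          using abs_le_step_limit[OF b, of x] x elim by (auto simp: abs_less_iff)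
        have "f (x - b * phi x + real i * (h * phi x)) = g (x - b * phi x + real i * (h * phi x))" if "i \<in> {0..r}" for i
        proof -
          have y: "x - b * phi x + real i * (h * phi x) = x + c i * phi x"
            by (simp add: c_def algebra_simps)
          have "x + c i * phi x \<in> {-1..1}" using step_map_facts(1)[OF b c xS] that by simp
          moreover have "F (x + c i * phi x) = 0" using elim(1) that xS by (auto simp: abs_le_iff)
          then have "x + c i * phi x \<notin> N" by (auto simp: F_def indicator_def)
          ultimately show ?thesis unfolding y using N(2) by auto
        qed
        then show ?thesis using True by (simp add: symmetric_difference_def step)
      next
        case False
        then show ?thesis unfolding symmetric_difference_def step by auto
      qed
    qed
  qed
qed

lemma symmetric_difference_add:
  "symmetric_difference r h (\<lambda>x. f x + g x) x = symmetric_difference r h f x + symmetric_difference r h g x"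
  by (simp add: symmetric_difference_def distrib_left sum.distrib)

lemma symmetric_difference_sum:
  "symmetric_difference r h (\<lambda>x. \<Sum>i\<in>A. f i x) x = (\<Sum>i\<in>A. symmetric_difference r h (f i) x)"
proof (induction A rule: infinite_finite_induct)
  case (insert a A)
  then show ?case by (simp add: symmetric_difference_add)
qed (simp_all add: symmetric_difference_def)

lemma symmetric_difference_const: "1 \<le> r \<Longrightarrow> symmetric_difference r h (\<lambda>_. c) x = 0"
proof -
  assume "1 \<le> r"
  then have "(0::real) = (1 + (-1)) ^ r" by (simp add: zero_power)
  also have "\<dots> = (\<Sum>i\<le>r. real (r choose i) * 1 ^ i * (-1) ^ (r - i))" by (rule binomial_ring)
  finally show ?thesis
    by (simp add: symmetric_difference_def sum_distrib_right[symmetric] atLeast0AtMost)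
qed

section \<open>Passing between weights of comparable degrees\<close>

lemma wnorm_avg_weight_le_iff:
  assumes "1 \<le> p" "doubling_weight L w" "1 \<le> n" "0 \<le> A" "g' \<in> borel_measurable borel"
    and "AE x in lborel. x \<in> {-1..1} \<longrightarrow> g x = g' x"
  shows "wnorm p (avg_weight w n) g \<le> ennreal A \<longleftrightarrow>
    norm_le p (\<lambda>x. g' x * avg_weight w n x powr (1 / lam p)) A"
  by (rule wnorm_le_iff) (use assms avg_weight_nonneg[OF assms(2,3)] avg_weight_measurable[OF assms(2)] in auto)

lemma norm_le_avg_weight_double:
  assumes p: "1 \<le> p" and w: "doubling_weight L w" and mn: "1 \<le> m" "m \<le> n" "n \<le> 2 * m"
    and [measurable]: "g \<in> borel_measurable borel" and A: "0 \<le> A"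
    and ng: "norm_le p (\<lambda>x. g x * avg_weight w m x powr (1 / lam p)) A"
  shows "norm_le p (\<lambda>x. g x * avg_weight w n x powr (1 / lam p)) (4 * A)"
proof -
  have [measurable]: "avg_weight w m \<in> borel_measurable borel" by (rule avg_weight_measurable[OF w])
  have n: "1 \<le> n" using mn by simp
  have "norm_le p (\<lambda>x. 4 * (g x * avg_weight w m x powr (1 / lam p))) (4 * A)"
    using A by (intro norm_le_scale[OF p _ ng]) auto
  then show ?thesis
  proof (rule norm_le_mono[OF p], intro AE_I2 impI)
    fix x :: real assume x: "x \<in> {-1..1}"
    have "avg_weight w n x powr (1 / lam p) \<le> 4 * avg_weight w m x powr (1 / lam p)"
      by (intro powr_le_scaled avg_weight_double[OF w mn x] avg_weight_nonneg[OF w] n mn x lam_ge_1[OF p]) auto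
    then have "\<bar>g x\<bar> * avg_weight w n x powr (1 / lam p) \<le> \<bar>g x\<bar> * (4 * avg_weight w m x powr (1 / lam p))"
      by (rule mult_left_mono) simp
    then show "\<bar>g x * avg_weight w n x powr (1 / lam p)\<bar> \<le> \<bar>4 * (g x * avg_weight w m x powr (1 / lam p))\<bar>"
      by (simp add: abs_mult)
  qed
qed

lemma wnorm_double:
  assumes p: "1 \<le> p" and w: "doubling_weight L w" and mn: "1 \<le> m" "m \<le> n" "n \<le> 2 * m"
    and g: "g \<in> borel_measurable (lebesgue_on {-1..1})"
  shows "wnorm p (avg_weight w n) g \<le> 4 * wnorm p (avg_weight w m) g"
proof (cases "wnorm p (avg_weight w m) g" rule: ennreal_cases)
  case (real A)
  obtain g' where g': "g' \<in> borel_measurable borel" and eq: "AE x in lborel. x \<in> {-1..1} \<longrightarrow> g x = g' x"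
    using AE_borel_representative[OF g] by blast
  have n: "1 \<le> n" using mn by simp
  have "norm_le p (\<lambda>x. g' x * avg_weight w m x powr (1 / lam p)) A"
    using wnorm_avg_weight_le_iff[OF p w mn(1) real(1) g' eq] real(2) by simp
  then have "norm_le p (\<lambda>x. g' x * avg_weight w n x powr (1 / lam p)) (4 * A)"
    by (rule norm_le_avg_weight_double[OF p w mn g' real(1)])
  then have "wnorm p (avg_weight w n) g \<le> ennreal (4 * A)"
    using wnorm_avg_weight_le_iff[OF p w n _ g' eq, of "4 * A"] real(1) by simp
  then show ?thesis using real by (simp add: ennreal_mult)
qed (simp add: ennreal_mult_top)

text \<open>Polynomials admissible for m are admissible for n; only the change of weight costs the
  4.\<close>

lemma best_approx_double:
  assumes p: "1 \<le> p" and w: "doubling_weight L w" and mn: "1 \<le> m" "m \<le> n" "n \<le> 2 * m"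
    and f: "f \<in> borel_measurable (lebesgue_on {-1..1})"
  shows "ennreal (1 / 4) * best_approx n f p (avg_weight w n) \<le> best_approx m f p (avg_weight w m)"
  unfolding best_approx_def[of m]
proof (rule INF_greatest)
  fix P assume P: "P \<in> Pi_polys m"
  have "poly P \<in> borel_measurable borel"
    by (intro borel_measurable_continuous_onI continuous_intros)
  then have "poly P \<in> borel_measurable (lebesgue_on {-1..1})"
    by (intro measurable_restrict_space1 measurable_completion) simp
  then have m: "(\<lambda>x. f x - poly P x) \<in> borel_measurable (lebesgue_on {-1..1})" using f by simp
  have "P \<in> Pi_polys n" using P mn by (simp add: Pi_polys_def)
  then have "best_approx n f p (avg_weight w n) \<le> wnorm p (avg_weight w n) (\<lambda>x. f x - poly P x)"
    unfolding best_approx_def by (rule INF_lower)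
  also have "\<dots> \<le> 4 * wnorm p (avg_weight w m) (\<lambda>x. f x - poly P x)"
    by (rule wnorm_double[OF p w mn m])
  finally have "ennreal (1 / 4) * best_approx n f p (avg_weight w n)
      \<le> ennreal (1 / 4) * (4 * wnorm p (avg_weight w m) (\<lambda>x. f x - poly P x))"
    by (rule mult_left_mono) simp
  also have "\<dots> = wnorm p (avg_weight w m) (\<lambda>x. f x - poly P x)"
  proof -
    have "ennreal (1 / 4) * 4 = ennreal (1 / 4) * ennreal 4" by simp
    also have "\<dots> = 1" by (subst ennreal_mult[symmetric]) auto
    finally show ?thesis by (simp add: mult.assoc[symmetric])
  qed
  finally show "ennreal (1 / 4) * best_approx n f p (avg_weight w n) \<le> wnorm p (avg_weight w m) (\<lambda>x. f x - poly P x)" .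
qed

text \<open>On a dyadic block k and its right end differ by a factor at most 2; the absolute value
  covers both signs of the exponent.\<close>

lemma powr_dyadic_block:
  assumes "2 ^ N < k" "k \<le> 2 ^ Suc N"
  shows "(2 ^ Suc N :: real) powr e \<le> 2 powr \<bar>e\<bar> * real k powr e"
proof -
  define M where "M = (2 ^ Suc N :: real)"
  have k: "0 < real k" "real k \<le> M" "M \<le> 2 * real k"
  proof -
    show "0 < real k" using assms by (metis gr_implies_not_zero neq0_conv of_nat_0_less_iff)
    have "real k \<le> real (2 ^ Suc N)" using assms(2) by (simp only: of_nat_le_iff)
    then show "real k \<le> M" by (simp add: M_def)
    have "real (2 ^ N) \<le> real k" using assms(1) by (simp only: of_nat_le_iff)
    then show "M \<le> 2 * real k" by (simp add: M_def)
  qed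
  have "(M / real k) powr e \<le> 2 powr \<bar>e\<bar>"
  proof -
    have "(M / real k) powr e \<le> (M / real k) powr \<bar>e\<bar>" using k by (intro powr_mono) auto
    also have "\<dots> \<le> 2 powr \<bar>e\<bar>" using k by (intro powr_mono2) (auto simp: divide_le_eq)
    finally show ?thesis .
  qed
  then show ?thesis using k by (simp add: powr_divide divide_le_eq M_def)
qed

text \<open>The term at S = 2^(N+1) is spread over the 2^N indices k of the block ending there, each
  with E(S) \<le> 4 E(k). As 2^N S^(\<beta> - 1) is half of S^\<beta>, the cost is 2 times
  4.\<close>

lemma dyadic_sum_le:
  fixes E :: "nat \<Rightarrow> ennreal"
  assumes "\<And>m n. 1 \<le> m \<Longrightarrow> m \<le> n \<Longrightarrow> n \<le> 2 * m \<Longrightarrow> ennreal (1 / 4) * E n \<le> E m"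
  shows "(\<Sum>j\<le>N. ennreal ((2 ^ j) powr \<beta>) * E (2 ^ j))
    \<le> ennreal (8 * 2 powr \<bar>\<beta> - 1\<bar>) * (\<Sum>k=1..2 ^ N. ennreal (real k powr (\<beta> - 1)) * E k)"
proof (induction N)
  case 0
  have "1 \<le> 8 * 2 powr \<bar>\<beta> - 1\<bar>" using ge_one_powr_ge_zero[of 2 "\<bar>\<beta> - 1\<bar>"] by linarith
  then have "1 \<le> ennreal (8 * 2 powr \<bar>\<beta> - 1\<bar>)" by (metis ennreal_1 ennreal_leI)
  then have "1 * E 1 \<le> ennreal (8 * 2 powr \<bar>\<beta> - 1\<bar>) * E 1" by (rule mult_right_mono) simp
  then show ?case by simp
next
  case (Suc N)
  define C where "C = 8 * 2 powr \<bar>\<beta> - 1\<bar>"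
  define S where "S = (2 ^ Suc N :: real)"
  define e where "e = E (2 ^ Suc N)"
  define T where "T k = ennreal (real k powr (\<beta> - 1)) * E k" for k
  have S: "0 < S" by (simp add: S_def)
  have block: "ennreal (S powr (\<beta> - 1)) * (ennreal (1 / 4) * e) \<le> ennreal (2 powr \<bar>\<beta> - 1\<bar>) * T k"
    if "k \<in> {2 ^ N + 1..2 ^ Suc N}" for k
  proof -
    have k: "2 ^ N < k" "k \<le> 2 ^ Suc N" using that by auto
    have "ennreal (S powr (\<beta> - 1)) * (ennreal (1 / 4) * e)
        \<le> ennreal (2 powr \<bar>\<beta> - 1\<bar> * real k powr (\<beta> - 1)) * E k"
      unfolding e_def S_def using k by (intro mult_mono ennreal_leI powr_dyadic_block assms) auto
    then show ?thesis by (simp add: T_def ennreal_mult mult.assoc)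
  qed
  have "ennreal (S powr \<beta>) * e = ennreal (8 * (real (2 ^ N) * (S powr (\<beta> - 1) * (1 / 4)))) * e"
    using S by (simp add: powr_diff S_def)
  also have "\<dots> = 8 * (of_nat (2 ^ N) * (ennreal (S powr (\<beta> - 1)) * (ennreal (1 / 4) * e)))"
    by (simp only: ennreal_mult zero_le_numeral zero_le_mult_iff of_nat_0_le_iff powr_ge_zero mult.assoc
        ennreal_numeral ennreal_of_nat_eq_real_of_nat simp_thms zero_le_divide_1_iff mult_nonneg_nonneg)
  also have "of_nat (2 ^ N) * (ennreal (S powr (\<beta> - 1)) * (ennreal (1 / 4) * e))
      = (\<Sum>k\<in>{2 ^ N + (1::nat)..2 ^ Suc N}. ennreal (S powr (\<beta> - 1)) * (ennreal (1 / 4) * e))"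
    by simp
  also have "\<dots> \<le> (\<Sum>k\<in>{2 ^ N + (1::nat)..2 ^ Suc N}. ennreal (2 powr \<bar>\<beta> - 1\<bar>) * T k)"
    by (rule sum_mono[OF block])
  also have "\<dots> = ennreal (2 powr \<bar>\<beta> - 1\<bar>) * (\<Sum>k\<in>{2 ^ N + (1::nat)..2 ^ Suc N}. T k)"
    by (simp add: sum_distrib_left)
  also have "8 * \<dots> = ennreal C * (\<Sum>k\<in>{2 ^ N + (1::nat)..2 ^ Suc N}. T k)"
    by (simp add: C_def ennreal_mult mult.assoc)
  finally have new: "ennreal (S powr \<beta>) * e \<le> ennreal C * (\<Sum>k\<in>{2 ^ N + (1::nat)..2 ^ Suc N}. T k)"
    by (simp add: mult_left_mono)
  have "(\<Sum>k=1..2 ^ Suc N. T k) = (\<Sum>k=1..2 ^ N. T k) + (\<Sum>k\<in>{2 ^ N + (1::nat)..2 ^ Suc N}. T k)"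
    by (subst sum.union_disjoint[symmetric]) (auto intro!: sum.cong)
  then show ?case
    using add_mono[OF Suc.IH new] by (simp add: distrib_left C_def S_def e_def T_def del: power_Suc)
qed

lemma doubling_weight_mono:
  assumes "doubling_weight L w" "L \<le> L'" shows "doubling_weight L' w"
proof -
  have "L * (LINT u:{a..b}|lebesgue. w u) \<le> L' * (LINT u:{a..b}|lebesgue. w u)" for a b
    using wint_nonneg[OF assms(1), of a b] assms(2) by (intro mult_right_mono) (auto simp: wint_def)
  then show ?thesis using assms(1) unfolding doubling_weight_def by (meson order_trans)
qed

text \<open>Write g as (g - P_N) plus the increments P_(i+1) - P_i plus P_0. Measured with the
  weight of degree 2^(i+1), an increment is at most B(i+1) + 4 B(i), the 4 paying for the change of
  weight.\<close>

lemma norm_le_symmetric_difference_telescope: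
  fixes r s :: nat and p :: ennreal and \<delta> \<gamma> \<Lambda> L :: real
  assumes r: "1 \<le> r" and p: "1 \<le> p" and par: "0 \<le> \<gamma>" "0 < \<Lambda>" "\<gamma> \<le> real r * lam p"
    and L: "0 \<le> L" "L\<^sup>2 \<le> 2 ^ s"
  defines "\<beta> \<equiv> real r - \<delta> / lam p"
  shows "\<exists>C>0. \<forall>w g n N P B h. doubling_weight L w \<longrightarrow> w \<in> W_class \<delta> \<gamma> \<Lambda> \<longrightarrow>
     g \<in> borel_measurable borel \<longrightarrow> 2 ^ N \<le> n \<longrightarrow> n \<le> 2 * 2 ^ N \<longrightarrow>
     (\<forall>j\<le>N. degree (P j) < 2 ^ j \<and> 0 < B j \<and>
        norm_le p (\<lambda>x. (g x - poly (P j) x) * avg_weight w (2 ^ j) x powr (1 / lam p)) (B j)) \<longrightarrow>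
     0 < h \<longrightarrow> h \<le> 1 / real n \<longrightarrow>
     norm_le p (\<lambda>x. symmetric_difference r (h * phi x) g x * avg_weight w n x powr (1 / lam p))
       (C * (\<Sum>j\<le>N. (2 ^ j / real n) powr \<beta> * B j))"
proof -
  obtain C1 where C1: "0 < C1" and polyb: "\<And>w m n Q h A. doubling_weight L w \<Longrightarrow> w \<in> W_class \<delta> \<gamma> \<Lambda> \<Longrightarrow>
     1 \<le> m \<Longrightarrow> m \<le> n \<Longrightarrow> degree Q < m \<Longrightarrow> 0 < h \<Longrightarrow> h \<le> 1 / real n \<Longrightarrow> 0 \<le> A \<Longrightarrow>
     norm_le p (\<lambda>x. poly Q x * avg_weight w m x powr (1 / lam p)) A \<Longrightarrow>
     norm_le p (\<lambda>x. symmetric_difference r (h * phi x) (poly Q) x * avg_weight w n x powr (1 / lam p))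
       (C1 * (real m / real n) powr \<beta> * A)"
    using norm_le_symmetric_difference_poly[OF r p par L, of \<delta>] unfolding \<beta>_def by blast
  \<comment> \<open>The 8 is the 2 of \<open>norm_le_symmetric_difference\<close> times the 4 for
    replacing the weight of degree 2^N by that of degree n.\<close>
  define C0 where "C0 = (2::real) ^ r * (2 * 4 ^ s * (1 + real r) ^ (2 * s + 1)) * 8"
  define K where "K = (2::real) powr \<bar>\<beta>\<bar>"
  \<comment> \<open>The remainder carries no coefficient, but c N \<ge> 1/K because n \<le> 2 * 2^N.
    An increment meets B(i) with c(i+1) \<le> K c(i).\<close>
  define C where "C = C0 * K + C1 * (1 + 4 * K)"
  have C0: "0 < C0" by (simp add: C0_def add_pos_nonneg)
  have K: "0 < K" by (simp add: K_def)
  have C: "0 < C" using C0 C1 K by (simp add: C_def add_pos_pos)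
  show ?thesis
  proof (rule exI[of _ C], intro conjI allI impI, rule C)
    fix w g n N P B h
    assume w: "doubling_weight L w" and wW: "w \<in> W_class \<delta> \<gamma> \<Lambda>" and gm[measurable]: "g \<in> borel_measurable borel"
      and nN: "2 ^ N \<le> n" "n \<le> 2 * 2 ^ N"
      and PB: "\<forall>j\<le>N. degree (P j) < 2 ^ j \<and> 0 < B j \<and>
        norm_le p (\<lambda>x. (g x - poly (P j) x) * avg_weight w (2 ^ j) x powr (1 / lam p)) (B j)"
      and h: "0 < h" "h \<le> 1 / real n"
    have deg: "degree (P j) < 2 ^ j" and B: "0 < B j"
      and nb: "norm_le p (\<lambda>x. (g x - poly (P j) x) * avg_weight w (2 ^ j) x powr (1 / lam p)) (B j)"
      if "j \<le> N" for j using PB that by auto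
    have n1: "1 \<le> n" using nN(1) one_le_power[of "2::nat" N] by linarith
    have n: "0 < real n" using n1 by simp
    have wm[measurable]: "avg_weight w k \<in> borel_measurable borel" for k by (rule avg_weight_measurable[OF w])
    have pm[measurable]: "poly Q \<in> borel_measurable borel" for Q :: "real poly"
      by (intro borel_measurable_continuous_onI continuous_intros)
    define v where "v = (\<lambda>k x. avg_weight w k x powr (1 / lam p))"
    have vm[measurable]: "v k \<in> borel_measurable borel" for k unfolding v_def by measurable
    define c where "c = (\<lambda>j::nat. (2 ^ j / real n) powr \<beta>)"
    have c0: "0 < c j" for j using n by (simp add: c_def)
    have c_Suc: "c (Suc j) \<le> K * c j" for j
    proof -
      have "c (Suc j) = 2 powr \<beta> * c j"
        unfolding c_def powr_mult[symmetric] by simp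
      moreover have "2 powr \<beta> \<le> K" unfolding K_def by (intro powr_mono) auto
      ultimately show ?thesis using c0[of j] by (simp add: mult_right_mono)
    qed
    have c_N: "1 \<le> K * c N"
    proof -
      define y where "y = real n / 2 ^ N"
      have "real (2 ^ N) \<le> real n" "real n \<le> real (2 * 2 ^ N)" using nN by (simp_all only: of_nat_le_iff)
      then have y: "1 \<le> y" "y \<le> 2" by (auto simp: y_def le_divide_eq divide_le_eq)
      have "y powr \<beta> \<le> y powr \<bar>\<beta>\<bar>" using y by (intro powr_mono) auto
      also have "\<dots> \<le> K" unfolding K_def using y by (intro powr_mono2) auto
      finally have "y powr \<beta> * c N \<le> K * c N" using c0[of N] by (intro mult_right_mono) auto
      moreover have "y powr \<beta> * c N = 1"
        unfolding c_def powr_mult[symmetric] y_def using n by simp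
      ultimately show ?thesis by simp
    qed
    define Q where "Q = (\<lambda>i. P (Suc i) - P i)"
    \<comment> \<open>Index 0 holds the remainder and index i + 1 the increment Q i, so a single sum
      over i \<le> N covers both.\<close>
    define G where "G = (\<lambda>i. case i of 0 \<Rightarrow> (\<lambda>x. symmetric_difference r (h * phi x) (\<lambda>x. g x - poly (P N) x) x * v n x)
        | Suc i \<Rightarrow> (\<lambda>x. symmetric_difference r (h * phi x) (poly (Q i)) x * v n x))"
    define A where "A = (\<lambda>i. case i of 0 \<Rightarrow> C0 * B N | Suc i \<Rightarrow> C1 * c (Suc i) * (B (Suc i) + 4 * B i))"
    have G0: "norm_le p (G 0) (A 0)"
    proof -
      have "norm_le p (\<lambda>x. (g x - poly (P N) x) * v n x) (4 * B N)"
        unfolding v_def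
        by (rule norm_le_avg_weight_double[OF p w _ nN _ _ nb]) (use B[of N] in auto)
      then show ?thesis
        using norm_le_symmetric_difference[OF r p L w n1 h, of "\<lambda>x. g x - poly (P N) x" "4 * B N"] B[of N]
        by (simp add: G_def A_def v_def C0_def mult_ac)
    qed
    have GS: "norm_le p (G (Suc i)) (A (Suc i))" if i: "i < N" for i
    proof -
      have m: "2 ^ Suc i \<le> n"
        using nN(1) power_increasing[of "Suc i" N "2::nat"] i by linarith
      have "norm_le p (\<lambda>x. (g x - poly (P i) x) * v (2 ^ Suc i) x) (4 * B i)"
        unfolding v_def
        by (rule norm_le_avg_weight_double[OF p w _ _ _ _ _ nb]) (use B[of i] i in auto)
      moreover have "norm_le p (\<lambda>x. - ((g x - poly (P (Suc i)) x) * v (2 ^ Suc i) x)) (B (Suc i))"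
        unfolding v_def by (rule norm_le_mono[OF p nb]) (use i in auto)
      ultimately have "norm_le p (\<lambda>x. - ((g x - poly (P (Suc i)) x) * v (2 ^ Suc i) x)
          + (g x - poly (P i) x) * v (2 ^ Suc i) x) (B (Suc i) + 4 * B i)"
        using B[of i] B[of "Suc i"] i by (intro norm_le_add[OF p]) auto
      then have "norm_le p (\<lambda>x. poly (Q i) x * v (2 ^ Suc i) x) (B (Suc i) + 4 * B i)"
        by (rule norm_le_mono[OF p]) (simp add: Q_def algebra_simps)
      moreover have "degree (Q i) < 2 ^ Suc i"
      proof -
        have "degree (P i) < 2 ^ Suc i" "degree (P (Suc i)) < 2 ^ Suc i"
          using deg[of i] deg[of "Suc i"] i by auto
        then show ?thesis
          unfolding Q_def using degree_diff_le_max[of "P (Suc i)" "P i"] by linarith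
      qed
      ultimately show ?thesis
        using polyb[OF w wW _ m _ h, of "Q i" "B (Suc i) + 4 * B i"] B[of i] B[of "Suc i"] i
        by (simp add: G_def A_def v_def c_def)
    qed
    have "norm_le p (\<lambda>x. \<Sum>i\<le>N. G i x) (\<Sum>i\<le>N. A i)"
    proof (rule norm_le_sum[OF p])
      show "G i \<in> borel_measurable borel" for i by (cases i) (auto simp: G_def)
      fix i assume i: "i \<le> N"
      show "norm_le p (G i) (A i)" using i G0 GS by (cases i) auto
      show "0 < A i" using i B[of N] B[of i] B[of "i - 1"] C0 C1 c0[of i]
        by (cases i) (auto simp: A_def intro!: mult_pos_pos add_pos_pos)
    qed
    moreover have "(\<Sum>i\<le>N. G i x) = symmetric_difference r (h * phi x) g x * v n x" for x
    proof -
      \<comment> \<open>Degree below 2^0 means constant, so the bottom of the telescope has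
        vanishing differences.\<close>
      obtain a where "P 0 = [:a:]" using deg[of 0] by (auto elim: degree_eq_zeroE)
      then have "poly (P 0) = (\<lambda>_. a)" by (simp add: fun_eq_iff)
      then have P0: "symmetric_difference r (h * phi x) (poly (P 0)) x = 0"
        using symmetric_difference_const[OF r] by metis
      have "(\<Sum>i<N. poly (Q i) y) = poly (P N) y - poly (P 0) y" for y
        unfolding Q_def poly_diff by (rule sum_lessThan_telescope)
      then have "g = (\<lambda>y. ((g y - poly (P N) y) + (\<Sum>i<N. poly (Q i) y)) + poly (P 0) y)" by auto
      then have "symmetric_difference r (h * phi x) g x
          = symmetric_difference r (h * phi x) (\<lambda>y. ((g y - poly (P N) y) + (\<Sum>i<N. poly (Q i) y)) + poly (P 0) y) x"
        by metis
      also have "\<dots> = symmetric_difference r (h * phi x) (\<lambda>y. g y - poly (P N) y) x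
          + (\<Sum>i<N. symmetric_difference r (h * phi x) (poly (Q i)) x)"
        by (simp only: symmetric_difference_add symmetric_difference_sum P0 add_0_right)
      finally show ?thesis
        by (simp add: sum.atMost_shift G_def distrib_right sum_distrib_right)
    qed
    ultimately have "norm_le p (\<lambda>x. symmetric_difference r (h * phi x) g x * v n x) (\<Sum>i\<le>N. A i)" by simp
    moreover have "(\<Sum>i\<le>N. A i) \<le> C * (\<Sum>j\<le>N. c j * B j)"
    proof -
      define S where "S = (\<Sum>j\<le>N. c j * B j)"
      have cB: "0 \<le> c j * B j" if "j \<le> N" for j using c0[of j] B[OF that] by simp
      have "A 0 \<le> C0 * K * (c N * B N)"
        using mult_right_mono[OF c_N, of "C0 * B N"] C0 B[of N] by (simp add: A_def mult_ac)
      also have "c N * B N \<le> S" unfolding S_def using cB by (intro member_le_sum) auto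
      finally have a0: "A 0 \<le> C0 * K * S" using C0 K by (simp add: mult_left_mono)
      have "(\<Sum>i<N. A (Suc i)) \<le> (\<Sum>i<N. C1 * (c (Suc i) * B (Suc i)) + 4 * K * C1 * (c i * B i))"
      proof (rule sum_mono)
        fix i assume "i \<in> {..<N}"
        then have "c (Suc i) * (4 * B i * C1) \<le> K * c i * (4 * B i * C1)"
          using B[of i] C1 by (intro mult_right_mono c_Suc) auto
        then show "A (Suc i) \<le> C1 * (c (Suc i) * B (Suc i)) + 4 * K * C1 * (c i * B i)"
          by (simp add: A_def algebra_simps)
      qed
      also have "\<dots> = C1 * (\<Sum>i<N. c (Suc i) * B (Suc i)) + 4 * K * C1 * (\<Sum>i<N. c i * B i)"
        by (simp add: sum.distrib sum_distrib_left)
      also have "\<dots> \<le> C1 * S + 4 * K * C1 * S"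
      proof (intro add_mono mult_left_mono)
        show "(\<Sum>i<N. c i * B i) \<le> S" unfolding S_def using cB by (intro sum_mono2) auto
        show "(\<Sum>i<N. c (Suc i) * B (Suc i)) \<le> S"
          unfolding S_def sum.atMost_shift using cB[of 0] by simp
      qed (use C1 K in auto)
      finally have "A 0 + (\<Sum>i<N. A (Suc i)) \<le> C * S"
        using a0 by (simp add: C_def algebra_simps)
      then show ?thesis unfolding S_def[symmetric] by (simp only: sum.atMost_shift)
    qed
    moreover have "0 \<le> (\<Sum>i\<le>N. A i)"
    proof (rule sum_nonneg)
      fix i assume "i \<in> {..N}"
      then show "0 \<le> A i" using B[of N] B[of i] B[of "i - 1"] C0 C1 c0[of i]
        by (cases i) (auto simp: A_def intro!: mult_nonneg_nonneg less_imp_le)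
    qed
    ultimately show "norm_le p (\<lambda>x. symmetric_difference r (h * phi x) g x * avg_weight w n x powr (1 / lam p))
       (C * (\<Sum>j\<le>N. (2 ^ j / real n) powr \<beta> * B j))"
      using norm_le_bound_mono[OF p] by (simp add: v_def c_def)
  qed
qed

theorem theorem7p3:
  fixes r :: nat and p :: ennreal and \<delta> \<gamma> \<Lambda> L :: real
  assumes "1 \<le> r" and "1 \<le> p"
    and "0 \<le> \<delta>" and "0 \<le> \<gamma>" and "0 < \<Lambda>"
    and "\<gamma> \<le> real r * lam p"
  shows "\<exists>c>0. \<forall>w f n.
           doubling_weight L w \<and> w \<in> W_class \<delta> \<gamma> \<Lambda> \<and> f \<in> Lp_space p \<and> 1 \<le> n \<longrightarrow>
           modulus r f (1 / real n) p (avg_weight w n)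
             \<le> ennreal (c / real n powr (real r - \<delta> / lam p)) *
               (\<Sum>k=1..n. ennreal (real k powr (real r - 1 - \<delta> / lam p)) *
                           best_approx k f p (avg_weight w k))"
proof -
  note r = assms(1) and p = assms(2)
  define \<beta> where "\<beta> = real r - \<delta> / lam p"
  \<comment> \<open>No sign of L is assumed, but the growth lemmas need a nonnegative constant;
    enlarging L is harmless.\<close>
  define L' where "L' = max L 0"
  have L': "0 \<le> L'" by (simp add: L'_def)
  obtain s where s: "L'\<^sup>2 \<le> 2 ^ s" using real_arch_pow[of 2 "L'\<^sup>2"] by (auto intro: less_imp_le)
  obtain C where C: "0 < C" and tel: "\<forall>w g n N P B h. doubling_weight L' w \<longrightarrow> w \<in> W_class \<delta> \<gamma> \<Lambda> \<longrightarrow>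
     g \<in> borel_measurable borel \<longrightarrow> 2 ^ N \<le> n \<longrightarrow> n \<le> 2 * 2 ^ N \<longrightarrow>
     (\<forall>j\<le>N. degree (P j) < 2 ^ j \<and> 0 < B j \<and>
        norm_le p (\<lambda>x. (g x - poly (P j) x) * avg_weight w (2 ^ j) x powr (1 / lam p)) (B j)) \<longrightarrow>
     0 < h \<longrightarrow> h \<le> 1 / real n \<longrightarrow>
     norm_le p (\<lambda>x. symmetric_difference r (h * phi x) g x * avg_weight w n x powr (1 / lam p))
       (C * (\<Sum>j\<le>N. (2 ^ j / real n) powr \<beta> * B j))"
    using norm_le_symmetric_difference_telescope[OF r p assms(4-6) L' s, of \<delta>, folded \<beta>_def]
    by (elim exE conjE) (rule that)
  define C' where "C' = 8 * (2::real) powr \<bar>\<beta> - 1\<bar>"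
  show ?thesis
  proof (rule exI[of _ "C * C'"], intro conjI allI impI)
    show "0 < C * C'" using C by (simp add: C'_def)
    fix w f and n :: nat
    assume "doubling_weight L w \<and> w \<in> W_class \<delta> \<gamma> \<Lambda> \<and> f \<in> Lp_space p \<and> 1 \<le> n"
    then have w: "doubling_weight L' w" and wW: "w \<in> W_class \<delta> \<gamma> \<Lambda>" and n1: "1 \<le> n"
      and f: "f \<in> borel_measurable (lebesgue_on {-1..1})"
      using doubling_weight_mono[of L w L'] by (auto simp: L'_def Lp_space_def)
    have n: "0 < real n" using n1 by simp
    obtain g where gm[measurable]: "g \<in> borel_measurable borel" and fg: "AE x in lborel. x \<in> {-1..1} \<longrightarrow> f x = g x"
      using AE_borel_representative[OF f] by blast
    obtain N where N: "2 ^ N \<le> n" "n < 2 ^ (N + 1)" using ex_power_ivl1[of 2 n] n1 by auto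
    define E where "E = (\<lambda>k. best_approx k f p (avg_weight w k))"
    define c where "c = (\<lambda>j::nat. (2 ^ j / real n) powr \<beta>)"
    have c0: "0 < c j" for j using n by (simp add: c_def)
    have "modulus r f (1 / real n) p (avg_weight w n) \<le> ennreal C * (\<Sum>j\<le>N. ennreal (c j) * E (2 ^ j))"
    \<comment> \<open>The infima defining E need not be attained, so near-best approximants are used
      with total slack e. This rule also lets the right-hand side be assumed finite, which makes
      every dyadic error finite because the coefficients are positive.\<close>
    proof (rule ennreal_le_epsilon)
      fix e :: real
      assume fin: "ennreal C * (\<Sum>j\<le>N. ennreal (c j) * E (2 ^ j)) < top" and e: "0 < e"
      have Efin: "E (2 ^ j) < top" if "j \<le> N" for j
      proof (rule ccontr)
        assume "\<not> E (2 ^ j) < top"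
        then have "E (2 ^ j) = top" by (metis top.not_eq_extremum)
        then have "ennreal (c j) * E (2 ^ j) = top" using c0[of j] by (simp add: ennreal_mult_eq_top_iff)
        moreover have "ennreal (c j) * E (2 ^ j) \<le> (\<Sum>j\<le>N. ennreal (c j) * E (2 ^ j))"
          using that by (intro member_le_sum) auto
        ultimately have sum_top: "(\<Sum>j\<le>N. ennreal (c j) * E (2 ^ j)) = top" by (simp add: top_unique)
        show False using fin[unfolded sum_top] C by (simp add: ennreal_mult_top)
      qed
      define b where "b = (\<lambda>j. enn2real (E (2 ^ j)))"
      have Eb: "E (2 ^ j) = ennreal (b j)" if "j \<le> N" for j
        using Efin[OF that] by (simp add: b_def less_top)
      have cb0: "0 \<le> c j * b j" for j using c0[of j] by (simp add: b_def)
      define S where "S = (\<Sum>j\<le>N. c j)"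
      have S: "0 < S" unfolding S_def by (intro sum_pos c0) auto
      \<comment> \<open>After summation against c j and multiplication by C, the added constant
        amounts to exactly e; it also makes every B j positive.\<close>
      define B where "B = (\<lambda>j. b j + e / (C * S))"
      have B: "0 < B j" and bB: "b j < B j" for j
        using C S e by (auto simp: B_def b_def intro!: add_nonneg_pos divide_pos_pos mult_pos_pos)
      have "\<exists>P. degree P < 2 ^ j \<and> wnorm p (avg_weight w (2 ^ j)) (\<lambda>x. f x - poly P x) \<le> ennreal (B j)" if "j \<le> N" for j
      proof -
        have "E (2 ^ j) < ennreal (B j)" unfolding Eb[OF that] using bB[of j] by (simp add: b_def ennreal_less_iff)
        then show ?thesis
          unfolding E_def best_approx_def INF_less_iff by (auto simp: Pi_polys_def intro: less_imp_le)
      qed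
      then obtain P where P: "\<And>j. j \<le> N \<Longrightarrow> degree (P j) < 2 ^ j"
          "\<And>j. j \<le> N \<Longrightarrow> wnorm p (avg_weight w (2 ^ j)) (\<lambda>x. f x - poly (P j) x) \<le> ennreal (B j)"
        by metis
      have nb: "norm_le p (\<lambda>x. (g x - poly (P j) x) * avg_weight w (2 ^ j) x powr (1 / lam p)) (B j)" if "j \<le> N" for j
      proof -
        have [measurable]: "poly (P j) \<in> borel_measurable borel"
          by (intro borel_measurable_continuous_onI continuous_intros)
        have "AE x in lborel. x \<in> {-1..1} \<longrightarrow> f x - poly (P j) x = g x - poly (P j) x"
          using fg by eventually_elim simp
        then show ?thesis
          using wnorm_avg_weight_le_iff[OF p w, of "2 ^ j" "B j" "\<lambda>x. g x - poly (P j) x" "\<lambda>x. f x - poly (P j) x"]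
            P(2)[OF that] B[of j] by simp
      qed
      define X where "X = C * (\<Sum>j\<le>N. c j * B j)"
      have X0: "0 \<le> X" unfolding X_def using C c0 B by (intro mult_nonneg_nonneg sum_nonneg) (auto intro: less_imp_le)
      have "modulus r f (1 / real n) p (avg_weight w n) \<le> ennreal X"
        unfolding modulus_def
      proof (rule SUP_least)
        fix h assume "h \<in> {0<..1 / real n}"
        then have h: "0 < h" "h \<le> 1 / real n" by auto
        have "norm_le p (\<lambda>x. symmetric_difference r (h * phi x) g x * avg_weight w n x powr (1 / lam p)) X"
          unfolding X_def c_def using P(1) B nb N h by (intro tel[rule_format, OF w wW gm]) auto
        then show "wnorm p (avg_weight w n) (\<lambda>x. symmetric_difference r (h * phi x) f x) \<le> ennreal X"
          using wnorm_avg_weight_le_iff[OF p w n1 X0 _ AE_symmetric_difference_eq[OF fg r h(1)]] by simp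
      qed
      also have "X = C * (\<Sum>j\<le>N. c j * b j) + e"
      proof -
        have "(\<Sum>j\<le>N. c j * (b j + d)) = (\<Sum>j\<le>N. c j * b j) + S * d" for d
          by (simp add: distrib_left sum.distrib S_def sum_distrib_right)
        then have "(\<Sum>j\<le>N. c j * B j) = (\<Sum>j\<le>N. c j * b j) + S * (e / (C * S))"
          unfolding B_def .
        then show ?thesis using C S by (simp add: X_def distrib_left)
      qed
      also have "ennreal (C * (\<Sum>j\<le>N. c j * b j) + e) = ennreal (C * (\<Sum>j\<le>N. c j * b j)) + ennreal e"
        using C e cb0 by (intro ennreal_plus mult_nonneg_nonneg[of C] sum_nonneg) auto
      also have "ennreal (C * (\<Sum>j\<le>N. c j * b j)) = ennreal C * (\<Sum>j\<le>N. ennreal (c j) * E (2 ^ j))"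
      proof -
        have "ennreal (\<Sum>j\<le>N. c j * b j) = (\<Sum>j\<le>N. ennreal (c j * b j))"
          by (rule sum_ennreal[symmetric]) (rule cb0)
        also have "\<dots> = (\<Sum>j\<le>N. ennreal (c j) * E (2 ^ j))"
          using c0 by (intro sum.cong refl) (simp add: Eb ennreal_mult' less_imp_le)
        finally show ?thesis using C by (simp add: ennreal_mult')
      qed
      finally show "modulus r f (1 / real n) p (avg_weight w n)
          \<le> ennreal C * (\<Sum>j\<le>N. ennreal (c j) * E (2 ^ j)) + ennreal e" .
    qed
    also have "(\<Sum>j\<le>N. ennreal (c j) * E (2 ^ j))
        = ennreal (1 / real n powr \<beta>) * (\<Sum>j\<le>N. ennreal ((2 ^ j) powr \<beta>) * E (2 ^ j))"
    proof -
      have "ennreal (c j) = ennreal (1 / real n powr \<beta>) * ennreal ((2 ^ j) powr \<beta>)" for j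
        by (subst ennreal_mult[symmetric]) (auto simp: c_def powr_divide)
      then show ?thesis by (simp add: sum_distrib_left mult.assoc)
    qed
    also have "(\<Sum>j\<le>N. ennreal ((2 ^ j) powr \<beta>) * E (2 ^ j))
        \<le> ennreal C' * (\<Sum>k=1..2 ^ N. ennreal (real k powr (\<beta> - 1)) * E k)"
      unfolding C'_def E_def by (intro dyadic_sum_le best_approx_double[OF p w _ _ _ f])
    also have "(\<Sum>k=1..2 ^ N. ennreal (real k powr (\<beta> - 1)) * E k)
        \<le> (\<Sum>k=1..n. ennreal (real k powr (\<beta> - 1)) * E k)"
      using N by (intro sum_mono2) auto
    finally have "modulus r f (1 / real n) p (avg_weight w n)
        \<le> ennreal C * (ennreal (1 / real n powr \<beta>) * (ennreal C' * (\<Sum>k=1..n. ennreal (real k powr (\<beta> - 1)) * E k)))"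
      by (simp add: mult_left_mono)
    also have "\<dots> = ennreal (C * C' / real n powr \<beta>) * (\<Sum>k=1..n. ennreal (real k powr (\<beta> - 1)) * E k)"
    proof -
      have "ennreal (C * C' / real n powr \<beta>) = ennreal C * (ennreal (1 / real n powr \<beta>) * ennreal C')"
        using C by (simp add: C'_def flip: ennreal_mult)
      then show ?thesis by (simp add: mult.assoc)
    qed
    finally show "modulus r f (1 / real n) p (avg_weight w n)
        \<le> ennreal (C * C' / real n powr (real r - \<delta> / lam p)) *
          (\<Sum>k=1..n. ennreal (real k powr (real r - 1 - \<delta> / lam p)) * best_approx k f p (avg_weight w k))"
      by (simp add: \<beta>_def E_def algebra_simps)
  qed
qed

end
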